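(* Consider the supOUSV model $(X,Y)$ defined in the context, and assume that $$\pi(\mathrm{d}r)=\gamma_{\alpha_r,\beta_r}(r)\,\mathrm{d}r,\qquad \rho(\mathrm{d}R)=\gamma_{\alpha_R,\beta_R}(R)\,\mathrm{d}R,\qquad \alpha_r-1,\ \alpha_R,\ \beta_r,\ \beta_R>0,$$ where $\gamma_{\alpha,\beta}(x)=\frac{1}{\Gamma(\alpha)\beta^{\alpha}}x^{\alpha-1}e^{-x/\beta}$ for $x>0$, and that $$(\alpha_r-1)(\alpha_R+2)>1\quad\text{if }\alpha_r\in(1,2].$$ Then the autocorrelation $\mathrm{AC}_X(h)$ of $X$ at lag $h\geq 0$ satisfies $\lim_{h\to+\infty}\mathrm{AC}_X(h)=0$. Moreover, as $h\to+\infty$: if $\alpha_r>2$, then $$\mathrm{AC}_X(h)\le\sigma^2O\left(h^{-\alpha_R}\right)+\mu^2\left\{O\left(h^{-\alpha_R}\right)+O\left(h^{-(\alpha_r-2)}\right)\right\};$$ if $\alpha_r\in(1,2]$, then $$\mathrm{AC}_X(h)\le\sigma^2O\left(h^{-\alpha_R}\right)+\mu^2\left\{O\left(h^{-\alpha_R}\right)+O\left(h^{-\eta}\right)\right\}\quad\text{with}\quad \eta=\frac{(\alpha_r-1)(\alpha_R+2)-1}{\alpha_R+2}>0.$$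
   Context: Work on a complete (filtered) probability space; $\mathbb{E}$ and $\mathbb{V}$ denote expectation and variance. Measures and parameters. $\nu$ is the (nonzero) Lévy measure on $(0,+\infty)$ of a pure-jump subordinator with $\int_0^{+\infty}z^k\,\nu(\mathrm{d}z)<+\infty$ for $k=1,2,3,\dots$; $\pi$ is a probability measure on $(0,+\infty)$ with $\int_0^{+\infty}r^{-1}\pi(\mathrm{d}r)<+\infty$ (for the gamma density this holds since $\alpha_r>1$); $\rho$ is a probability measure on $(0,+\infty)$; $\mu\in\mathbb{R}$ and $\sigma>0$ are constants. Noises. $N$ is a Poisson random measure on $\mathbb{R}\times(0,+\infty)\times(0,+\infty)$ with compensator (intensity) $\mathrm{d}s\,\nu(\mathrm{d}z)\,\pi(\mathrm{d}r)$. $B(\mathrm{d}R,\mathrm{d}s)$ is a centered space-time Gaussian random measure (white noise) on $(0,+\infty)\times\mathbb{R}$ with control measure $\rho(\mathrm{d}R)\,\mathrm{d}s$, i.e. $\mathbb{E}[B(A)B(A')]=(\rho\otimes\mathrm{Leb})(A\cap A')$ for Borel sets $A,A'$ of finite measure. $B$ and $N$ are mutually independent. supOUSV model (in its stationary state). For $t\in\mathbb{R}$, $$Y_t=\int_{s=-\infty}^{s=t}\int_{z=0}^{z=+\infty}\int_{r=0}^{r=+\infty}z\,e^{-r(t-s)}N(\mathrm{d}s,\mathrm{d}z,\mathrm{d}r),$$ $$X_t=\int_{R=0}^{R=+\infty}\int_{s=-\infty}^{s=t}e^{-R(t-s)}\left\{R\mu\,(Y_s-\overline{Y})\,\rho(\mathrm{d}R)\,\mathrm{d}s+\sigma\sqrt{R\,Y_s}\,B(\mathrm{d}R,\mathrm{d}s)\right\},$$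 where $\overline{Y}=\mathbb{E}[Y_t]$ (independent of $t$ because $Y$ is stationary), and the integral against $B$ is in the Itô sense. The autocorrelation of $X$ at lag $h\ge0$ is $\mathrm{AC}_X(h)=\mathbb{E}\bigl[(X_t-\mathbb{E}[X_t])(X_{t+h}-\mathbb{E}[X_{t+h}])\bigr]/\mathbb{V}[X_t]$, where $X$ is stationary with $\mathbb{E}[X_t]=0$. The $O(\cdot)$ terms are as $h\to+\infty$ for fixed model parameters (the implied constants may depend on $\nu,\alpha_r,\beta_r,\alpha_R,\beta_R,\mu,\sigma$). *)

theory Defs
  imports "HOL-Probability.Probability" "HOL-Library.Landau_Symbols"
begin

definition gamma_density :: "real \<Rightarrow> real \<Rightarrow> real \<Rightarrow> real" where
  "gamma_density \<alpha> \<beta> x =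
     (if x > 0 then x powr (\<alpha> - 1) * exp (- x / \<beta>) / (Gamma \<alpha> * \<beta> powr \<alpha>) else 0)"

definition gamma_measure :: "real \<Rightarrow> real \<Rightarrow> real measure" where
  "gamma_measure \<alpha> \<beta> = density lborel (\<lambda>x. ennreal (gamma_density \<alpha> \<beta> x))"

text \<open>The \<open>\<sigma>\<close>-algebra on \<open>space M\<close> generated by the random variables \<open>V i\<close>, \<open>i \<in> I\<close>.\<close>

definition generated_sets ::
    "'a measure \<Rightarrow> 'i set \<Rightarrow> ('i \<Rightarrow> 'a \<Rightarrow> 'b::topological_space) \<Rightarrow> 'a set set" where
  "generated_sets M I V =
     sigma_sets (space M) {V i -` S \<inter> space M | i S. i \<in> I \<and> S \<in> sets borel}"

text \<open>A Poisson random measure is a random (\<open>[0,\<infinity>]\<close>-valued) measure \<open>N \<omega>\<close>.  The Poisson weights are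
  spelled out because the rate may be \<open>0\<close>, which \<^const>\<open>poisson_pmf\<close> does not cover.\<close>

definition poisson_random_measure ::
    "'a measure \<Rightarrow> 'e measure \<Rightarrow> ('a \<Rightarrow> 'e measure) \<Rightarrow> bool" where
  "poisson_random_measure M \<Lambda> N \<longleftrightarrow>
     (\<forall>\<omega>\<in>space M. sets (N \<omega>) = sets \<Lambda>) \<and>
     (\<forall>A\<in>sets \<Lambda>. (\<lambda>\<omega>. emeasure (N \<omega>) A) \<in> borel_measurable M) \<and>
     (\<forall>A\<in>sets \<Lambda>. emeasure \<Lambda> A < \<infinity> \<longrightarrow>
        (\<forall>k::nat. measure M {\<omega> \<in> space M. emeasure (N \<omega>) A = of_nat k} =
           exp (- measure \<Lambda> A) * measure \<Lambda> A ^ k / fact k)) \<and>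
     (\<forall>A\<in>sets \<Lambda>. emeasure \<Lambda> A = \<infinity> \<longrightarrow> (AE \<omega> in M. emeasure (N \<omega>) A = \<infinity>)) \<and>
     (\<forall>(I::nat set) A. finite I \<and> A ` I \<subseteq> sets \<Lambda> \<and> disjoint_family_on A I \<longrightarrow>
        prob_space.indep_vars M (\<lambda>_. borel) (\<lambda>i \<omega>. emeasure (N \<omega>) (A i)) I)"

definition gaussian_rv :: "'a measure \<Rightarrow> ('a \<Rightarrow> real) \<Rightarrow> bool" where
  "gaussian_rv M V \<longleftrightarrow>
     V \<in> borel_measurable M \<and>
     ((\<exists>m s. s > 0 \<and> distributed M lborel V (\<lambda>x. ennreal (normal_density m s x))) \<or>
      (\<exists>m. AE \<omega> in M. V \<omega> = m))"

text \<open>\<open>B A\<close> is meaningful only for measurable \<open>A\<close> of finite control measure.  Joint Gaussianity is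
  Gaussianity of all finite linear combinations; almost sure additivity follows from the
  covariance.\<close>

definition finite_sets :: "'e measure \<Rightarrow> 'e set set" where
  "finite_sets \<Lambda> = {A \<in> sets \<Lambda>. emeasure \<Lambda> A < \<infinity>}"

definition gaussian_random_measure ::
    "'a measure \<Rightarrow> 'e measure \<Rightarrow> ('e set \<Rightarrow> 'a \<Rightarrow> real) \<Rightarrow> bool" where
  "gaussian_random_measure M \<Lambda> B \<longleftrightarrow>
     (\<forall>\<A> c. finite \<A> \<and> \<A> \<subseteq> finite_sets \<Lambda> \<longrightarrow> gaussian_rv M (\<lambda>\<omega>. \<Sum>A\<in>\<A>. c A * B A \<omega>)) \<and>
     (\<forall>A\<in>finite_sets \<Lambda>. (\<integral>\<omega>. B A \<omega> \<partial>M) = 0) \<and>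
     (\<forall>A\<in>finite_sets \<Lambda>. \<forall>A'\<in>finite_sets \<Lambda>.
        (\<integral>\<omega>. B A \<omega> * B A' \<omega> \<partial>M) = measure \<Lambda> (A \<inter> A'))"

text \<open>Ito integration against a Gaussian random measure \<open>B\<close> with control measure
  \<open>\<rho>(dR) ds\<close>, \<open>\<rho>\<close> finite.  A list of quadruples \<open>(\<xi>, A, a, b)\<close> stands for the elementary
  integrand \<open>\<Sum> \<xi>(\<omega>) 1\<^sub>A(R) 1\<^sub>(\<^sub>a\<^sub>,\<^sub>b\<^sub>](s)\<close>, with \<open>\<xi>\<close> bounded and known at time \<open>a\<close>.  The
  integral is extended to the mean-square closure of the elementary integrands.  The integrand is
  required to be measurable for the completed product measure, so that the mean-square distance is
  a genuine (not merely lower) integral.\<close>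

type_synonym 'a elementary = "(('a \<Rightarrow> real) \<times> real set \<times> real \<times> real) list"

definition elementary_integrand :: "'a measure \<Rightarrow> (real \<Rightarrow> 'a measure) \<Rightarrow> 'a elementary \<Rightarrow> bool" where
  "elementary_integrand M F L \<longleftrightarrow>
     (\<forall>(\<xi>, A, a, b)\<in>set L. \<xi> \<in> borel_measurable (F a) \<and> bounded (\<xi> ` space M) \<and>
        A \<in> sets borel \<and> a \<le> b)"

definition elementary_value :: "'a elementary \<Rightarrow> real \<Rightarrow> real \<Rightarrow> 'a \<Rightarrow> real" where
  "elementary_value L R s \<omega> =
     (\<Sum>(\<xi>, A, a, b)\<leftarrow>L. \<xi> \<omega> * indicator A R * indicator {a<..b} s)"

definition elementary_integral :: "((real \<times> real) set \<Rightarrow> 'a \<Rightarrow> real) \<Rightarrow> 'a elementary \<Rightarrow> 'a \<Rightarrow> real" where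
  "elementary_integral B L \<omega> = (\<Sum>(\<xi>, A, a, b)\<leftarrow>L. \<xi> \<omega> * B (A \<times> {a<..b}) \<omega>)"

definition has_ito_integral ::
    "'a measure \<Rightarrow> (real \<Rightarrow> 'a measure) \<Rightarrow> real measure \<Rightarrow> ((real \<times> real) set \<Rightarrow> 'a \<Rightarrow> real)
      \<Rightarrow> (real \<Rightarrow> real \<Rightarrow> 'a \<Rightarrow> real) \<Rightarrow> ('a \<Rightarrow> real) \<Rightarrow> bool" where
  "has_ito_integral M F \<rho> B H Z \<longleftrightarrow>
     (\<lambda>(\<omega>, R, s). H R s \<omega>) \<in> borel_measurable (completion (M \<Otimes>\<^sub>M (\<rho> \<Otimes>\<^sub>M lborel))) \<and>
     Z \<in> borel_measurable M \<and>
     (\<exists>L. (\<forall>n. elementary_integrand M F (L n)) \<and>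
        (\<lambda>n. \<integral>\<^sup>+(\<omega>, R, s). ennreal ((elementary_value (L n) R s \<omega> - H R s \<omega>)\<^sup>2)
               \<partial>completion (M \<Otimes>\<^sub>M (\<rho> \<Otimes>\<^sub>M lborel))) \<longlonglongrightarrow> 0 \<and>
        (\<lambda>n. \<integral>\<^sup>+\<omega>. ennreal ((elementary_integral B (L n) \<omega> - Z \<omega>)\<^sup>2) \<partial>M) \<longlonglongrightarrow> 0)"

text \<open>Points of the Poisson random measure are triples \<open>(s, z, r)\<close>; points of the white noise are
  pairs \<open>(R, s)\<close>.  Measures on \<open>(0,\<infinity>)\<close> are Borel measures on the real line that do not charge
  \<open>(-\<infinity>, 0]\<close>.  The Levy condition \<open>\<integral> min(1,z) \<nu>(dz) < \<infinity>\<close> is subsumed by the first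
  moment.\<close>

locale supOUSV_parameters =
  fixes \<nu> \<pi> \<rho> :: "real measure" and \<sigma> :: real
  assumes sets_\<nu>: "sets \<nu> = sets borel" and \<nu>_pos: "emeasure \<nu> {..0} = 0"
    and \<nu>_nonzero: "emeasure \<nu> UNIV \<noteq> 0"
    and \<nu>_moments: "\<And>k::nat. k \<ge> 1 \<Longrightarrow> integrable \<nu> (\<lambda>z. z ^ k)"
    and prob_\<pi>: "prob_space \<pi>" and sets_\<pi>: "sets \<pi> = sets borel" and \<pi>_pos: "emeasure \<pi> {..0} = 0"
    and \<pi>_inverse: "integrable \<pi> (\<lambda>r. 1 / r)"
    and prob_\<rho>: "prob_space \<rho>" and sets_\<rho>: "sets \<rho> = sets borel" and \<rho>_pos: "emeasure \<rho> {..0} = 0"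
    and \<sigma>_pos: "\<sigma> > 0"

definition supOU :: "('a \<Rightarrow> (real \<times> real \<times> real) measure) \<Rightarrow> real \<Rightarrow> 'a \<Rightarrow> real" where
  "supOU N t \<omega> =
     (LINT x:{..t} \<times> {0<..} \<times> {0<..}|N \<omega>. (case x of (s, z, r) \<Rightarrow> z * exp (- r * (t - s))))"

text \<open>The stationary mean of the variance process is evaluated at time \<open>0\<close>.\<close>

definition supOUSV_drift ::
    "'a measure \<Rightarrow> real measure \<Rightarrow> real \<Rightarrow> ('a \<Rightarrow> (real \<times> real \<times> real) measure) \<Rightarrow> real \<Rightarrow> 'a \<Rightarrow> real" where
  "supOUSV_drift M \<rho> \<mu> N t \<omega> =
     (LINT x:{0<..} \<times> {..t}|\<rho> \<Otimes>\<^sub>M lborel. (case x of (R, s) \<Rightarrow>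
        exp (- R * (t - s)) * (R * \<mu> * (supOU N s \<omega> - (\<integral>\<omega>'. supOU N 0 \<omega>' \<partial>M)))))"

definition supOUSV_diffusion ::
    "real \<Rightarrow> ('a \<Rightarrow> (real \<times> real \<times> real) measure) \<Rightarrow> real \<Rightarrow> real \<Rightarrow> real \<Rightarrow> 'a \<Rightarrow> real" where
  "supOUSV_diffusion \<sigma> N t R s \<omega> =
     indicator ({0<..} \<times> {..t}) (R, s) * (exp (- R * (t - s)) * (\<sigma> * sqrt (R * supOU N s \<omega>)))"

text \<open>The \<open>\<sigma>\<close>-algebras generated by the values of the noises on a set \<open>T\<close> of times.\<close>

definition poisson_sets :: "'a measure \<Rightarrow> ('a \<Rightarrow> (real \<times> real \<times> real) measure) \<Rightarrow> real set \<Rightarrow> 'a set set" where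
  "poisson_sets M N T = generated_sets M {A \<in> sets borel. A \<subseteq> T \<times> UNIV} (\<lambda>A \<omega>. emeasure (N \<omega>) A)"

definition white_noise_sets ::
    "'a measure \<Rightarrow> real measure \<Rightarrow> ((real \<times> real) set \<Rightarrow> 'a \<Rightarrow> real) \<Rightarrow> real set \<Rightarrow> 'a set set" where
  "white_noise_sets M \<rho> B T = generated_sets M {A \<in> finite_sets (\<rho> \<Otimes>\<^sub>M lborel). A \<subseteq> UNIV \<times> T} B"

text \<open>A solution of the model on a complete filtered probability space: \<open>F\<close> knows both noises up to
  the present, and their joint future is independent of it.\<close>

locale supOUSV =
  supOUSV_parameters \<nu> \<pi> \<rho> \<sigma> + prob_space M + complete_measure M + filtration "space M" F
  for \<nu> \<pi> \<rho> :: "real measure" and \<mu> \<sigma> :: real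
    and M :: "'a measure" and F :: "real \<Rightarrow> 'a measure" +
  fixes N :: "'a \<Rightarrow> (real \<times> real \<times> real) measure"
    and B :: "(real \<times> real) set \<Rightarrow> 'a \<Rightarrow> real"
    and X :: "real \<Rightarrow> 'a \<Rightarrow> real"
  assumes F_events: "\<And>t. sets (F t) \<subseteq> events"
    and F_complete: "\<And>t. null_sets M \<subseteq> sets (F t)"
    and poisson: "poisson_random_measure M (lborel \<Otimes>\<^sub>M (\<nu> \<Otimes>\<^sub>M \<pi>)) N"
    and white_noise: "gaussian_random_measure M (\<rho> \<Otimes>\<^sub>M lborel) B"
    and noises_indep: "indep_set (white_noise_sets M \<rho> B UNIV) (poisson_sets M N UNIV)"
    and noises_adapted:
      "\<And>t. white_noise_sets M \<rho> B {..t} \<union> poisson_sets M N {..t} \<subseteq> sets (F t)"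
    and future_indep:
      "\<And>t. indep_set (sets (F t))
         (sigma_sets (space M) (white_noise_sets M \<rho> B {t<..} \<union> poisson_sets M N {t<..}))"
    and X_rv: "\<And>t. X t \<in> borel_measurable M"
    and X_eq: "\<And>t. \<exists>Z. has_ito_integral M F \<rho> B (supOUSV_diffusion \<sigma> N t) Z \<and>
        (AE \<omega> in M. X t \<omega> = supOUSV_drift M \<rho> \<mu> N t \<omega> + Z \<omega>)"

text \<open>For a stationary process the base time \<open>t\<close> is immaterial.\<close>

definition (in prob_space) autocorrelation :: "(real \<Rightarrow> 'a \<Rightarrow> real) \<Rightarrow> real \<Rightarrow> real \<Rightarrow> real" where
  "autocorrelation X t h =
     expectation (\<lambda>\<omega>. (X t \<omega> - expectation (X t)) * (X (t + h) \<omega> - expectation (X (t + h)))) /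
     variance (X t)"

end

theory Submission
  imports Defs
begin

text \<open>
  Write \<open>Y\<close> for the supOU process, \<open>m\<close> for its mean, \<open>\<Lambda>\<close> for the intensity of the jumps and
  \<open>g\<^sub>s(x)\<close> for the contribution to \<open>Y\<^sub>s\<close> of a jump at the point \<open>x\<close>, so that \<open>Y\<^sub>s = N(g\<^sub>s)\<close>.  The proof computes
  the autocovariance of \<open>X\<close> exactly and then bounds it.

  The process is \<open>X\<^sub>t = D\<^sub>t + Z\<^sub>t\<close> with \<open>D\<close> the drift integral and \<open>Z\<close> the Ito integral.  The kernel
  \<open>R e\<^sup>-\<^sup>R\<^sup>(\<^sup>t\<^sup>-\<^sup>s\<^sup>) \<rho>(dR) ds\<close> on \<open>s \<le> t\<close> has total mass one; let \<open>Q\<^sub>t\<close> be the resulting law of the time \<open>s\<close>.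
  For a fixed realisation of the jumps, Fubini's theorem for \<open>N(\<omega>)\<close> and \<open>Q\<^sub>t\<close> turns the drift into
  \<open>D\<^sub>t = \<mu> (N(G\<^sub>t) - m)\<close> with \<open>G\<^sub>t = \<integral> g\<^sub>s Q\<^sub>t(ds)\<close>
  (\<open>drift_eq_poisson_integral\<close>).  The drift is therefore one integral against the Poisson measure, and
  Campbell's formulas (\<open>campbell_mean\<close>, \<open>campbell_product\<close>) give
  \<open>Cov(D\<^sub>t, D\<^sub>u) = \<mu>\<^sup>2 \<Lambda>(G\<^sub>t G\<^sub>u)\<close>.

  The Ito isometry (\<open>ito_isometry\<close>) gives \<open>E[Z\<^sub>t Z\<^sub>t\<^sub>+\<^sub>h] = \<sigma>\<^sup>2 m L(h) / 2\<close> with \<open>L\<close> the Laplace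
  transform of \<open>\<rho>\<close>.  The mixed terms vanish (\<open>expectation_poisson_integral_mult_ito\<close>): against an elementary
  integrand that starts at time \<open>a\<close>, split the jumps at \<open>a\<close>; the jumps up to \<open>a\<close> belong to the past, of which
  the noise after \<open>a\<close> is independent and centred, and the jumps after \<open>a\<close> are independent of the noise.  Hence
  \<open>E[X\<^sub>t X\<^sub>t\<^sub>+\<^sub>h] = \<sigma>\<^sup>2 m L(h) / 2 + \<mu>\<^sup>2 \<Lambda>(G\<^sub>t G\<^sub>t\<^sub>+\<^sub>h)\<close> (\<open>covariance_X\<close>).

  Both terms are nonnegative and the variance is at least \<open>\<sigma>\<^sup>2 m / 2 > 0\<close>.  The second term is the
  average of \<open>c(|v - s|) = \<Lambda>(g\<^sub>s g\<^sub>v)\<close> over independent \<open>s\<close> and \<open>v\<close> with laws \<open>Q\<^sub>t\<close> and \<open>Q\<^sub>t\<^sub>+\<^sub>h\<close>, where \<open>c\<close> is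
  decreasing.  The event \<open>v \<le> t + h/2\<close> has probability \<open>L(h/2)\<close>, and outside it \<open>v - s \<ge> h/2\<close>; so
  \<open>\<Lambda>(G\<^sub>t G\<^sub>t\<^sub>+\<^sub>h) \<le> c(0) L(h/2) + c(h/2)\<close>.

  For gamma densities \<open>L(h)\<close> decays as \<open>h\<close> to the power \<open>-\<alpha>\<^sub>R\<close> and \<open>c(h)\<close>, a Laplace transform of
  \<open>\<pi>(dr)/r\<close>, as \<open>h\<close> to the power \<open>-(\<alpha>\<^sub>r - 1)\<close>.  The exponent \<open>\<alpha>\<^sub>r - 1\<close> is at least \<open>\<alpha>\<^sub>r - 2\<close> and at least \<open>\<eta>\<close>,
  which gives both rates; since the autocorrelation is nonnegative, its limit is \<open>0\<close>.
\<close>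

section \<open>Square integrability and mean-square limits\<close>

definition square_integrable :: "'a measure \<Rightarrow> ('a \<Rightarrow> real) \<Rightarrow> bool" where
  "square_integrable M f \<longleftrightarrow> f \<in> borel_measurable M \<and> integrable M (\<lambda>x. (f x)\<^sup>2)"

lemma square_integrable_measurable [measurable_dest]:
  "square_integrable M f \<Longrightarrow> f \<in> borel_measurable M"
  by (simp add: square_integrable_def)

lemma square_integrable_iff_nn_integral:
  "square_integrable M f \<longleftrightarrow>
     f \<in> borel_measurable M \<and> (\<integral>\<^sup>+x. ennreal ((f x)\<^sup>2) \<partial>M) < \<infinity>"
  by (auto simp: square_integrable_def integrable_iff_bounded)

lemma square_integrable_mult:
  assumes "square_integrable M f" "square_integrable M g"
  shows "integrable M (\<lambda>x. f x * g x)"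
proof (rule Bochner_Integration.integrable_bound)
  show "integrable M (\<lambda>x. (f x)\<^sup>2 + (g x)\<^sup>2)"
    using assms by (auto simp: square_integrable_def)
  show "(\<lambda>x. f x * g x) \<in> borel_measurable M"
    using assms by (auto simp: square_integrable_def)
  have "\<bar>a * b\<bar> \<le> a\<^sup>2 + b\<^sup>2" for a b :: real
  proof -
    have "2 * (\<bar>a\<bar> * \<bar>b\<bar>) \<le> \<bar>a\<bar>\<^sup>2 + \<bar>b\<bar>\<^sup>2"
      using sum_squares_bound[of "\<bar>a\<bar>" "\<bar>b\<bar>"] by simp
    moreover have "0 \<le> \<bar>a\<bar> * \<bar>b\<bar>" by simp
    ultimately show ?thesis
      unfolding abs_mult power2_abs by linarith
  qed
  then show "AE x in M. norm (f x * g x) \<le> norm ((f x)\<^sup>2 + (g x)\<^sup>2)"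
    by simp
qed

lemma square_integrable_scale:
  assumes "square_integrable M f" shows "square_integrable M (\<lambda>x. c * f x)"
  using assms by (auto simp: square_integrable_def power_mult_distrib)

lemma square_integrable_add:
  assumes "square_integrable M f" "square_integrable M g"
  shows "square_integrable M (\<lambda>x. f x + g x)"
proof -
  have "integrable M (\<lambda>x. (f x)\<^sup>2 + (g x)\<^sup>2 + 2 * (f x * g x))"
    using assms square_integrable_mult[OF assms] by (auto simp: square_integrable_def)
  moreover have "(f x + g x)\<^sup>2 = (f x)\<^sup>2 + (g x)\<^sup>2 + 2 * (f x * g x)" for x
    by (simp add: power2_sum)
  ultimately show ?thesis
    using assms by (auto simp: square_integrable_def)
qed

lemma square_integrable_diff:
  assumes "square_integrable M f" "square_integrable M g"
  shows "square_integrable M (\<lambda>x. f x - g x)"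
  using square_integrable_add[OF assms(1) square_integrable_scale[OF assms(2), of "-1"]] by simp

lemma square_integrable_sum_list:
  assumes "\<And>x. x \<in> set xs \<Longrightarrow> square_integrable M (f x)"
  shows "square_integrable M (\<lambda>\<omega>. \<Sum>x\<leftarrow>xs. f x \<omega>)"
  using assms
proof (induction xs)
  case Nil
  then show ?case by (simp add: square_integrable_def)
next
  case (Cons a xs)
  then show ?case using square_integrable_add[of M "f a"] by simp
qed

lemma square_integrable_bounded_mult:
  fixes f g :: "'a \<Rightarrow> real"
  assumes "square_integrable M f" "g \<in> borel_measurable M" "bounded (g ` space M)"
  shows "square_integrable M (\<lambda>x. g x * f x)"
proof -
  from assms(3) obtain K where K: "\<And>x. x \<in> space M \<Longrightarrow> \<bar>g x\<bar> \<le> K"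
    by (auto simp: bounded_iff)
  have "integrable M (\<lambda>x. (g x * f x)\<^sup>2)"
  proof (rule Bochner_Integration.integrable_bound)
    show "integrable M (\<lambda>x. K\<^sup>2 * (f x)\<^sup>2)"
      using assms(1) by (simp add: square_integrable_def)
    show "AE x in M. norm ((g x * f x)\<^sup>2) \<le> norm (K\<^sup>2 * (f x)\<^sup>2)"
    proof (rule AE_I2)
      fix x assume "x \<in> space M"
      then have "\<bar>g x\<bar>\<^sup>2 \<le> K\<^sup>2"
        using K by (intro power_mono) auto
      then show "norm ((g x * f x)\<^sup>2) \<le> norm (K\<^sup>2 * (f x)\<^sup>2)"
        by (auto simp: power_mult_distrib intro!: mult_right_mono)
    qed
  qed (use assms in \<open>auto simp: square_integrable_def\<close>)
  then show ?thesis using assms by (auto simp: square_integrable_def)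
qed

lemma bounded_mult_image:
  fixes f g :: "'x \<Rightarrow> real"
  assumes "bounded (f ` S)" "bounded (g ` S)"
  shows "bounded ((\<lambda>x. f x * g x) ` S)"
proof -
  obtain K L where K: "\<And>x. x \<in> S \<Longrightarrow> \<bar>f x\<bar> \<le> K" and L: "\<And>x. x \<in> S \<Longrightarrow> \<bar>g x\<bar> \<le> L"
    using assms by (auto simp: bounded_iff)
  have "\<bar>f x * g x\<bar> \<le> \<bar>K\<bar> * \<bar>L\<bar>" if "x \<in> S" for x
    unfolding abs_mult using K[OF that] L[OF that] by (intro mult_mono) auto
  then show ?thesis by (auto simp: bounded_iff)
qed

lemma (in finite_measure) square_integrable_const: "square_integrable M (\<lambda>_. c)"
  by (simp add: square_integrable_def)

lemma (in finite_measure) square_integrable_integrable: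
  assumes "square_integrable M f" shows "integrable M f"
  using square_integrable_mult[OF assms square_integrable_const[of 1]] by simp

lemma Cauchy_Schwarz_integral:
  assumes f: "square_integrable M f" and g: "square_integrable M g"
  shows "\<bar>\<integral>x. f x * g x \<partial>M\<bar> \<le> sqrt (\<integral>x. (f x)\<^sup>2 \<partial>M) * sqrt (\<integral>x. (g x)\<^sup>2 \<partial>M)"
proof -
  have [measurable]: "f \<in> borel_measurable M" "g \<in> borel_measurable M"
    using f g by (auto simp: square_integrable_def)
  have fg: "integrable M (\<lambda>x. \<bar>f x * g x\<bar>)"
    using square_integrable_mult[OF f g] by simp
  have "ennreal ((\<integral>x. \<bar>f x * g x\<bar> \<partial>M)\<^sup>2) = (\<integral>\<^sup>+x. ennreal \<bar>f x\<bar> * ennreal \<bar>g x\<bar> \<partial>M)\<^sup>2"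
    using nn_integral_eq_integral[OF fg]
    by (simp add: ennreal_power ennreal_mult[symmetric] abs_mult)
  also have "\<dots> \<le> (\<integral>\<^sup>+x. (ennreal \<bar>f x\<bar>)\<^sup>2 \<partial>M) * (\<integral>\<^sup>+x. (ennreal \<bar>g x\<bar>)\<^sup>2 \<partial>M)"
    by (rule Cauchy_Schwarz_nn_integral) auto
  also have "\<dots> = ennreal (\<integral>x. (f x)\<^sup>2 \<partial>M) * ennreal (\<integral>x. (g x)\<^sup>2 \<partial>M)"
    using f g by (simp add: ennreal_power nn_integral_eq_integral square_integrable_def)
  also have "\<dots> = ennreal ((\<integral>x. (f x)\<^sup>2 \<partial>M) * (\<integral>x. (g x)\<^sup>2 \<partial>M))"
    by (simp add: ennreal_mult)
  finally have "(\<integral>x. \<bar>f x * g x\<bar> \<partial>M)\<^sup>2 \<le> (\<integral>x. (f x)\<^sup>2 \<partial>M) * (\<integral>x. (g x)\<^sup>2 \<partial>M)"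
    by (subst (asm) ennreal_le_iff) auto
  then have "(\<integral>x. \<bar>f x * g x\<bar> \<partial>M) \<le> sqrt (\<integral>x. (f x)\<^sup>2 \<partial>M) * sqrt (\<integral>x. (g x)\<^sup>2 \<partial>M)"
    unfolding real_sqrt_mult[symmetric] by (rule real_le_rsqrt)
  then show ?thesis
    using integral_abs_bound[of M "\<lambda>x. f x * g x"] by linarith
qed

text \<open>A mean-square limit of square integrable functions is within a finite mean-square distance of
  one of them, hence square integrable; only then is the distance a Bochner integral.\<close>

lemma square_integrable_limit:
  assumes F: "\<And>n::nat. square_integrable M (F n)" and f: "f \<in> borel_measurable M"
    and lim: "(\<lambda>n. \<integral>\<^sup>+x. ennreal ((F n x - f x)\<^sup>2) \<partial>M) \<longlonglongrightarrow> 0"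
  shows "square_integrable M f"
    and "(\<lambda>n. sqrt (\<integral>x. (F n x - f x)\<^sup>2 \<partial>M)) \<longlonglongrightarrow> 0"
proof -
  have [measurable]: "F n \<in> borel_measurable M" for n
    using F[of n] by (auto simp: square_integrable_def)
  note f[measurable]
  have "eventually (\<lambda>n. (\<integral>\<^sup>+x. ennreal ((F n x - f x)\<^sup>2) \<partial>M) < 1) sequentially"
    using lim by (rule order_tendstoD(2)) simp
  then obtain n where n: "(\<integral>\<^sup>+x. ennreal ((F n x - f x)\<^sup>2) \<partial>M) < 1"
    by (auto simp: eventually_sequentially)
  then have "square_integrable M (\<lambda>x. F n x - f x)"
    unfolding square_integrable_iff_nn_integral
    by (auto intro: less_trans[OF _ ennreal_one_less_top])
  from square_integrable_diff[OF F[of n] this] show sq: "square_integrable M f"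
    by simp
  have "(\<lambda>n. enn2real (\<integral>\<^sup>+x. ennreal ((F n x - f x)\<^sup>2) \<partial>M)) \<longlonglongrightarrow> enn2real 0"
    using lim by (intro tendsto_enn2real) auto
  then have "(\<lambda>n. \<integral>x. (F n x - f x)\<^sup>2 \<partial>M) \<longlonglongrightarrow> 0"
    by (simp add: integral_eq_nn_integral)
  from tendsto_real_sqrt[OF this]
  show "(\<lambda>n. sqrt (\<integral>x. (F n x - f x)\<^sup>2 \<partial>M)) \<longlonglongrightarrow> 0" by simp
qed

text \<open>Inner products are continuous under mean-square convergence.  This carries identities from
  elementary integrands to Ito integrals.\<close>

lemma tendsto_integral_mult_mean_square:
  assumes F: "\<And>n::nat. square_integrable M (F n)" and f: "f \<in> borel_measurable M"
    and limF: "(\<lambda>n. \<integral>\<^sup>+x. ennreal ((F n x - f x)\<^sup>2) \<partial>M) \<longlonglongrightarrow> 0"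
    and G: "\<And>n::nat. square_integrable M (G n)" and g: "g \<in> borel_measurable M"
    and limG: "(\<lambda>n. \<integral>\<^sup>+x. ennreal ((G n x - g x)\<^sup>2) \<partial>M) \<longlonglongrightarrow> 0"
  shows "(\<lambda>n. \<integral>x. F n x * G n x \<partial>M) \<longlonglongrightarrow> (\<integral>x. f x * g x \<partial>M)"
proof -
  note f2 = square_integrable_limit[OF F f limF]
  note g2 = square_integrable_limit[OF G g limG]
  \<comment> \<open>the product differs from its limit by \<open>d e + d g + f e\<close>\<close>
  define d where "d n x = F n x - f x" for n x
  define e where "e n x = G n x - g x" for n x
  have d: "square_integrable M (d n)" and e: "square_integrable M (e n)" for n
    unfolding d_def e_def using F G f2(1) g2(1) by (auto intro: square_integrable_diff)
  let ?N = "\<lambda>u. sqrt (\<integral>x. (u x)\<^sup>2 \<partial>M)"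
  have "\<bar>(\<integral>x. F n x * G n x \<partial>M) - (\<integral>x. f x * g x \<partial>M)\<bar>
      \<le> ?N (d n) * ?N (e n) + ?N (d n) * ?N g + ?N f * ?N (e n)" for n
  proof -
    have "(\<integral>x. F n x * G n x \<partial>M) - (\<integral>x. f x * g x \<partial>M)
        = (\<integral>x. F n x * G n x - f x * g x \<partial>M)"
      using square_integrable_mult[OF F G] square_integrable_mult[OF f2(1) g2(1)] by simp
    also have "\<dots> = (\<integral>x. d n x * e n x + d n x * g x + f x * e n x \<partial>M)"
      by (intro Bochner_Integration.integral_cong) (auto simp: d_def e_def algebra_simps)
    also have "\<dots> = (\<integral>x. d n x * e n x \<partial>M) + (\<integral>x. d n x * g x \<partial>M) + (\<integral>x. f x * e n x \<partial>M)"
      using square_integrable_mult[OF d[of n] e[of n]] square_integrable_mult[OF d[of n] g2(1)]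
        square_integrable_mult[OF f2(1) e[of n]] by simp
    finally show ?thesis
      using Cauchy_Schwarz_integral[OF d[of n] e[of n]] Cauchy_Schwarz_integral[OF d[of n] g2(1)]
        Cauchy_Schwarz_integral[OF f2(1) e[of n]] by linarith
  qed
  then have bound: "\<forall>\<^sub>F n in sequentially. norm ((\<integral>x. F n x * G n x \<partial>M) - (\<integral>x. f x * g x \<partial>M))
      \<le> ?N (d n) * ?N (e n) + ?N (d n) * ?N g + ?N f * ?N (e n)"
    by (intro always_eventually allI) (simp only: real_norm_def)
  have "(\<lambda>n. ?N (d n) * ?N (e n) + ?N (d n) * ?N g + ?N f * ?N (e n))
      \<longlonglongrightarrow> 0 * 0 + 0 * ?N g + ?N f * 0"
    unfolding d_def e_def by (intro tendsto_add tendsto_mult f2(2) g2(2) tendsto_const)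
  then have "(\<lambda>n. ?N (d n) * ?N (e n) + ?N (d n) * ?N g + ?N f * ?N (e n)) \<longlonglongrightarrow> 0"
    by (simp only: mult_zero_left mult_zero_right add_0_right)
  from Lim_null_comparison[OF bound this] show ?thesis by (rule LIM_zero_cancel)
qed

lemma integral_sum_list_mult:
  fixes f :: "'x \<Rightarrow> 'a \<Rightarrow> real" and g :: "'y \<Rightarrow> 'a \<Rightarrow> real"
  assumes f: "\<And>x. x \<in> set xs \<Longrightarrow> square_integrable M (f x)"
    and g: "\<And>y. y \<in> set ys \<Longrightarrow> square_integrable M (g y)"
  shows "(\<integral>\<omega>. (\<Sum>x\<leftarrow>xs. f x \<omega>) * (\<Sum>y\<leftarrow>ys. g y \<omega>) \<partial>M) = (\<Sum>x\<leftarrow>xs. \<Sum>y\<leftarrow>ys. \<integral>\<omega>. f x \<omega> * g y \<omega> \<partial>M)"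
proof -
  have right: "(\<integral>\<omega>. u \<omega> * (\<Sum>y\<leftarrow>ys. g y \<omega>) \<partial>M) = (\<Sum>y\<leftarrow>ys. \<integral>\<omega>. u \<omega> * g y \<omega> \<partial>M)"
    if u: "square_integrable M u" for u
    using g
  proof (induction ys)
    case (Cons y ys)
    have "(\<integral>\<omega>. u \<omega> * g y \<omega> + u \<omega> * (\<Sum>y\<leftarrow>ys. g y \<omega>) \<partial>M)
        = (\<integral>\<omega>. u \<omega> * g y \<omega> \<partial>M) + (\<integral>\<omega>. u \<omega> * (\<Sum>y\<leftarrow>ys. g y \<omega>) \<partial>M)"
      using Cons.prems
      by (intro Bochner_Integration.integral_add square_integrable_mult u square_integrable_sum_list) auto
    with Cons show ?case by (simp add: distrib_left)
  qed simp
  note gs = square_integrable_sum_list[OF g]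
  show ?thesis
    using f
  proof (induction xs)
    case (Cons x xs)
    have "(\<integral>\<omega>. f x \<omega> * (\<Sum>y\<leftarrow>ys. g y \<omega>) + (\<Sum>x\<leftarrow>xs. f x \<omega>) * (\<Sum>y\<leftarrow>ys. g y \<omega>) \<partial>M)
        = (\<integral>\<omega>. f x \<omega> * (\<Sum>y\<leftarrow>ys. g y \<omega>) \<partial>M) + (\<integral>\<omega>. (\<Sum>x\<leftarrow>xs. f x \<omega>) * (\<Sum>y\<leftarrow>ys. g y \<omega>) \<partial>M)"
      using Cons.prems
      by (intro Bochner_Integration.integral_add square_integrable_mult gs square_integrable_sum_list) auto
    with Cons show ?case by (simp add: distrib_right right)
  qed simp
qed

text \<open>The form of independence in which the model is given: two \<open>\<sigma>\<close>-algebras, represented as measures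
  on the sample space, with respect to which the factors are measurable.\<close>

lemma (in prob_space) indep_set_integral_mult:
  fixes f g :: "'a \<Rightarrow> real"
  assumes ind: "indep_set (sets S) (sets T)" and sp: "space S = space M" "space T = space M"
    and f: "f \<in> borel_measurable S" "integrable M f"
    and g: "g \<in> borel_measurable T" "integrable M g"
  shows "integrable M (\<lambda>\<omega>. f \<omega> * g \<omega>)"
    and "(\<integral>\<omega>. f \<omega> * g \<omega> \<partial>M) = (\<integral>\<omega>. f \<omega> \<partial>M) * (\<integral>\<omega>. g \<omega> \<partial>M)"
proof -
  have f': "sigma_sets (space M) {f -` A \<inter> space M |A. A \<in> sets borel} \<subseteq> sets S"
    using measurable_sets[OF f(1)] unfolding sp[symmetric]
    by (intro sets.sigma_sets_subset) auto
  have g': "sigma_sets (space M) {g -` A \<inter> space M |A. A \<in> sets borel} \<subseteq> sets T"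
    using measurable_sets[OF g(1)] unfolding sp(2)[symmetric]
    by (intro sets.sigma_sets_subset) auto
  have mono: "indep_set P Q" if "P \<subseteq> sets S" "Q \<subseteq> sets T" for P Q
    using ind that unfolding indep_sets2_eq by blast
  have "indep_set (sigma_sets (space M) {f -` A \<inter> space M |A. A \<in> sets borel})
      (sigma_sets (space M) {g -` A \<inter> space M |A. A \<in> sets borel})"
    by (rule mono[OF f' g'])
  then have "indep_var borel f borel g"
    unfolding indep_var_eq
    by (intro conjI borel_measurable_integrable[OF f(2)] borel_measurable_integrable[OF g(2)])
  then show "integrable M (\<lambda>\<omega>. f \<omega> * g \<omega>)"
    and "(\<integral>\<omega>. f \<omega> * g \<omega> \<partial>M) = (\<integral>\<omega>. f \<omega> \<partial>M) * (\<integral>\<omega>. g \<omega> \<partial>M)"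
    using indep_var_integrable[OF _ f(2) g(2)] indep_var_lebesgue_integral[OF _ f(2) g(2)] by auto
qed

section \<open>Monotone limits and positivity of integrals\<close>

text \<open>Holds including \<open>0 * \<infinity>\<close>, where continuity of multiplication would fail.\<close>

lemma SUP_mult_incseq_ennreal:
  fixes f g :: "nat \<Rightarrow> ennreal"
  assumes "incseq f" "incseq g"
  shows "(SUP i. f i) * (SUP i. g i) = (SUP i. f i * g i)"
proof (rule antisym)
  show "(SUP i. f i) * (SUP i. g i) \<le> (SUP i. f i * g i)"
    unfolding SUP_mult_right_ennreal unfolding SUP_mult_left_ennreal
  proof (intro SUP_least)
    fix i j
    have "f i * g j \<le> f (max i j) * g (max i j)"
      using assms by (intro mult_mono) (auto simp: incseq_def)
    then show "f i * g j \<le> (SUP i. f i * g i)"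
      by (rule SUP_upper2[rotated]) simp
  qed
  show "(SUP i. f i * g i) \<le> (SUP i. f i) * (SUP i. g i)"
    by (intro SUP_least mult_mono SUP_upper) auto
qed

lemma nn_integral_SUP_fun:
  fixes U :: "nat \<Rightarrow> 'a \<Rightarrow> ennreal"
  assumes "incseq U" "\<And>i. U i \<in> borel_measurable K"
  shows "(\<integral>\<^sup>+x. (SUP i. U i) x \<partial>K) = (SUP i. \<integral>\<^sup>+x. U i x \<partial>K)"
proof -
  have "(SUP i. U i) = (\<lambda>x. SUP i. U i x)" by (simp add: fun_eq_iff image_comp)
  with nn_integral_monotone_convergence_SUP[OF assms] show ?thesis by simp
qed

lemma nn_integral_positive_half_line:
  fixes K :: "real measure"
  assumes K: "sets K = sets borel" "emeasure K {..0} = 0" "emeasure K UNIV \<noteq> 0"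
    and f: "f \<in> borel_measurable borel" "\<And>x. x > 0 \<Longrightarrow> f x > (0::real)"
  shows "(\<integral>\<^sup>+x. ennreal (indicator {0<..} x * f x) \<partial>K) > 0"
proof (rule ccontr)
  note [measurable_cong] = K(1)
  note [measurable] = f(1)
  have sp: "space K = UNIV" using sets_eq_imp_space_eq[OF K(1)] by simp
  assume "\<not> ?thesis"
  then have "AE x in K. ennreal (indicator {0<..} x * f x) = 0"
    by (subst (asm) not_gr_zero, subst (asm) nn_integral_0_iff_AE) auto
  then have "AE x in K. x \<notin> {0<..}"
    by eventually_elim (use f(2) in \<open>force simp: indicator_def\<close>)
  moreover have "AE x in K. x \<notin> {..0}"
    using K by (intro AE_not_in) (auto simp: null_sets_def)
  ultimately have "AE x in K. False" by eventually_elim auto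
  then show False
    using K(3) by (simp add: AE_iff_measurable[OF sets.top] sp)
qed

section \<open>Poisson random measures and Campbell's formulas\<close>

locale poisson_noise = prob_space M + control: sigma_finite_measure \<Lambda>
  for M :: "'a measure" and \<Lambda> :: "'e measure" +
  fixes N :: "'a \<Rightarrow> 'e measure"
  assumes prm: "poisson_random_measure M \<Lambda> N"
begin

lemma sets_N: "\<omega> \<in> space M \<Longrightarrow> sets (N \<omega>) = sets \<Lambda>"
  using prm by (simp add: poisson_random_measure_def)

lemma measurable_emeasure_N [measurable]:
  "A \<in> sets \<Lambda> \<Longrightarrow> (\<lambda>\<omega>. emeasure (N \<omega>) A) \<in> borel_measurable M"
  using prm by (simp add: poisson_random_measure_def)

lemma prob_emeasure_N: "A \<in> sets \<Lambda> \<Longrightarrow> emeasure \<Lambda> A < \<infinity> \<Longrightarrow>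
    prob {\<omega> \<in> space M. emeasure (N \<omega>) A = of_nat k} = exp (- measure \<Lambda> A) * measure \<Lambda> A ^ k / fact k"
  using prm by (simp add: poisson_random_measure_def)

lemma AE_emeasure_N_infinite:
  "A \<in> sets \<Lambda> \<Longrightarrow> emeasure \<Lambda> A = \<infinity> \<Longrightarrow> AE \<omega> in M. emeasure (N \<omega>) A = \<infinity>"
  using prm by (simp add: poisson_random_measure_def)

lemma indep_emeasure_N:
  assumes "finite (I :: nat set)" "A ` I \<subseteq> sets \<Lambda>" "disjoint_family_on A I"
  shows "indep_vars (\<lambda>_. borel) (\<lambda>i \<omega>. emeasure (N \<omega>) (A i)) I"
proof -
  have "\<forall>(I::nat set) A. finite I \<and> A ` I \<subseteq> sets \<Lambda> \<and> disjoint_family_on A I \<longrightarrow>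
      indep_vars (\<lambda>_. borel) (\<lambda>i \<omega>. emeasure (N \<omega>) (A i)) I"
    using prm unfolding poisson_random_measure_def by (elim conjE)
  from this[rule_format, of I A] assms show ?thesis by simp
qed

lemma space_N: "\<omega> \<in> space M \<Longrightarrow> space (N \<omega>) = space \<Lambda>"
  by (rule sets_eq_imp_space_eq) (rule sets_N)

lemma measurable_N: "\<omega> \<in> space M \<Longrightarrow> f \<in> measurable (N \<omega>) K \<longleftrightarrow> f \<in> measurable \<Lambda> K"
  by (metis measurable_cong_sets sets_N)

definition poisson_weight :: "'e set \<Rightarrow> nat \<Rightarrow> real" where
  "poisson_weight A k = exp (- measure \<Lambda> A) * measure \<Lambda> A ^ k / fact k"

lemma poisson_weight_nonneg: "0 \<le> poisson_weight A k"
  by (simp add: poisson_weight_def)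

text \<open>The recursion that turns the factor \<open>k\<close> in a moment into a shift of the index.\<close>

lemma poisson_weight_Suc: "real (Suc k) * poisson_weight A (Suc k) = measure \<Lambda> A * poisson_weight A k"
proof -
  have "real (Suc k) * (x / (real (Suc k) * y)) = x / y" for x y :: real by simp
  then show ?thesis
    by (simp only: poisson_weight_def fact_Suc power_Suc) (simp add: algebra_simps)
qed

lemma poisson_weight_sums: "poisson_weight A sums 1"
proof -
  have "(\<lambda>k. exp (- measure \<Lambda> A) * (measure \<Lambda> A ^ k /\<^sub>R fact k)) sums
      (exp (- measure \<Lambda> A) * exp (measure \<Lambda> A))"
    by (intro sums_mult exp_converges)
  then show ?thesis
    by (simp add: poisson_weight_def[abs_def] exp_minus divide_inverse mult_ac)
qed

lemma poisson_weight_mean: "(\<lambda>k. real k * poisson_weight A k) sums measure \<Lambda> A"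
proof -
  have "(\<lambda>k. real (Suc k) * poisson_weight A (Suc k)) sums measure \<Lambda> A"
    using sums_mult[OF poisson_weight_sums, of "measure \<Lambda> A" A] unfolding poisson_weight_Suc by simp
  then show ?thesis
    using sums_Suc_iff[where f="\<lambda>k. real k * poisson_weight A k"] by simp
qed

lemma poisson_weight_square:
  "(\<lambda>k. (real k)\<^sup>2 * poisson_weight A k) sums (measure \<Lambda> A + (measure \<Lambda> A)\<^sup>2)"
proof -
  have "(\<lambda>k. measure \<Lambda> A * (real k * poisson_weight A k + poisson_weight A k)) sums
      (measure \<Lambda> A * (measure \<Lambda> A + 1))"
    by (intro sums_mult sums_add poisson_weight_mean poisson_weight_sums)
  moreover have "measure \<Lambda> A * (real k * poisson_weight A k + poisson_weight A k)
      = (real (Suc k))\<^sup>2 * poisson_weight A (Suc k)" for k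
  proof -
    have "(real (Suc k))\<^sup>2 * poisson_weight A (Suc k)
        = real (Suc k) * (real (Suc k) * poisson_weight A (Suc k))"
      by (simp only: power2_eq_square mult.assoc)
    then show ?thesis
      unfolding poisson_weight_Suc by (simp add: algebra_simps)
  qed
  ultimately have "(\<lambda>k. (real (Suc k))\<^sup>2 * poisson_weight A (Suc k)) sums
      (measure \<Lambda> A + (measure \<Lambda> A)\<^sup>2)"
    by (simp add: power2_eq_square algebra_simps)
  then show ?thesis
    using sums_Suc_iff[where f="\<lambda>k. (real k)\<^sup>2 * poisson_weight A k"] by simp
qed

text \<open>The Poisson weights have sum one, so they exhaust the probability.\<close>

lemma AE_emeasure_N_nat:
  assumes A: "A \<in> sets \<Lambda>" "emeasure \<Lambda> A < \<infinity>"
  shows "AE \<omega> in M. \<exists>k::nat. emeasure (N \<omega>) A = of_nat k"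
proof -
  let ?E = "\<lambda>k::nat. {\<omega> \<in> space M. emeasure (N \<omega>) A = of_nat k}"
  have [measurable]: "(\<lambda>\<omega>. emeasure (N \<omega>) A) \<in> borel_measurable M"
    using A by measurable
  have "(\<lambda>k. prob (?E k)) sums prob (\<Union>k. ?E k)"
    by (rule finite_measure_UNION) (auto simp: disjoint_family_on_def)
  moreover have "(\<lambda>k. prob (?E k)) sums 1"
    using poisson_weight_sums[of A] by (simp add: prob_emeasure_N[OF A] poisson_weight_def[abs_def])
  ultimately have "prob (\<Union>k. ?E k) = 1"
    by (rule sums_unique2)
  then have "AE \<omega> in M. \<omega> \<in> (\<Union>k. ?E k)"
    by (intro AE_prob_1)
  then show ?thesis by eventually_elim auto
qed

lemma nn_integral_emeasure_N_discrete:
  assumes A: "A \<in> sets \<Lambda>" "emeasure \<Lambda> A < \<infinity>" and \<phi>: "\<And>k. 0 \<le> \<phi> k"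
    and f: "\<And>k. f (of_nat k) = ennreal (\<phi> k)"
    and sums: "(\<lambda>k. \<phi> k * poisson_weight A k) sums m"
  shows "(\<integral>\<^sup>+\<omega>. f (emeasure (N \<omega>) A) \<partial>M) = ennreal m"
proof -
  let ?E = "\<lambda>k::nat. {\<omega> \<in> space M. emeasure (N \<omega>) A = of_nat k}"
  have [measurable]: "(\<lambda>\<omega>. emeasure (N \<omega>) A) \<in> borel_measurable M"
    using A by measurable
  have disj: "disjoint_family ?E" by (auto simp: disjoint_family_on_def)
  have "(\<integral>\<^sup>+\<omega>. f (emeasure (N \<omega>) A) \<partial>M) = (\<integral>\<^sup>+\<omega>. (\<Sum>k. ennreal (\<phi> k) * indicator (?E k) \<omega>) \<partial>M)"
  proof (rule nn_integral_cong_AE)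
    show "AE \<omega> in M. f (emeasure (N \<omega>) A) = (\<Sum>k. ennreal (\<phi> k) * indicator (?E k) \<omega>)"
      using AE_emeasure_N_nat[OF A] AE_space
    proof eventually_elim
      case (elim \<omega>)
      then obtain k where k: "\<omega> \<in> ?E k" by auto
      from suminf_cmult_indicator[OF disj this, of "\<lambda>k. ennreal (\<phi> k)"] show ?case
        using k by (simp add: f)
    qed
  qed
  also have "\<dots> = (\<Sum>k. ennreal (\<phi> k) * emeasure M (?E k))"
    by (simp add: nn_integral_suminf nn_integral_cmult_indicator)
  also have "\<dots> = (\<Sum>k. ennreal (\<phi> k * poisson_weight A k))"
    unfolding emeasure_eq_measure prob_emeasure_N[OF A] poisson_weight_def[symmetric]
    by (simp add: ennreal_mult \<phi> poisson_weight_nonneg)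
  also have "\<dots> = ennreal m"
    using sums by (intro suminf_ennreal_eq) (auto simp: \<phi> poisson_weight_nonneg)
  finally show ?thesis .
qed

lemma nn_integral_emeasure_N:
  assumes A: "A \<in> sets \<Lambda>"
  shows "(\<integral>\<^sup>+\<omega>. emeasure (N \<omega>) A \<partial>M) = emeasure \<Lambda> A"
proof (cases "emeasure \<Lambda> A = \<infinity>")
  case True
  have "(\<integral>\<^sup>+\<omega>. emeasure (N \<omega>) A \<partial>M) = (\<integral>\<^sup>+\<omega>. \<infinity> \<partial>M)"
    by (rule nn_integral_cong_AE) (rule AE_emeasure_N_infinite[OF A True])
  then show ?thesis using True by (simp add: emeasure_space_1)
next
  case False
  then have "emeasure \<Lambda> A < \<infinity>" by (simp add: top.not_eq_extremum)
  from nn_integral_emeasure_N_discrete[OF A this, where f="\<lambda>x. x", OF _ _ poisson_weight_mean] show ?thesis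
    using False by (simp add: ennreal_of_nat_eq_real_of_nat emeasure_eq_ennreal_measure)
qed

lemma nn_integral_emeasure_N_square:
  assumes A: "A \<in> sets \<Lambda>" "emeasure \<Lambda> A < \<infinity>"
  shows "(\<integral>\<^sup>+\<omega>. emeasure (N \<omega>) A * emeasure (N \<omega>) A \<partial>M) = emeasure \<Lambda> A * emeasure \<Lambda> A + emeasure \<Lambda> A"
proof -
  have "(\<integral>\<^sup>+\<omega>. emeasure (N \<omega>) A * emeasure (N \<omega>) A \<partial>M) = ennreal (measure \<Lambda> A + (measure \<Lambda> A)\<^sup>2)"
    by (rule nn_integral_emeasure_N_discrete[OF A _ _ poisson_weight_square, where f="\<lambda>x. x * x"])
      (auto simp: ennreal_of_nat_eq_real_of_nat power2_eq_square ennreal_mult)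
  also have "\<dots> = emeasure \<Lambda> A * emeasure \<Lambda> A + emeasure \<Lambda> A"
    using A by (simp add: emeasure_eq_ennreal_measure ennreal_plus power2_eq_square ennreal_mult add.commute)
  finally show ?thesis .
qed

lemma nn_integral_emeasure_N_disjoint:
  assumes A: "A \<in> sets \<Lambda>" and B: "B \<in> sets \<Lambda>" and disj: "A \<inter> B = {}"
  shows "(\<integral>\<^sup>+\<omega>. emeasure (N \<omega>) A * emeasure (N \<omega>) B \<partial>M) = emeasure \<Lambda> A * emeasure \<Lambda> B"
proof -
  let ?A = "\<lambda>i::nat. if i = 0 then A else B"
  have "indep_vars (\<lambda>_. borel) (\<lambda>i \<omega>. emeasure (N \<omega>) (?A i)) {0, 1}"
    by (rule indep_emeasure_N) (use A B disj in \<open>auto simp: disjoint_family_on_def\<close>)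
  from indep_vars_nn_integral[OF _ this] show ?thesis
    using A B by (simp add: nn_integral_emeasure_N)
qed

text \<open>Splitting both sets along their intersection leaves one square and three products over disjoint
  sets; the square of \<open>N (A \<inter> B)\<close> contributes the extra term.\<close>

lemma nn_integral_emeasure_N_mult_finite:
  assumes A: "A \<in> sets \<Lambda>" "emeasure \<Lambda> A < \<infinity>" and B: "B \<in> sets \<Lambda>" "emeasure \<Lambda> B < \<infinity>"
  shows "(\<integral>\<^sup>+\<omega>. emeasure (N \<omega>) A * emeasure (N \<omega>) B \<partial>M)
    = emeasure \<Lambda> A * emeasure \<Lambda> B + emeasure \<Lambda> (A \<inter> B)"
proof -
  let ?C = "A \<inter> B" and ?D = "A - B" and ?E = "B - A"
  have C: "emeasure \<Lambda> ?C < \<infinity>"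
    using emeasure_mono[of ?C A \<Lambda>] A by (auto intro: le_less_trans)
  have s[measurable]: "?C \<in> sets \<Lambda>" "?D \<in> sets \<Lambda>" "?E \<in> sets \<Lambda>"
    using A B by auto
  have splitA: "emeasure K A = emeasure K ?C + emeasure K ?D"
    and splitB: "emeasure K B = emeasure K ?C + emeasure K ?E" if "sets K = sets \<Lambda>" for K
    using A B that by (subst plus_emeasure; auto intro!: arg_cong[where f="emeasure K"])+
  have "(\<integral>\<^sup>+\<omega>. emeasure (N \<omega>) A * emeasure (N \<omega>) B \<partial>M)
    = (\<integral>\<^sup>+\<omega>. emeasure (N \<omega>) ?C * emeasure (N \<omega>) ?C + emeasure (N \<omega>) ?C * emeasure (N \<omega>) ?E
       + emeasure (N \<omega>) ?D * emeasure (N \<omega>) ?C + emeasure (N \<omega>) ?D * emeasure (N \<omega>) ?E \<partial>M)"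
    by (intro nn_integral_cong) (simp add: splitA splitB sets_N algebra_simps)
  also have "\<dots> = (emeasure \<Lambda> ?C * emeasure \<Lambda> ?C + emeasure \<Lambda> ?C) + emeasure \<Lambda> ?C * emeasure \<Lambda> ?E
     + emeasure \<Lambda> ?D * emeasure \<Lambda> ?C + emeasure \<Lambda> ?D * emeasure \<Lambda> ?E"
  proof -
    have "?C \<inter> ?E = {}" "?D \<inter> ?C = {}" "?D \<inter> ?E = {}" by auto
    note disj = this[THEN nn_integral_emeasure_N_disjoint[rotated 2]]
    show ?thesis
      by (simp add: nn_integral_add nn_integral_emeasure_N_square[OF s(1) C] disj)
  qed
  also have "\<dots> = (emeasure \<Lambda> ?C + emeasure \<Lambda> ?D) * (emeasure \<Lambda> ?C + emeasure \<Lambda> ?E) + emeasure \<Lambda> ?C"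
    by (simp add: algebra_simps)
  finally show ?thesis by (simp add: splitA splitB)
qed

text \<open>Sets of infinite intensity are reached along an exhaustion of the space by sets of finite intensity.\<close>

lemma nn_integral_emeasure_N_mult:
  assumes A: "A \<in> sets \<Lambda>" and B: "B \<in> sets \<Lambda>"
  shows "(\<integral>\<^sup>+\<omega>. emeasure (N \<omega>) A * emeasure (N \<omega>) B \<partial>M)
    = emeasure \<Lambda> A * emeasure \<Lambda> B + emeasure \<Lambda> (A \<inter> B)"
proof -
  obtain E :: "nat \<Rightarrow> 'e set" where E: "range E \<subseteq> sets \<Lambda>" "(\<Union>i. E i) = space \<Lambda>"
      "\<And>i. emeasure \<Lambda> (E i) \<noteq> \<infinity>" "incseq E"
    by (rule control.sigma_finite_incseq) (rule that)
  have fin: "emeasure \<Lambda> (C \<inter> E i) < \<infinity>" if "C \<in> sets \<Lambda>" for C i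
    using emeasure_mono[of "C \<inter> E i" "E i" \<Lambda>] E(1) E(3)[of i]
    by (auto simp: top.not_eq_extremum intro: le_less_trans)
  have inc: "incseq (\<lambda>i. C \<inter> E i)" for C
    using E(4) unfolding incseq_def by blast
  have exh: "(SUP i. emeasure K (C \<inter> E i)) = emeasure K C"
    if "C \<in> sets \<Lambda>" "sets K = sets \<Lambda>" for C K
  proof -
    have "(\<Union>i. C \<inter> E i) = C"
      using E(2) sets.sets_into_space[OF that(1)] by auto
    then show ?thesis
      using E(1) that inc by (subst SUP_emeasure_incseq) auto
  qed
  have mono: "incseq (\<lambda>i. emeasure K (C \<inter> E i))" if "C \<in> sets \<Lambda>" "sets K = sets \<Lambda>" for C K
    using E(1) that inc[of C] unfolding incseq_def by (blast intro!: emeasure_mono)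
  have "(\<integral>\<^sup>+\<omega>. emeasure (N \<omega>) A * emeasure (N \<omega>) B \<partial>M)
     = (\<integral>\<^sup>+\<omega>. (SUP i. emeasure (N \<omega>) (A \<inter> E i) * emeasure (N \<omega>) (B \<inter> E i)) \<partial>M)"
  proof (rule nn_integral_cong)
    fix \<omega> assume \<omega>: "\<omega> \<in> space M"
    show "emeasure (N \<omega>) A * emeasure (N \<omega>) B
        = (SUP i. emeasure (N \<omega>) (A \<inter> E i) * emeasure (N \<omega>) (B \<inter> E i))"
      using mono[OF A sets_N[OF \<omega>]] mono[OF B sets_N[OF \<omega>]]
      by (subst SUP_mult_incseq_ennreal[symmetric]) (auto simp: exh[OF _ sets_N[OF \<omega>]] A B)
  qed
  also have "\<dots> = (SUP i. \<integral>\<^sup>+\<omega>. emeasure (N \<omega>) (A \<inter> E i) * emeasure (N \<omega>) (B \<inter> E i) \<partial>M)"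
  proof (rule nn_integral_monotone_convergence_SUP_AE)
    show "AE \<omega> in M. emeasure (N \<omega>) (A \<inter> E i) * emeasure (N \<omega>) (B \<inter> E i)
        \<le> emeasure (N \<omega>) (A \<inter> E (Suc i)) * emeasure (N \<omega>) (B \<inter> E (Suc i))" for i
      using AE_space
      by eventually_elim (intro mult_mono incseq_SucD[OF mono] A B sets_N; simp)
    show "(\<lambda>\<omega>. emeasure (N \<omega>) (A \<inter> E i) * emeasure (N \<omega>) (B \<inter> E i)) \<in> borel_measurable M" for i
      using A B E(1) by (intro borel_measurable_times_ennreal measurable_emeasure_N) auto
  qed
  also have "\<dots> = (SUP i. emeasure \<Lambda> (A \<inter> E i) * emeasure \<Lambda> (B \<inter> E i) + emeasure \<Lambda> (A \<inter> B \<inter> E i))"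
    using A B E(1)
    by (subst nn_integral_emeasure_N_mult_finite) (auto simp: fin[simplified] Int_ac intro!: SUP_cong arg_cong[where f="emeasure \<Lambda>"])
  also have "\<dots> = (SUP i. emeasure \<Lambda> (A \<inter> E i) * emeasure \<Lambda> (B \<inter> E i)) + (SUP i. emeasure \<Lambda> (A \<inter> B \<inter> E i))"
    using mono[OF A] mono[OF B] mono[of "A \<inter> B"] A B
    by (intro ennreal_SUP_add) (auto simp: incseq_def intro!: mult_mono)
  also have "\<dots> = emeasure \<Lambda> A * emeasure \<Lambda> B + emeasure \<Lambda> (A \<inter> B)"
    using A B mono[OF A] mono[OF B]
    by (subst SUP_mult_incseq_ennreal[symmetric]) (auto simp: exh)
  finally show ?thesis .
qed

text \<open>Integrals over the part of the Poisson measure inside \<open>T\<close> are known to every \<open>\<sigma>\<close>-algebra that knows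
  the masses inside \<open>T\<close>; the adaptedness and independence of jump integrals rest on this.\<close>

lemma measurable_nn_integral_N_subalgebra:
  assumes S: "space S = space M" and T: "T \<in> sets \<Lambda>"
    and meas: "\<And>A. A \<in> sets \<Lambda> \<Longrightarrow> A \<subseteq> T \<Longrightarrow> (\<lambda>\<omega>. emeasure (N \<omega>) A) \<in> borel_measurable S"
    and G: "G \<in> borel_measurable \<Lambda>"
  shows "(\<lambda>\<omega>. \<integral>\<^sup>+x. G x * indicator T x \<partial>N \<omega>) \<in> borel_measurable S"
  using G
proof (induction G rule: borel_measurable_induct)
  case (cong f g)
  have "(\<integral>\<^sup>+x. f x * indicator T x \<partial>N \<omega>) = (\<integral>\<^sup>+x. g x * indicator T x \<partial>N \<omega>)" if "\<omega> \<in> space S" for \<omega>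
    by (rule nn_integral_cong) (use cong(3) that S in \<open>simp add: space_N\<close>)
  with cong(4) show ?case by (simp cong: measurable_cong)
next
  case (set A)
  have "(\<integral>\<^sup>+x. indicator A x * indicator T x \<partial>N \<omega>) = emeasure (N \<omega>) (A \<inter> T)" if "\<omega> \<in> space S" for \<omega>
    using set T that S by (subst indicator_inter_arith[symmetric]) (simp add: sets_N)
  then show ?case
    using meas[of "A \<inter> T"] set T by (simp cong: measurable_cong)
next
  case (mult u c)
  have "(\<integral>\<^sup>+x. c * u x * indicator T x \<partial>N \<omega>) = c * (\<integral>\<^sup>+x. u x * indicator T x \<partial>N \<omega>)"
    if "\<omega> \<in> space S" for \<omega>
    using mult(2) T that S unfolding mult.assoc
    by (intro nn_integral_cmult) (simp add: measurable_N)
  with mult(4) show ?case by (simp cong: measurable_cong)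
next
  case (add u v)
  have "(\<integral>\<^sup>+x. (v x + u x) * indicator T x \<partial>N \<omega>)
      = (\<integral>\<^sup>+x. v x * indicator T x \<partial>N \<omega>) + (\<integral>\<^sup>+x. u x * indicator T x \<partial>N \<omega>)"
    if "\<omega> \<in> space S" for \<omega>
    using add(1,3) T that S unfolding distrib_right
    by (intro nn_integral_add) (simp_all add: measurable_N)
  with add.IH show ?case by (simp cong: measurable_cong)
next
  case (seq U)
  have "(\<integral>\<^sup>+x. (SUP i. U i) x * indicator T x \<partial>N \<omega>) = (SUP i. \<integral>\<^sup>+x. U i x * indicator T x \<partial>N \<omega>)"
    if "\<omega> \<in> space S" for \<omega>
  proof -
    have "(\<integral>\<^sup>+x. (SUP i. U i) x * indicator T x \<partial>N \<omega>)
        = (\<integral>\<^sup>+x. (SUP i. U i x * indicator T x) \<partial>N \<omega>)"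
      by (simp add: SUP_apply image_comp SUP_mult_right_ennreal)
    also have "\<dots> = (SUP i. \<integral>\<^sup>+x. U i x * indicator T x \<partial>N \<omega>)"
      using seq(1,3) T that S
      by (intro nn_integral_monotone_convergence_SUP)
        (auto simp: measurable_N incseq_def le_fun_def intro!: mult_right_mono)
    finally show ?thesis .
  qed
  with seq.IH show ?case by (simp cong: measurable_cong)
qed

lemma measurable_nn_integral_N [measurable]:
  assumes G: "G \<in> borel_measurable \<Lambda>"
  shows "(\<lambda>\<omega>. \<integral>\<^sup>+x. G x \<partial>N \<omega>) \<in> borel_measurable M"
proof -
  have "(\<integral>\<^sup>+x. G x * indicator (space \<Lambda>) x \<partial>N \<omega>) = (\<integral>\<^sup>+x. G x \<partial>N \<omega>)" if "\<omega> \<in> space M" for \<omega>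
    by (rule nn_integral_cong) (simp add: space_N that)
  then show ?thesis
    using measurable_nn_integral_N_subalgebra[OF refl sets.top measurable_emeasure_N G]
    by (simp cong: measurable_cong)
qed

theorem campbell_mean:
  assumes G: "G \<in> borel_measurable \<Lambda>"
  shows "(\<integral>\<^sup>+\<omega>. \<integral>\<^sup>+x. G x \<partial>N \<omega> \<partial>M) = (\<integral>\<^sup>+x. G x \<partial>\<Lambda>)"
  using G
proof (induction G rule: borel_measurable_induct)
  case (cong f g)
  have "(\<integral>\<^sup>+x. f x \<partial>N \<omega>) = (\<integral>\<^sup>+x. g x \<partial>N \<omega>)" if "\<omega> \<in> space M" for \<omega>
    by (rule nn_integral_cong) (use cong(3) that in \<open>simp add: space_N\<close>)
  with cong(3,4) show ?case by (simp cong: nn_integral_cong)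
next
  case (set A)
  then show ?case
    using nn_integral_emeasure_N[OF set] by (simp add: sets_N cong: nn_integral_cong)
next
  case (mult u c)
  then show ?case
    by (simp add: nn_integral_cmult measurable_N cong: nn_integral_cong)
next
  case (add u v)
  have "(\<integral>\<^sup>+\<omega>. \<integral>\<^sup>+x. v x + u x \<partial>N \<omega> \<partial>M) = (\<integral>\<^sup>+\<omega>. (\<integral>\<^sup>+x. v x \<partial>N \<omega>) + (\<integral>\<^sup>+x. u x \<partial>N \<omega>) \<partial>M)"
    using add(1,3) by (simp add: nn_integral_add measurable_N cong: nn_integral_cong)
  also have "\<dots> = (\<integral>\<^sup>+x. v x \<partial>\<Lambda>) + (\<integral>\<^sup>+x. u x \<partial>\<Lambda>)"
    using add(1,3) add.IH by (simp add: nn_integral_add)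
  also have "\<dots> = (\<integral>\<^sup>+x. v x + u x \<partial>\<Lambda>)"
    using add(1,3) by (simp add: nn_integral_add)
  finally show ?case .
next
  case (seq U)
  have "(\<integral>\<^sup>+\<omega>. \<integral>\<^sup>+x. (SUP i. U i) x \<partial>N \<omega> \<partial>M) = (\<integral>\<^sup>+\<omega>. (SUP i. \<integral>\<^sup>+x. U i x \<partial>N \<omega>) \<partial>M)"
    using seq(1,3)
    by (intro nn_integral_cong, subst nn_integral_SUP_fun) (auto simp: measurable_N)
  also have "\<dots> = (SUP i. \<integral>\<^sup>+\<omega>. \<integral>\<^sup>+x. U i x \<partial>N \<omega> \<partial>M)"
    using seq(1,3)
    by (intro nn_integral_monotone_convergence_SUP)
      (auto simp: incseq_def le_fun_def intro!: nn_integral_mono)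
  also have "\<dots> = (SUP i. \<integral>\<^sup>+x. U i x \<partial>\<Lambda>)"
    using seq.IH by simp
  also have "\<dots> = (\<integral>\<^sup>+x. (SUP i. U i) x \<partial>\<Lambda>)"
    using seq(1,3) by (subst nn_integral_SUP_fun) auto
  finally show ?case .
qed

text \<open>One step of the extension from sets to functions.  The integrand \<open>G\<close> replaces an indicator while \<open>V\<close>
  is kept fixed, so that two applications yield the product formula: first with \<open>V\<close> the mass of a set,
  then with \<open>V\<close> itself a Poisson integral.\<close>

lemma nn_integral_N_mult_induct:
  assumes V: "V \<in> borel_measurable M" and G: "G \<in> borel_measurable \<Lambda>" and H: "H \<in> borel_measurable \<Lambda>"
    and ind: "\<And>A. A \<in> sets \<Lambda> \<Longrightarrow>
      (\<integral>\<^sup>+\<omega>. V \<omega> * emeasure (N \<omega>) A \<partial>M) = c * emeasure \<Lambda> A + (\<integral>\<^sup>+x. H x * indicator A x \<partial>\<Lambda>)"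
  shows "(\<integral>\<^sup>+\<omega>. V \<omega> * (\<integral>\<^sup>+x. G x \<partial>N \<omega>) \<partial>M) = c * (\<integral>\<^sup>+x. G x \<partial>\<Lambda>) + (\<integral>\<^sup>+x. H x * G x \<partial>\<Lambda>)"
  using G
proof (induction G rule: borel_measurable_induct)
  case (cong f g)
  have "(\<integral>\<^sup>+x. f x \<partial>N \<omega>) = (\<integral>\<^sup>+x. g x \<partial>N \<omega>)" if "\<omega> \<in> space M" for \<omega>
    by (rule nn_integral_cong) (use cong(3) that in \<open>simp add: space_N\<close>)
  with cong(3,4) show ?case by (simp cong: nn_integral_cong)
next
  case (set A)
  then show ?case
    using ind[OF set] by (simp add: sets_N cong: nn_integral_cong)
next
  case (mult u d)
  have "(\<integral>\<^sup>+\<omega>. V \<omega> * (\<integral>\<^sup>+x. d * u x \<partial>N \<omega>) \<partial>M) = (\<integral>\<^sup>+\<omega>. d * (V \<omega> * (\<integral>\<^sup>+x. u x \<partial>N \<omega>)) \<partial>M)"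
    using mult(2) by (simp add: nn_integral_cmult measurable_N mult_ac cong: nn_integral_cong)
  also have "\<dots> = d * (c * (\<integral>\<^sup>+x. u x \<partial>\<Lambda>) + (\<integral>\<^sup>+x. H x * u x \<partial>\<Lambda>))"
    using mult(2,4) V by (simp add: nn_integral_cmult)
  also have "\<dots> = c * (\<integral>\<^sup>+x. d * u x \<partial>\<Lambda>) + (\<integral>\<^sup>+x. d * (H x * u x) \<partial>\<Lambda>)"
    using mult(2) H by (simp add: nn_integral_cmult distrib_left mult_ac)
  finally show ?case by (simp add: mult_ac)
next
  case (add u v)
  have "(\<integral>\<^sup>+\<omega>. V \<omega> * (\<integral>\<^sup>+x. v x + u x \<partial>N \<omega>) \<partial>M)
      = (\<integral>\<^sup>+\<omega>. V \<omega> * (\<integral>\<^sup>+x. v x \<partial>N \<omega>) + V \<omega> * (\<integral>\<^sup>+x. u x \<partial>N \<omega>) \<partial>M)"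
    using add(1,3) by (simp add: nn_integral_add measurable_N distrib_left cong: nn_integral_cong)
  also have "\<dots> = (c * (\<integral>\<^sup>+x. v x \<partial>\<Lambda>) + (\<integral>\<^sup>+x. H x * v x \<partial>\<Lambda>))
      + (c * (\<integral>\<^sup>+x. u x \<partial>\<Lambda>) + (\<integral>\<^sup>+x. H x * u x \<partial>\<Lambda>))"
    using add(1,3) add.IH V by (simp add: nn_integral_add)
  also have "\<dots> = c * (\<integral>\<^sup>+x. v x + u x \<partial>\<Lambda>) + (\<integral>\<^sup>+x. H x * (v x + u x) \<partial>\<Lambda>)"
    using add(1,3) H by (simp add: nn_integral_add distrib_left add_ac)
  finally show ?case .
next
  case (seq U)
  have "(\<integral>\<^sup>+\<omega>. V \<omega> * (\<integral>\<^sup>+x. (SUP i. U i) x \<partial>N \<omega>) \<partial>M)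
      = (\<integral>\<^sup>+\<omega>. (SUP i. V \<omega> * (\<integral>\<^sup>+x. U i x \<partial>N \<omega>)) \<partial>M)"
    using seq(1,3) unfolding SUP_mult_left_ennreal[symmetric]
    by (intro nn_integral_cong, subst nn_integral_SUP_fun) (auto simp: measurable_N)
  also have "\<dots> = (SUP i. \<integral>\<^sup>+\<omega>. V \<omega> * (\<integral>\<^sup>+x. U i x \<partial>N \<omega>) \<partial>M)"
    using seq(1,3) V
    by (intro nn_integral_monotone_convergence_SUP)
      (auto simp: incseq_def le_fun_def intro!: nn_integral_mono mult_left_mono)
  also have "\<dots> = (SUP i. c * (\<integral>\<^sup>+x. U i x \<partial>\<Lambda>) + (\<integral>\<^sup>+x. H x * U i x \<partial>\<Lambda>))"
    using seq.IH by simp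
  also have "\<dots> = (SUP i. c * (\<integral>\<^sup>+x. U i x \<partial>\<Lambda>)) + (SUP i. \<integral>\<^sup>+x. H x * U i x \<partial>\<Lambda>)"
    using seq(3) by (intro ennreal_SUP_add)
      (auto simp: incseq_def le_fun_def intro!: nn_integral_mono mult_left_mono)
  also have "(SUP i. c * (\<integral>\<^sup>+x. U i x \<partial>\<Lambda>)) = c * (\<integral>\<^sup>+x. (SUP i. U i) x \<partial>\<Lambda>)"
    unfolding SUP_mult_left_ennreal[symmetric]
    using seq(1,3) by (subst nn_integral_SUP_fun) auto
  also have "(SUP i. \<integral>\<^sup>+x. H x * U i x \<partial>\<Lambda>) = (\<integral>\<^sup>+x. (SUP i. H x * U i x) \<partial>\<Lambda>)"
    using seq(1,3) H
    by (intro nn_integral_monotone_convergence_SUP[symmetric])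
      (auto simp: incseq_def le_fun_def intro!: mult_left_mono)
  also have "\<dots> = (\<integral>\<^sup>+x. H x * (SUP i. U i) x \<partial>\<Lambda>)"
    by (simp add: SUP_mult_left_ennreal image_comp)
  finally show ?case .
qed

theorem campbell_product:
  assumes G: "G \<in> borel_measurable \<Lambda>" and H: "H \<in> borel_measurable \<Lambda>"
  shows "(\<integral>\<^sup>+\<omega>. (\<integral>\<^sup>+x. G x \<partial>N \<omega>) * (\<integral>\<^sup>+x. H x \<partial>N \<omega>) \<partial>M)
    = (\<integral>\<^sup>+x. G x \<partial>\<Lambda>) * (\<integral>\<^sup>+x. H x \<partial>\<Lambda>) + (\<integral>\<^sup>+x. G x * H x \<partial>\<Lambda>)"
proof (rule nn_integral_N_mult_induct[OF _ H G])
  show "(\<lambda>\<omega>. \<integral>\<^sup>+x. G x \<partial>N \<omega>) \<in> borel_measurable M" using G by measurable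
  fix A assume A: "A \<in> sets \<Lambda>"
  have "(\<integral>\<^sup>+\<omega>. emeasure (N \<omega>) A * (\<integral>\<^sup>+x. G x \<partial>N \<omega>) \<partial>M)
      = emeasure \<Lambda> A * (\<integral>\<^sup>+x. G x \<partial>\<Lambda>) + (\<integral>\<^sup>+x. indicator A x * G x \<partial>\<Lambda>)"
  proof (rule nn_integral_N_mult_induct[OF _ G])
    fix B assume B: "B \<in> sets \<Lambda>"
    show "(\<integral>\<^sup>+\<omega>. emeasure (N \<omega>) A * emeasure (N \<omega>) B \<partial>M)
        = emeasure \<Lambda> A * emeasure \<Lambda> B + (\<integral>\<^sup>+x. indicator A x * indicator B x \<partial>\<Lambda>)"
      using nn_integral_emeasure_N_mult[OF A B] A B
      by (simp add: indicator_inter_arith[symmetric])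
  qed (use A in auto)
  then show "(\<integral>\<^sup>+\<omega>. (\<integral>\<^sup>+x. G x \<partial>N \<omega>) * emeasure (N \<omega>) A \<partial>M)
      = (\<integral>\<^sup>+x. G x \<partial>\<Lambda>) * emeasure \<Lambda> A + (\<integral>\<^sup>+x. G x * indicator A x \<partial>\<Lambda>)"
    by (simp add: mult.commute)
qed

text \<open>Real-valued, with value \<open>0\<close> where the integral is infinite; this is the convention of the Bochner
  integral for nonnegative integrands, so it agrees with the definition of the supOU process.\<close>

definition poisson_integral :: "('e \<Rightarrow> ennreal) \<Rightarrow> 'a \<Rightarrow> real" where
  "poisson_integral G \<omega> = enn2real (\<integral>\<^sup>+x. G x \<partial>N \<omega>)"

lemma measurable_poisson_integral [measurable]:
  "G \<in> borel_measurable \<Lambda> \<Longrightarrow> poisson_integral G \<in> borel_measurable M"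
  unfolding poisson_integral_def[abs_def] by measurable

lemma AE_nn_integral_N_finite:
  assumes G: "G \<in> borel_measurable \<Lambda>" "(\<integral>\<^sup>+x. G x \<partial>\<Lambda>) < \<infinity>"
  shows "AE \<omega> in M. (\<integral>\<^sup>+x. G x \<partial>N \<omega>) < \<infinity>"
proof -
  have "AE \<omega> in M. (\<integral>\<^sup>+x. G x \<partial>N \<omega>) \<noteq> \<infinity>"
    using G by (intro nn_integral_PInf_AE measurable_nn_integral_N) (auto simp: campbell_mean)
  then show ?thesis by (simp add: top.not_eq_extremum)
qed

lemma expectation_poisson_integral:
  assumes G: "G \<in> borel_measurable \<Lambda>" "(\<integral>\<^sup>+x. G x \<partial>\<Lambda>) < \<infinity>"
  shows "expectation (poisson_integral G) = enn2real (\<integral>\<^sup>+x. G x \<partial>\<Lambda>)"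
proof -
  have "(\<integral>\<^sup>+\<omega>. ennreal (poisson_integral G \<omega>) \<partial>M) = (\<integral>\<^sup>+\<omega>. (\<integral>\<^sup>+x. G x \<partial>N \<omega>) \<partial>M)"
    using AE_nn_integral_N_finite[OF G]
    by (intro nn_integral_cong_AE) (auto simp: poisson_integral_def)
  then show ?thesis
    using G by (subst integral_eq_nn_integral) (auto simp: poisson_integral_def campbell_mean)
qed

lemma nn_integral_poisson_integral_mult:
  assumes G: "G \<in> borel_measurable \<Lambda>" "(\<integral>\<^sup>+x. G x \<partial>\<Lambda>) < \<infinity>"
    and H: "H \<in> borel_measurable \<Lambda>" "(\<integral>\<^sup>+x. H x \<partial>\<Lambda>) < \<infinity>"
  shows "(\<integral>\<^sup>+\<omega>. ennreal (poisson_integral G \<omega> * poisson_integral H \<omega>) \<partial>M)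
    = (\<integral>\<^sup>+x. G x \<partial>\<Lambda>) * (\<integral>\<^sup>+x. H x \<partial>\<Lambda>) + (\<integral>\<^sup>+x. G x * H x \<partial>\<Lambda>)"
  unfolding campbell_product[OF G(1) H(1), symmetric]
  using AE_nn_integral_N_finite[OF G] AE_nn_integral_N_finite[OF H]
  by (intro nn_integral_cong_AE) (auto simp: poisson_integral_def ennreal_mult)

lemma square_integrable_poisson_integral:
  assumes G: "G \<in> borel_measurable \<Lambda>" "(\<integral>\<^sup>+x. G x \<partial>\<Lambda>) < \<infinity>" "(\<integral>\<^sup>+x. G x * G x \<partial>\<Lambda>) < \<infinity>"
  shows "square_integrable M (poisson_integral G)"
  using nn_integral_poisson_integral_mult[OF G(1,2) G(1,2)] G
  by (auto simp: square_integrable_iff_nn_integral power2_eq_square ennreal_mult_less_top)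

text \<open>In the covariance the product of the means cancels, and only the diagonal term of Campbell's
  product formula remains.\<close>

lemma covariance_poisson_integral:
  assumes G: "G \<in> borel_measurable \<Lambda>" "(\<integral>\<^sup>+x. G x \<partial>\<Lambda>) < \<infinity>" "(\<integral>\<^sup>+x. G x * G x \<partial>\<Lambda>) < \<infinity>"
    and H: "H \<in> borel_measurable \<Lambda>" "(\<integral>\<^sup>+x. H x \<partial>\<Lambda>) < \<infinity>" "(\<integral>\<^sup>+x. H x * H x \<partial>\<Lambda>) < \<infinity>"
  shows "(\<integral>\<omega>. (poisson_integral G \<omega> - expectation (poisson_integral G)) *
      (poisson_integral H \<omega> - expectation (poisson_integral H)) \<partial>M) = enn2real (\<integral>\<^sup>+x. G x * H x \<partial>\<Lambda>)"
proof -
  let ?G = "poisson_integral G" and ?H = "poisson_integral H"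
  have G2: "square_integrable M ?G" and H2: "square_integrable M ?H"
    using G H by (auto intro: square_integrable_poisson_integral)
  note int = square_integrable_integrable[OF G2] square_integrable_integrable[OF H2]
    square_integrable_mult[OF G2 H2]
  have "ennreal (expectation (\<lambda>\<omega>. ?G \<omega> * ?H \<omega>)) = (\<integral>\<^sup>+x. G x \<partial>\<Lambda>) * (\<integral>\<^sup>+x. H x \<partial>\<Lambda>) + (\<integral>\<^sup>+x. G x * H x \<partial>\<Lambda>)"
    unfolding nn_integral_poisson_integral_mult[OF G(1,2) H(1,2), symmetric]
    by (rule nn_integral_eq_integral[symmetric]) (auto simp: int, simp add: poisson_integral_def)
  note product = this
  have "(\<integral>\<^sup>+x. G x * H x \<partial>\<Lambda>) \<le> ennreal (expectation (\<lambda>\<omega>. ?G \<omega> * ?H \<omega>))"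
    unfolding product by (rule add_increasing) auto
  also have "\<dots> < \<infinity>" by simp
  finally have "(\<integral>\<^sup>+x. G x * H x \<partial>\<Lambda>) < \<infinity>" .
  with product have eq: "expectation (\<lambda>\<omega>. ?G \<omega> * ?H \<omega>) = enn2real (\<integral>\<^sup>+x. G x \<partial>\<Lambda>) * enn2real (\<integral>\<^sup>+x. H x \<partial>\<Lambda>)
      + enn2real (\<integral>\<^sup>+x. G x * H x \<partial>\<Lambda>)"
    using G(2) H(2)
    by (subst enn2real_ennreal[symmetric])
      (auto simp: enn2real_plus enn2real_mult ennreal_mult_less_top poisson_integral_def intro!: integral_nonneg_AE)
  have "(\<integral>\<omega>. (?G \<omega> - expectation ?G) * (?H \<omega> - expectation ?H) \<partial>M)
      = (\<integral>\<omega>. ?G \<omega> * ?H \<omega> - expectation ?H * ?G \<omega> - expectation ?G * ?H \<omega> + expectation ?G * expectation ?H \<partial>M)"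
    by (intro Bochner_Integration.integral_cong) (auto simp: algebra_simps)
  also have "\<dots> = expectation (\<lambda>\<omega>. ?G \<omega> * ?H \<omega>) - expectation ?G * expectation ?H"
    using int by (simp add: prob_space)
  finally show ?thesis
    using eq G H by (simp add: expectation_poisson_integral)
qed

text \<open>Makes Fubini's theorem applicable to the Poisson measure of a single outcome.\<close>

lemma AE_sigma_finite_N: "AE \<omega> in M. sigma_finite_measure (N \<omega>)"
proof -
  obtain E :: "nat \<Rightarrow> 'e set" where E: "range E \<subseteq> sets \<Lambda>" "(\<Union>i. E i) = space \<Lambda>"
      "\<And>i. emeasure \<Lambda> (E i) \<noteq> \<infinity>"
    by (rule control.sigma_finite) (rule that)
  have "AE \<omega> in M. \<exists>k::nat. emeasure (N \<omega>) (E i) = of_nat k" for i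
    using E by (intro AE_emeasure_N_nat) (auto simp: top.not_eq_extremum)
  then have "AE \<omega> in M. \<forall>i. \<exists>k::nat. emeasure (N \<omega>) (E i) = of_nat k"
    by (simp add: AE_all_countable)
  then show ?thesis using AE_space
  proof eventually_elim
    case (elim \<omega>)
    show ?case
    proof
      have "emeasure (N \<omega>) (E i) \<noteq> \<infinity>" for i
        using elim(1)[rule_format, of i] by (auto simp: ennreal_of_nat_eq_real_of_nat)
      with E elim(2) show "\<exists>A. countable A \<and> A \<subseteq> sets (N \<omega>) \<and> \<Union>A = space (N \<omega>) \<and> (\<forall>a\<in>A. emeasure (N \<omega>) a \<noteq> \<infinity>)"
        by (intro exI[of _ "range E"]) (auto simp: sets_N space_N)
    qed
  qed
qed

end

section \<open>The noises of the model\<close>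

lemma (in prob_space) gaussian_square_integrable:
  assumes "gaussian_rv M V"
  shows "square_integrable M V"
proof -
  have V: "V \<in> borel_measurable M" using assms by (simp add: gaussian_rv_def)
  consider m s where "s > 0" "distributed M lborel V (\<lambda>x. ennreal (normal_density m s x))"
    | m where "AE \<omega> in M. V \<omega> = m"
    using assms by (auto simp: gaussian_rv_def)
  then have "integrable M (\<lambda>\<omega>. (V \<omega>)\<^sup>2)"
  proof cases
    case 1
    have "integrable lborel (\<lambda>x. normal_density m s x * (x - m)^2 + 2 * m * (normal_density m s x * (x - m)^1)
        + m\<^sup>2 * (normal_density m s x * (x - m)^0))"
      using 1(1) by (intro Bochner_Integration.integrable_add integrable_mult_right integrable_normal_moment)
    moreover have "normal_density m s x * (x - m)^2 + 2 * m * (normal_density m s x * (x - m)^1)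
        + m\<^sup>2 * (normal_density m s x * (x - m)^0) = normal_density m s x * x\<^sup>2" for x
      by (simp add: power2_eq_square algebra_simps)
    ultimately have "integrable lborel (\<lambda>x. normal_density m s x * x\<^sup>2)" by simp
    then show ?thesis
      using distributed_integrable[OF 1(2), of "\<lambda>x. x\<^sup>2"] by simp
  next
    case 2
    have "integrable M (\<lambda>_. m\<^sup>2)" by simp
    then show ?thesis
      by (rule integrable_cong_AE_imp) (use 2 V in auto)
  qed
  with V show ?thesis by (simp add: square_integrable_def)
qed

lemma generated_sets_subset_Pow: "generated_sets M I V \<subseteq> Pow (space M)"
  unfolding generated_sets_def by (rule subsetI, rule PowI, erule sigma_sets_into_sp[rotated]) auto

lemma sets_sigma_generated_sets:
  "sets (sigma (space M) (generated_sets M I V)) = generated_sets M I V"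
proof -
  have "sigma_sets (space M) (generated_sets M I V) = generated_sets M I V"
    unfolding generated_sets_def by (rule sigma_sets_sigma_sets_eq) auto
  then show ?thesis
    using generated_sets_subset_Pow[of M I V] by (simp add: sets_measure_of)
qed

lemma measurable_generated_sets:
  fixes V :: "'i \<Rightarrow> 'a \<Rightarrow> 'b::topological_space"
  assumes "i \<in> I" "space S = space M" "generated_sets M I V \<subseteq> sets S"
  shows "V i \<in> borel_measurable S"
proof (rule measurableI)
  fix A :: "'b set" assume "A \<in> sets borel"
  then have "V i -` A \<inter> space M \<in> generated_sets M I V"
    unfolding generated_sets_def using assms(1) by (intro sigma_sets.Basic) auto
  then show "V i -` A \<inter> space S \<in> sets S" using assms by auto
qed simp

context supOUSV_parameters
begin

abbreviation jump_intensity :: "(real \<times> real \<times> real) measure" where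
  "jump_intensity \<equiv> lborel \<Otimes>\<^sub>M (\<nu> \<Otimes>\<^sub>M \<pi>)"

abbreviation noise_control :: "(real \<times> real) measure" where
  "noise_control \<equiv> \<rho> \<Otimes>\<^sub>M lborel"

declare sets_\<nu> [measurable_cong] sets_\<pi> [measurable_cong] sets_\<rho> [measurable_cong]

lemma space_parameter_measures [simp]: "space \<nu> = UNIV" "space \<pi> = UNIV" "space \<rho> = UNIV"
  using sets_\<nu> sets_\<pi> sets_\<rho> by (metis sets_eq_imp_space_eq space_borel)+

text \<open>The measure \<open>\<nu>\<close> may be infinite near \<open>0\<close>; the first moment controls it away from \<open>0\<close>.\<close>

lemma emeasure_\<nu>_tail_finite:
  assumes "c > 0" shows "emeasure \<nu> {c..} < \<infinity>"
proof -
  have "emeasure \<nu> {c..} = (\<integral>\<^sup>+z. indicator {c..} z \<partial>\<nu>)" by (simp add: sets_\<nu>)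
  also have "\<dots> \<le> (\<integral>\<^sup>+z. ennreal (norm (1 / c * z)) \<partial>\<nu>)"
    using assms by (intro nn_integral_mono) (auto split: split_indicator simp: field_simps)
  also have "\<dots> < \<infinity>"
  proof -
    have "integrable \<nu> (\<lambda>z. 1 / c * z)"
      using \<nu>_moments[of 1] by (intro integrable_mult_right) simp
    then show ?thesis unfolding integrable_iff_bounded by (elim conjE)
  qed
  finally show ?thesis .
qed

lemma sigma_finite_\<nu>: "sigma_finite_measure \<nu>"
proof
  let ?A = "insert {..0} (range (\<lambda>n::nat. {1 / real (Suc n)..}))"
  have "z \<in> \<Union>?A" for z :: real
  proof (cases "z \<le> 0")
    case False
    then obtain n where "inverse (real (Suc n)) < z" using reals_Archimedean[of z] by auto
    then show ?thesis by (auto simp: inverse_eq_divide intro!: exI[of _ n])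
  qed auto
  moreover have "emeasure \<nu> a \<noteq> \<infinity>" if "a \<in> ?A" for a
    using that \<nu>_pos emeasure_\<nu>_tail_finite[of "1 / real (Suc n)" for n] by (auto simp: less_top)
  ultimately show "\<exists>A. countable A \<and> A \<subseteq> sets \<nu> \<and> \<Union>A = space \<nu> \<and> (\<forall>a\<in>A. emeasure \<nu> a \<noteq> \<infinity>)"
    by (intro exI[of _ ?A]) (auto simp: sets_\<nu>)
qed

end

sublocale supOUSV_parameters \<subseteq> nu: sigma_finite_measure \<nu>
  by (rule sigma_finite_\<nu>)

sublocale supOUSV_parameters \<subseteq> pi: prob_space \<pi>
  by (rule prob_\<pi>)

sublocale supOUSV_parameters \<subseteq> rho: prob_space \<rho>
  by (rule prob_\<rho>)

sublocale supOUSV_parameters \<subseteq> marks: pair_sigma_finite \<nu> \<pi> ..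

sublocale supOUSV_parameters \<subseteq> mark_measure: sigma_finite_measure "\<nu> \<Otimes>\<^sub>M \<pi>"
  by (rule marks.sigma_finite_measure_axioms)

sublocale supOUSV_parameters \<subseteq> jump: pair_sigma_finite lborel "\<nu> \<Otimes>\<^sub>M \<pi>" ..

sublocale supOUSV_parameters \<subseteq> control: pair_sigma_finite \<rho> lborel ..

lemma (in supOUSV_parameters) sets_jump_intensity: "sets jump_intensity = sets borel"
proof -
  have "sets jump_intensity = sets (borel \<Otimes>\<^sub>M (borel \<Otimes>\<^sub>M borel))"
    by (intro sets_pair_measure_cong sets_lborel sets_\<nu> sets_\<pi>)
  then show ?thesis by (simp only: borel_prod)
qed

sublocale supOUSV \<subseteq> jumps: poisson_noise M jump_intensity N
  by (intro poisson_noise.intro poisson_noise_axioms.intro prob_space_axioms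
      jump.sigma_finite_measure_axioms poisson)

sublocale supOUSV \<subseteq> joint: pair_sigma_finite M noise_control
  by (intro pair_sigma_finite.intro sigma_finite_measure_axioms control.sigma_finite_measure_axioms)

context supOUSV
begin

lemma measurable_F_M: "f \<in> borel_measurable (F t) \<Longrightarrow> f \<in> borel_measurable M"
  by (rule measurable_from_subalg) (simp_all add: subalgebra_def space_F F_events)

lemma measurable_F_mono: "f \<in> borel_measurable (F s) \<Longrightarrow> s \<le> t \<Longrightarrow> f \<in> borel_measurable (F t)"
  by (rule measurable_from_subalg[of "F t" "F s"]) (simp_all add: subalgebra_def space_F sets_F_mono)

text \<open>The joint future of both noises after time \<open>t\<close>; the model makes it independent of \<open>F t\<close>.\<close>

definition future :: "real \<Rightarrow> 'a measure" where
  "future t = sigma (space M) (white_noise_sets M \<rho> B {t<..} \<union> poisson_sets M N {t<..})"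

lemma future_generators: "white_noise_sets M \<rho> B {t<..} \<union> poisson_sets M N {t<..} \<subseteq> Pow (space M)"
  unfolding white_noise_sets_def poisson_sets_def
  by (intro Un_least generated_sets_subset_Pow)

lemma space_future [simp]: "space (future t) = space M"
  using future_generators[of t] by (simp add: future_def space_measure_of_conv)

lemma sets_future:
  "sets (future t) = sigma_sets (space M) (white_noise_sets M \<rho> B {t<..} \<union> poisson_sets M N {t<..})"
  using future_generators[of t] by (simp add: future_def sets_measure_of)

lemma indep_future: "indep_set (sets (F t)) (sets (future t))"
  unfolding sets_future by (rule future_indep)

lemma white_noise_measurable:
  assumes "A \<in> finite_sets noise_control" "A \<subseteq> UNIV \<times> T" "space S = space M"
    and "white_noise_sets M \<rho> B T \<subseteq> sets S"
  shows "B A \<in> borel_measurable S"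
  using assms unfolding white_noise_sets_def
  by (intro measurable_generated_sets[where V=B and I="{A \<in> finite_sets noise_control. A \<subseteq> UNIV \<times> T}" and M=M])
    auto

lemma jumps_measurable:
  assumes "A \<in> sets borel" "A \<subseteq> T \<times> UNIV" "space S = space M"
    and "poisson_sets M N T \<subseteq> sets S"
  shows "(\<lambda>\<omega>. emeasure (N \<omega>) A) \<in> borel_measurable S"
  using assms unfolding poisson_sets_def
  by (intro measurable_generated_sets[where V="\<lambda>A \<omega>. emeasure (N \<omega>) A"
        and I="{A \<in> sets borel. A \<subseteq> T \<times> UNIV}" and M=M]) auto

lemma adapted: "white_noise_sets M \<rho> B {..t} \<subseteq> sets (F t)" "poisson_sets M N {..t} \<subseteq> sets (F t)"
  and in_future: "white_noise_sets M \<rho> B {t<..} \<subseteq> sets (future t)" "poisson_sets M N {t<..} \<subseteq> sets (future t)"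
  using noises_adapted[of t] by (auto simp: sets_future intro: sigma_sets.Basic)

lemma white_noise_square_integrable:
  assumes "A \<in> finite_sets noise_control" shows "square_integrable M (B A)"
proof -
  have all: "\<And>\<A> c. finite \<A> \<and> \<A> \<subseteq> finite_sets noise_control \<Longrightarrow> gaussian_rv M (\<lambda>\<omega>. \<Sum>A\<in>\<A>. c A * B A \<omega>)"
    using white_noise by (simp add: gaussian_random_measure_def)
  from all[of "{A}" "\<lambda>_. 1"] assms show ?thesis
    by (simp add: gaussian_square_integrable)
qed

lemma white_noise_mean: "A \<in> finite_sets noise_control \<Longrightarrow> expectation (B A) = 0"
  using white_noise by (simp add: gaussian_random_measure_def)

lemma white_noise_covariance:
  "A \<in> finite_sets noise_control \<Longrightarrow> A' \<in> finite_sets noise_control \<Longrightarrow>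
    expectation (\<lambda>\<omega>. B A \<omega> * B A' \<omega>) = measure noise_control (A \<inter> A')"
  using white_noise by (simp add: gaussian_random_measure_def)

text \<open>The covariance determines the mean square of the defect of additivity, and that is \<open>0\<close>.\<close>

lemma white_noise_additive:
  assumes C: "C \<in> finite_sets noise_control" and D: "D \<in> finite_sets noise_control" and disj: "C \<inter> D = {}"
  shows "AE \<omega> in M. B (C \<union> D) \<omega> = B C \<omega> + B D \<omega>"
proof -
  let ?V = "\<lambda>\<omega>. B (C \<union> D) \<omega> - B C \<omega> - B D \<omega>"
  have CD: "C \<union> D \<in> finite_sets noise_control"
    using C D emeasure_subadditive[of C noise_control D]
    by (auto simp: finite_sets_def intro: le_less_trans)
  note sq = white_noise_square_integrable[OF C] white_noise_square_integrable[OF D]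
    white_noise_square_integrable[OF CD]
  note [simp] = square_integrable_mult[OF sq(1) sq(1)] square_integrable_mult[OF sq(2) sq(2)]
    square_integrable_mult[OF sq(3) sq(3)] square_integrable_mult[OF sq(3) sq(1)]
    square_integrable_mult[OF sq(3) sq(2)] square_integrable_mult[OF sq(1) sq(2)]
  have V: "square_integrable M ?V"
    by (intro square_integrable_diff sq)
  have U: "measure noise_control (C \<union> D) = measure noise_control C + measure noise_control D"
    using C D disj by (intro measure_Union) (auto simp: finite_sets_def)
  have "(\<integral>\<omega>. (?V \<omega>)\<^sup>2 \<partial>M) = (\<integral>\<omega>. B (C \<union> D) \<omega> * B (C \<union> D) \<omega> + B C \<omega> * B C \<omega> + B D \<omega> * B D \<omega>
      - 2 * (B (C \<union> D) \<omega> * B C \<omega>) - 2 * (B (C \<union> D) \<omega> * B D \<omega>) + 2 * (B C \<omega> * B D \<omega>) \<partial>M)"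
    by (intro Bochner_Integration.integral_cong) (auto simp: power2_eq_square algebra_simps)
  also have "\<dots> = measure noise_control (C \<union> D) + measure noise_control C + measure noise_control D
      - 2 * measure noise_control ((C \<union> D) \<inter> C) - 2 * measure noise_control ((C \<union> D) \<inter> D)
      + 2 * measure noise_control (C \<inter> D)"
    using C D CD by (simp add: white_noise_covariance)
  also have "\<dots> = 0"
    using U disj by (simp add: Int_absorb1 inf_commute Un_Int_distrib Int_Un_distrib2)
  finally have "(\<integral>\<omega>. (?V \<omega>)\<^sup>2 \<partial>M) = 0" .
  then have "AE \<omega> in M. (?V \<omega>)\<^sup>2 = 0"
    using V by (subst (asm) integral_nonneg_eq_0_iff_AE) (auto simp: square_integrable_def)
  then show ?thesis by eventually_elim simp
qed

section \<open>The Ito isometry\<close>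

abbreviation strip :: "real set \<Rightarrow> real \<Rightarrow> real \<Rightarrow> (real \<times> real) set" where
  "strip A a b \<equiv> A \<times> {a<..b}"

lemma strip_finite: "A \<in> sets borel \<Longrightarrow> strip A a b \<in> finite_sets noise_control"
  by (cases "a \<le> b")
    (auto simp: finite_sets_def sets_\<rho> lborel.emeasure_pair_measure_Times ennreal_mult_eq_top_iff
      rho.emeasure_finite less_top[symmetric])

text \<open>Noise after time \<open>a\<close> is centred and independent of everything known at time \<open>a\<close>.\<close>

lemma expectation_past_mult_noise:
  assumes U: "U \<in> borel_measurable (F a)" "integrable M U" and A: "A \<in> sets borel"
  shows "expectation (\<lambda>\<omega>. U \<omega> * B (strip A a b) \<omega>) = 0"
proof -
  note fin = strip_finite[OF A, of a b]
  have "expectation (\<lambda>\<omega>. U \<omega> * B (strip A a b) \<omega>) = expectation U * expectation (B (strip A a b))"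
    using U fin
    by (intro indep_set_integral_mult(2)[OF indep_future[of a]])
      (auto simp: space_F intro!: white_noise_measurable[OF _ _ space_future in_future(1)] square_integrable_integrable
        white_noise_square_integrable)
  then show ?thesis by (simp add: white_noise_mean fin)
qed

lemma strip_additive:
  assumes "A \<in> sets borel" "a \<le> c" "c \<le> b"
  shows "AE \<omega> in M. B (strip A a b) \<omega> = B (strip A a c) \<omega> + B (strip A c b) \<omega>"
proof -
  have "strip A a b = strip A a c \<union> strip A c b" using assms by auto
  moreover have "strip A a c \<inter> strip A c b = {}" by auto
  ultimately show ?thesis
    using white_noise_additive[of "strip A a c" "strip A c b"] assms(1) by (simp add: strip_finite)
qed

lemma strip_increment_square_integrable:
  assumes "\<xi> \<in> borel_measurable M" "bounded (\<xi> ` space M)" "A \<in> sets borel"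
  shows "square_integrable M (\<lambda>\<omega>. \<xi> \<omega> * B (strip A a b) \<omega>)"
  using assms by (intro square_integrable_bounded_mult white_noise_square_integrable strip_finite)

text \<open>If the first interval ends before the second one begins, the second increment is centred given the
  rest.  Otherwise the first interval is cut at \<open>a'\<close>: the part before \<open>a'\<close> contributes nothing for the
  same reason, and the part after \<open>a'\<close> lies, like the second increment, in the future of \<open>a'\<close>, which is
  independent of both coefficients.\<close>

lemma ito_isometry_term_ordered:
  assumes \<xi>: "\<xi> \<in> borel_measurable (F a)" "bounded (\<xi> ` space M)" and A: "A \<in> sets borel"
    and \<xi>': "\<xi>' \<in> borel_measurable (F a')" "bounded (\<xi>' ` space M)" and A': "A' \<in> sets borel"
    and le: "a \<le> a'"
  shows "expectation (\<lambda>\<omega>. (\<xi> \<omega> * B (strip A a b) \<omega>) * (\<xi>' \<omega> * B (strip A' a' b') \<omega>))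
    = expectation (\<lambda>\<omega>. \<xi> \<omega> * \<xi>' \<omega>) * measure noise_control (strip A a b \<inter> strip A' a' b')"
proof -
  note [measurable] = measurable_F_M[OF \<xi>(1)] measurable_F_M[OF \<xi>'(1)]
  have \<xi>F: "\<xi> \<in> borel_measurable (F a')" using \<xi>(1) le by (rule measurable_F_mono)
  have past: "expectation (\<lambda>\<omega>. (\<xi> \<omega> * B (strip A a c) \<omega>) * (\<xi>' \<omega> * B (strip A' a' b') \<omega>)) = 0"
    if c: "c \<le> a'" for c
  proof -
    have "expectation (\<lambda>\<omega>. (\<xi> \<omega> * B (strip A a c) \<omega> * \<xi>' \<omega>) * B (strip A' a' b') \<omega>) = 0"
    proof (rule expectation_past_mult_noise[OF _ _ A'])
      have "B (strip A a c) \<in> borel_measurable (F a')"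
        using c by (intro white_noise_measurable[OF strip_finite[OF A] _ space_F adapted(1)]) auto
      then show "(\<lambda>\<omega>. \<xi> \<omega> * B (strip A a c) \<omega> * \<xi>' \<omega>) \<in> borel_measurable (F a')"
        using \<xi>F \<xi>'(1) by simp
      have "square_integrable M (\<lambda>\<omega>. \<xi>' \<omega> * (\<xi> \<omega> * B (strip A a c) \<omega>))"
        by (intro square_integrable_bounded_mult strip_increment_square_integrable \<xi> \<xi>' A) measurable
      then show "integrable M (\<lambda>\<omega>. \<xi> \<omega> * B (strip A a c) \<omega> * \<xi>' \<omega>)"
        by (intro square_integrable_integrable) (simp add: mult_ac)
    qed
    then show ?thesis by (simp add: mult_ac)
  qed
  show ?thesis
  proof (cases "b \<le> a'")
    case True
    then have "strip A a b \<inter> strip A' a' b' = {}" by auto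
    then show ?thesis using past[OF True] by simp
  next
    case False
    \<comment> \<open>\<open>?P\<close> comes from the part of the first interval before \<open>a'\<close>, \<open>?U ?V\<close> from the part after it\<close>
    let ?U = "\<lambda>\<omega>. \<xi> \<omega> * \<xi>' \<omega>" and ?V = "\<lambda>\<omega>. B (strip A a' b) \<omega> * B (strip A' a' b') \<omega>"
    have measB: "B (strip S c d) \<in> borel_measurable M" if "S \<in> sets borel" for S c d
      using white_noise_square_integrable[OF strip_finite[OF that]] by (rule square_integrable_measurable)
    let ?P = "\<lambda>\<omega>. (\<xi> \<omega> * B (strip A a a') \<omega>) * (\<xi>' \<omega> * B (strip A' a' b') \<omega>)"
    have sq: "square_integrable M (B (strip A a' b))" "square_integrable M (B (strip A' a' b'))"
      by (intro white_noise_square_integrable strip_finite A A')+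
    have [measurable]: "?U \<in> borel_measurable M" by measurable
    have bU: "bounded (?U ` space M)" by (rule bounded_mult_image[OF \<xi>(2) \<xi>'(2)])
    have U: "integrable M ?U"
      using square_integrable_bounded_mult[OF square_integrable_const[of 1] _ bU]
      by (intro square_integrable_integrable) simp
    have V: "integrable M ?V" by (rule square_integrable_mult[OF sq])
    have UV: "integrable M (\<lambda>\<omega>. ?U \<omega> * ?V \<omega>)"
      "expectation (\<lambda>\<omega>. ?U \<omega> * ?V \<omega>) = expectation ?U * expectation ?V"
    proof -
      have "?V \<in> borel_measurable (future a')"
        by (intro borel_measurable_times white_noise_measurable[OF strip_finite _ space_future in_future(1)] A A') auto
      moreover have "?U \<in> borel_measurable (F a')" using \<xi>F \<xi>'(1) by simp
      ultimately show "integrable M (\<lambda>\<omega>. ?U \<omega> * ?V \<omega>)"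
        "expectation (\<lambda>\<omega>. ?U \<omega> * ?V \<omega>) = expectation ?U * expectation ?V"
        using indep_set_integral_mult[OF indep_future[of a'] space_F space_future _ U _ V] by auto
    qed
    have P: "integrable M ?P"
      by (intro square_integrable_mult strip_increment_square_integrable \<xi> \<xi>' A A') measurable
    have "expectation (\<lambda>\<omega>. (\<xi> \<omega> * B (strip A a b) \<omega>) * (\<xi>' \<omega> * B (strip A' a' b') \<omega>))
        = expectation (\<lambda>\<omega>. ?P \<omega> + ?U \<omega> * ?V \<omega>)"
    proof (rule integral_cong_AE)
      show "AE \<omega> in M. (\<xi> \<omega> * B (strip A a b) \<omega>) * (\<xi>' \<omega> * B (strip A' a' b') \<omega>) = ?P \<omega> + ?U \<omega> * ?V \<omega>"
        using strip_additive[OF A le, of b] False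
        by (auto simp: algebra_simps elim: eventually_mono)
      show "(\<lambda>\<omega>. (\<xi> \<omega> * B (strip A a b) \<omega>) * (\<xi>' \<omega> * B (strip A' a' b') \<omega>)) \<in> borel_measurable M"
        using measB[OF A] measB[OF A'] by measurable
      show "(\<lambda>\<omega>. ?P \<omega> + ?U \<omega> * ?V \<omega>) \<in> borel_measurable M"
        by (intro borel_measurable_add borel_measurable_integrable P UV)
    qed
    also have "\<dots> = expectation ?U * expectation ?V"
      using past[OF order_refl] P UV by simp
    also have "expectation ?V = measure noise_control (strip A a' b \<inter> strip A' a' b')"
      by (intro white_noise_covariance strip_finite A A')
    also have "strip A a' b \<inter> strip A' a' b' = strip A a b \<inter> strip A' a' b'"
      using le by auto
    finally show ?thesis .
  qed
qed

lemma ito_isometry_term: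
  assumes \<xi>: "\<xi> \<in> borel_measurable (F a)" "bounded (\<xi> ` space M)" and A: "A \<in> sets borel"
    and \<xi>': "\<xi>' \<in> borel_measurable (F a')" "bounded (\<xi>' ` space M)" and A': "A' \<in> sets borel"
  shows "expectation (\<lambda>\<omega>. (\<xi> \<omega> * B (strip A a b) \<omega>) * (\<xi>' \<omega> * B (strip A' a' b') \<omega>))
    = expectation (\<lambda>\<omega>. \<xi> \<omega> * \<xi>' \<omega>) * measure noise_control (strip A a b \<inter> strip A' a' b')"
proof (cases "a \<le> a'")
  case True
  show ?thesis by (rule ito_isometry_term_ordered[OF assms True])
next
  case False
  then have "a' \<le> a" by simp
  from ito_isometry_term_ordered[OF \<xi>' A' \<xi> A this] show ?thesis
    by (simp add: mult.commute Int_commute)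
qed

text \<open>One summand of an elementary integrand, as a function on the product space, and its integral;
  elementary integrands and integrals are sums of these over a list.\<close>

definition step_value :: "('a \<Rightarrow> real) \<times> real set \<times> real \<times> real \<Rightarrow> 'a \<times> real \<times> real \<Rightarrow> real" where
  "step_value = (\<lambda>(\<xi>, A, a, b) x. \<xi> (fst x) * indicator (strip A a b) (snd x))"

definition step_integral :: "('a \<Rightarrow> real) \<times> real set \<times> real \<times> real \<Rightarrow> 'a \<Rightarrow> real" where
  "step_integral = (\<lambda>(\<xi>, A, a, b) \<omega>. \<xi> \<omega> * B (strip A a b) \<omega>)"

lemma elementary_value_eq: "(\<lambda>(\<omega>, R, s). elementary_value L R s \<omega>) = (\<lambda>x. \<Sum>q\<leftarrow>L. step_value q x)"
  by (auto simp: elementary_value_def step_value_def fun_eq_iff indicator_times mult_ac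
      intro!: arg_cong[where f=sum_list])

lemma elementary_integral_eq: "elementary_integral B L = (\<lambda>\<omega>. \<Sum>q\<leftarrow>L. step_integral q \<omega>)"
  by (auto simp: elementary_integral_def step_integral_def fun_eq_iff intro!: arg_cong[where f=sum_list])

lemma step_integral_square_integrable:
  assumes "elementary_integrand M F L" "q \<in> set L"
  shows "square_integrable M (step_integral q)"
  using assms
  by (auto simp: step_integral_def elementary_integrand_def
      intro!: strip_increment_square_integrable measurable_F_M)

lemma step_value_square_integrable:
  assumes "elementary_integrand M F L" "q \<in> set L"
  shows "square_integrable (M \<Otimes>\<^sub>M noise_control) (step_value q)"
proof -
  obtain \<xi> A a b where q: "q = (\<xi>, A, a, b)" by (cases q)
  then have *: "\<xi> \<in> borel_measurable M" "bounded (\<xi> ` space M)" "A \<in> sets borel"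
    using assms by (auto simp: elementary_integrand_def intro: measurable_F_M)
  note \<xi>[measurable] = *(1)
  have [measurable]: "strip A a b \<in> sets noise_control"
    using strip_finite[OF *(3), of a b] by (simp add: finite_sets_def)
  have "(\<integral>\<^sup>+x. ennreal ((indicator (strip A a b) (snd x))\<^sup>2) \<partial>(M \<Otimes>\<^sub>M noise_control))
      = (\<integral>\<^sup>+x. indicator (space M \<times> strip A a b) x \<partial>(M \<Otimes>\<^sub>M noise_control))"
    by (intro nn_integral_cong) (auto simp: space_pair_measure split: split_indicator)
  also have "\<dots> = emeasure noise_control (strip A a b)"
  proof -
    have s: "strip A a b \<in> sets noise_control"
      using strip_finite[OF *(3), of a b] by (simp only: finite_sets_def mem_Collect_eq)
    have "(\<integral>\<^sup>+x. indicator (space M \<times> strip A a b) x \<partial>(M \<Otimes>\<^sub>M noise_control))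
        = emeasure (M \<Otimes>\<^sub>M noise_control) (space M \<times> strip A a b)"
      by (rule nn_integral_indicator) (rule pair_measureI[OF sets.top s])
    also have "\<dots> = emeasure M (space M) * emeasure noise_control (strip A a b)"
      by (rule sigma_finite_measure.emeasure_pair_measure_Times[OF control.sigma_finite_measure_axioms sets.top s])
    finally show ?thesis by (simp add: emeasure_space_1)
  qed
  also have "\<dots> < \<infinity>" using strip_finite[OF *(3), of a b] by (simp add: finite_sets_def)
  finally have "square_integrable (M \<Otimes>\<^sub>M noise_control) (\<lambda>x. indicator (strip A a b) (snd x))"
    by (simp add: square_integrable_iff_nn_integral)
  moreover have "bounded ((\<lambda>x. \<xi> (fst x)) ` space (M \<Otimes>\<^sub>M noise_control))"
    using *(2) by (auto simp: space_pair_measure bounded_iff)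
  ultimately show ?thesis
    unfolding q step_value_def prod.case by (intro square_integrable_bounded_mult) measurable
qed

lemma step_isometry:
  assumes L: "elementary_integrand M F L" "q \<in> set L" and L': "elementary_integrand M F L'" "q' \<in> set L'"
  shows "(\<integral>\<omega>. step_integral q \<omega> * step_integral q' \<omega> \<partial>M)
    = (\<integral>x. step_value q x * step_value q' x \<partial>(M \<Otimes>\<^sub>M noise_control))"
proof -
  obtain \<xi> A a b where q: "q = (\<xi>, A, a, b)" by (cases q)
  obtain \<xi>' A' a' b' where q': "q' = (\<xi>', A', a', b')" by (cases q')
  have 1: "\<xi> \<in> borel_measurable (F a)" "bounded (\<xi> ` space M)" "A \<in> sets borel"
    using L by (auto simp: elementary_integrand_def q)
  have 2: "\<xi>' \<in> borel_measurable (F a')" "bounded (\<xi>' ` space M)" "A' \<in> sets borel"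
    using L' by (auto simp: elementary_integrand_def q')
  have s[measurable]: "strip A a b \<in> sets noise_control" "strip A' a' b' \<in> sets noise_control"
    using strip_finite[OF 1(3), of a b] strip_finite[OF 2(3), of a' b'] by (auto simp: finite_sets_def)
  have "(\<integral>x. step_value q x * step_value q' x \<partial>(M \<Otimes>\<^sub>M noise_control))
      = (\<integral>\<omega>. (\<integral>y. step_value q (\<omega>, y) * step_value q' (\<omega>, y) \<partial>noise_control) \<partial>M)"
    by (intro joint.integral_fst'[symmetric] square_integrable_mult
        step_value_square_integrable[OF L] step_value_square_integrable[OF L'])
  also have "\<dots> = (\<integral>\<omega>. (\<integral>y. (\<xi> \<omega> * \<xi>' \<omega>) * indicator (strip A a b \<inter> strip A' a' b') y \<partial>noise_control) \<partial>M)"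
    by (intro Bochner_Integration.integral_cong refl)
      (simp add: q q' step_value_def indicator_inter_arith mult_ac)
  also have "\<dots> = (\<integral>\<omega>. (\<xi> \<omega> * \<xi>' \<omega>) * measure noise_control (strip A a b \<inter> strip A' a' b') \<partial>M)"
    using s by simp
  also have "\<dots> = expectation (\<lambda>\<omega>. \<xi> \<omega> * \<xi>' \<omega>) * measure noise_control (strip A a b \<inter> strip A' a' b')"
    by simp
  finally show ?thesis
    using ito_isometry_term[OF 1 2] by (simp add: q q' step_integral_def)
qed

lemma elementary_isometry:
  assumes L: "elementary_integrand M F L" and L': "elementary_integrand M F L'"
  shows "(\<integral>\<omega>. elementary_integral B L \<omega> * elementary_integral B L' \<omega> \<partial>M)
    = (\<integral>x. (case x of (\<omega>, R, s) \<Rightarrow> elementary_value L R s \<omega>) * (case x of (\<omega>, R, s) \<Rightarrow> elementary_value L' R s \<omega>)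
        \<partial>(M \<Otimes>\<^sub>M noise_control))"
  unfolding elementary_integral_eq elementary_value_eq
  by (simp add: integral_sum_list_mult[OF step_integral_square_integrable[OF L] step_integral_square_integrable[OF L']]
      integral_sum_list_mult[OF step_value_square_integrable[OF L] step_value_square_integrable[OF L']]
      step_isometry[OF L _ L'] cong: map_cong)

text \<open>The integrand is measurable only for the completed product measure.  Replacing it by an almost
  everywhere equal version that is measurable for the product itself makes Fubini's theorem available.\<close>

lemma ito_integral_approximation:
  assumes "has_ito_integral M F \<rho> B H Z"
  obtains g L where "g \<in> borel_measurable (M \<Otimes>\<^sub>M noise_control)"
    "AE x in M \<Otimes>\<^sub>M noise_control. g x = (case x of (\<omega>, R, s) \<Rightarrow> H R s \<omega>)"
    "\<And>n::nat. elementary_integrand M F (L n)"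
    "(\<lambda>n. \<integral>\<^sup>+x. ennreal (((case x of (\<omega>, R, s) \<Rightarrow> elementary_value (L n) R s \<omega>) - g x)\<^sup>2)
        \<partial>(M \<Otimes>\<^sub>M noise_control)) \<longlonglongrightarrow> 0"
    "(\<lambda>n. \<integral>\<^sup>+\<omega>. ennreal ((elementary_integral B (L n) \<omega> - Z \<omega>)\<^sup>2) \<partial>M) \<longlonglongrightarrow> 0"
proof -
  from assms obtain g where g: "g \<in> borel_measurable (M \<Otimes>\<^sub>M noise_control)"
      "AE x in M \<Otimes>\<^sub>M noise_control. (case x of (\<omega>, R, s) \<Rightarrow> H R s \<omega>) = g x"
    unfolding has_ito_integral_def by (auto dest!: completion_ex_borel_measurable_real)
  from assms obtain L where L: "\<And>n::nat. elementary_integrand M F (L n)"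
      "(\<lambda>n. \<integral>\<^sup>+(\<omega>, R, s). ennreal ((elementary_value (L n) R s \<omega> - H R s \<omega>)\<^sup>2)
         \<partial>completion (M \<Otimes>\<^sub>M noise_control)) \<longlonglongrightarrow> 0"
      "(\<lambda>n. \<integral>\<^sup>+\<omega>. ennreal ((elementary_integral B (L n) \<omega> - Z \<omega>)\<^sup>2) \<partial>M) \<longlonglongrightarrow> 0"
    unfolding has_ito_integral_def by auto
  have "(\<integral>\<^sup>+(\<omega>, R, s). ennreal ((elementary_value (L n) R s \<omega> - H R s \<omega>)\<^sup>2) \<partial>completion (M \<Otimes>\<^sub>M noise_control))
      = (\<integral>\<^sup>+x. ennreal (((case x of (\<omega>, R, s) \<Rightarrow> elementary_value (L n) R s \<omega>) - g x)\<^sup>2)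
        \<partial>(M \<Otimes>\<^sub>M noise_control))" for n
    unfolding nn_integral_completion
    by (rule nn_integral_cong_AE) (use g(2) in \<open>auto elim!: eventually_mono\<close>)
  with L(2) have L2: "(\<lambda>n. \<integral>\<^sup>+x. ennreal (((case x of (\<omega>, R, s) \<Rightarrow> elementary_value (L n) R s \<omega>) - g x)\<^sup>2)
        \<partial>(M \<Otimes>\<^sub>M noise_control)) \<longlonglongrightarrow> 0" by simp
  show ?thesis
    by (rule that[OF g(1) _ L(1) L2 L(3)]) (use g(2) in \<open>auto elim!: eventually_mono\<close>)
qed

lemma elementary_square_integrable:
  assumes "elementary_integrand M F L"
  shows "square_integrable M (elementary_integral B L)"
    and "square_integrable (M \<Otimes>\<^sub>M noise_control) (\<lambda>(\<omega>, R, s). elementary_value L R s \<omega>)"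
  unfolding elementary_integral_eq elementary_value_eq
  using assms by (auto intro!: square_integrable_sum_list step_integral_square_integrable step_value_square_integrable)

lemma ito_integral_square_integrable:
  assumes "has_ito_integral M F \<rho> B H Z"
  shows "square_integrable M Z"
proof -
  obtain g L where L: "\<And>n::nat. elementary_integrand M F (L n)"
    "(\<lambda>n. \<integral>\<^sup>+\<omega>. ennreal ((elementary_integral B (L n) \<omega> - Z \<omega>)\<^sup>2) \<partial>M) \<longlonglongrightarrow> 0"
    by (rule ito_integral_approximation[OF assms]) (rule that)
  show ?thesis
    using assms by (intro square_integrable_limit(1)[OF elementary_square_integrable(1)[OF L(1)] _ L(2)])
      (simp add: has_ito_integral_def)
qed

text \<open>The exceptional set of a property need not be measurable, so the order of the quantifiers is
  exchanged for a measurable null set that covers it.\<close>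

lemma AE_control_swap:
  assumes "AE x in M \<Otimes>\<^sub>M noise_control. P x"
  shows "AE y in noise_control. AE \<omega> in M. P (\<omega>, y)"
proof -
  obtain Q where Q: "Q \<in> null_sets (M \<Otimes>\<^sub>M noise_control)"
      "{x \<in> space (M \<Otimes>\<^sub>M noise_control). \<not> P x} \<subseteq> Q"
    using assms by (auto simp: eventually_ae_filter)
  have [measurable]: "Q \<in> sets (M \<Otimes>\<^sub>M noise_control)" using Q by auto
  have "AE x in M \<Otimes>\<^sub>M noise_control. x \<notin> Q"
    by (rule AE_not_in[OF Q(1)])
  then have "AE \<omega> in M. AE y in noise_control. (\<omega>, y) \<notin> Q"
    by (rule joint.AE_pair)
  then have "AE y in noise_control. AE \<omega> in M. (\<omega>, y) \<notin> Q"
    by (subst (asm) joint.AE_commute) measurable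
  then show ?thesis
    using AE_space
  proof eventually_elim
    case (elim y)
    from elim(1) AE_space show ?case
      by eventually_elim (use Q(2) elim(2) in \<open>auto simp: space_pair_measure\<close>)
  qed
qed

text \<open>The function \<open>c\<close> is the expectation of the product of the integrands at a fixed point \<open>(R, s)\<close>.  It is
  given separately because its measurability does not follow from that of the integrands, which is only
  known up to a null set of the product.\<close>

theorem ito_isometry:
  assumes Z: "has_ito_integral M F \<rho> B H Z" and Z': "has_ito_integral M F \<rho> B H' Z'"
    and H: "\<And>R s. H R s \<in> borel_measurable M" and H': "\<And>R s. H' R s \<in> borel_measurable M"
    and c: "\<And>R s. expectation (\<lambda>\<omega>. H R s \<omega> * H' R s \<omega>) = c (R, s)" "c \<in> borel_measurable noise_control"
  shows "expectation (\<lambda>\<omega>. Z \<omega> * Z' \<omega>) = (\<integral>y. c y \<partial>noise_control)"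
proof -
  obtain g L where g[measurable]: "g \<in> borel_measurable (M \<Otimes>\<^sub>M noise_control)"
    and ae: "AE x in M \<Otimes>\<^sub>M noise_control. g x = (case x of (\<omega>, R, s) \<Rightarrow> H R s \<omega>)"
    and L: "\<And>n::nat. elementary_integrand M F (L n)"
    "(\<lambda>n. \<integral>\<^sup>+x. ennreal (((case x of (\<omega>, R, s) \<Rightarrow> elementary_value (L n) R s \<omega>) - g x)\<^sup>2)
        \<partial>(M \<Otimes>\<^sub>M noise_control)) \<longlonglongrightarrow> 0"
    "(\<lambda>n. \<integral>\<^sup>+\<omega>. ennreal ((elementary_integral B (L n) \<omega> - Z \<omega>)\<^sup>2) \<partial>M) \<longlonglongrightarrow> 0"
    by (rule ito_integral_approximation[OF Z]) (rule that)
  obtain g' L' where g'[measurable]: "g' \<in> borel_measurable (M \<Otimes>\<^sub>M noise_control)"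
    and ae': "AE x in M \<Otimes>\<^sub>M noise_control. g' x = (case x of (\<omega>, R, s) \<Rightarrow> H' R s \<omega>)"
    and L': "\<And>n::nat. elementary_integrand M F (L' n)"
    "(\<lambda>n. \<integral>\<^sup>+x. ennreal (((case x of (\<omega>, R, s) \<Rightarrow> elementary_value (L' n) R s \<omega>) - g' x)\<^sup>2)
        \<partial>(M \<Otimes>\<^sub>M noise_control)) \<longlonglongrightarrow> 0"
    "(\<lambda>n. \<integral>\<^sup>+\<omega>. ennreal ((elementary_integral B (L' n) \<omega> - Z' \<omega>)\<^sup>2) \<partial>M) \<longlonglongrightarrow> 0"
    by (rule ito_integral_approximation[OF Z']) (rule that)
  have meas: "Z \<in> borel_measurable M" "Z' \<in> borel_measurable M"
    using Z Z' by (auto simp: has_ito_integral_def)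
  have 1: "(\<lambda>n. \<integral>\<omega>. elementary_integral B (L n) \<omega> * elementary_integral B (L' n) \<omega> \<partial>M)
      \<longlonglongrightarrow> (\<integral>\<omega>. Z \<omega> * Z' \<omega> \<partial>M)"
    by (intro tendsto_integral_mult_mean_square elementary_square_integrable meas L L')
  have 2: "(\<lambda>n. \<integral>\<omega>. elementary_integral B (L n) \<omega> * elementary_integral B (L' n) \<omega> \<partial>M)
      \<longlonglongrightarrow> (\<integral>x. g x * g' x \<partial>(M \<Otimes>\<^sub>M noise_control))"
    unfolding elementary_isometry[OF L(1) L'(1)]
    by (intro tendsto_integral_mult_mean_square elementary_square_integrable g g' L L')
  have sq: "square_integrable (M \<Otimes>\<^sub>M noise_control) g" "square_integrable (M \<Otimes>\<^sub>M noise_control) g'"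
    by (intro square_integrable_limit(1)[OF elementary_square_integrable(2)[OF L(1)] g L(2)]
        square_integrable_limit(1)[OF elementary_square_integrable(2)[OF L'(1)] g' L'(2)])+
  have "expectation (\<lambda>\<omega>. Z \<omega> * Z' \<omega>) = (\<integral>x. g x * g' x \<partial>(M \<Otimes>\<^sub>M noise_control))"
    using 1 2 by (rule LIMSEQ_unique)
  also have "\<dots> = (\<integral>y. (\<integral>\<omega>. g (\<omega>, y) * g' (\<omega>, y) \<partial>M) \<partial>noise_control)"
    using joint.integral_snd[of "\<lambda>\<omega> y. g (\<omega>, y) * g' (\<omega>, y)"] square_integrable_mult[OF sq]
    by (simp add: case_prod_beta')
  also have "\<dots> = (\<integral>y. c y \<partial>noise_control)"
  proof (rule integral_cong_AE)
    show "AE y in noise_control. (\<integral>\<omega>. g (\<omega>, y) * g' (\<omega>, y) \<partial>M) = c y"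
      using AE_control_swap[OF ae] AE_control_swap[OF ae'] AE_space
    proof eventually_elim
      case (elim y)
      obtain R s where y: "y = (R, s)" by (cases y)
      note [measurable] = H H'
      have "(\<integral>\<omega>. g (\<omega>, y) * g' (\<omega>, y) \<partial>M) = (\<integral>\<omega>. H R s \<omega> * H' R s \<omega> \<partial>M)"
      proof (rule integral_cong_AE)
        show "AE \<omega> in M. g (\<omega>, y) * g' (\<omega>, y) = H R s \<omega> * H' R s \<omega>"
          using elim(1,2) by eventually_elim (simp add: y)
        have "(\<lambda>\<omega>. (\<omega>, y)) \<in> M \<rightarrow>\<^sub>M M \<Otimes>\<^sub>M noise_control" using elim(3) by simp
        then show "(\<lambda>\<omega>. g (\<omega>, y) * g' (\<omega>, y)) \<in> borel_measurable M" by measurable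
      qed measurable
      with c(1) show ?case by (simp add: y)
    qed
    show "(\<lambda>y. \<integral>\<omega>. g (\<omega>, y) * g' (\<omega>, y) \<partial>M) \<in> borel_measurable noise_control"
      by measurable
  qed (rule c(2))
  finally show ?thesis .
qed

section \<open>The Ito integral is orthogonal to the jumps\<close>

text \<open>Orthogonality to all Ito integrals need only be checked on single increments.\<close>

lemma expectation_mult_ito_integral:
  assumes W: "square_integrable M W" and Z: "has_ito_integral M F \<rho> B H Z"
    and zero: "\<And>\<xi> A a b. \<xi> \<in> borel_measurable (F a) \<Longrightarrow> bounded (\<xi> ` space M) \<Longrightarrow> A \<in> sets borel \<Longrightarrow>
      expectation (\<lambda>\<omega>. W \<omega> * (\<xi> \<omega> * B (strip A a b) \<omega>)) = 0"
  shows "expectation (\<lambda>\<omega>. W \<omega> * Z \<omega>) = 0"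
proof -
  obtain g L where L: "\<And>n::nat. elementary_integrand M F (L n)"
    "(\<lambda>n. \<integral>\<^sup>+\<omega>. ennreal ((elementary_integral B (L n) \<omega> - Z \<omega>)\<^sup>2) \<partial>M) \<longlonglongrightarrow> 0"
    by (rule ito_integral_approximation[OF Z]) (rule that)
  have "expectation (\<lambda>\<omega>. W \<omega> * elementary_integral B (L n) \<omega>) = 0" for n
  proof -
    \<comment> \<open>\<open>W\<close> is written as a sum over a one-element list to match the bilinear expansion\<close>
    have "expectation (\<lambda>\<omega>. (\<Sum>x\<leftarrow>[()]. W \<omega>) * elementary_integral B (L n) \<omega>)
        = (\<Sum>x\<leftarrow>[()]. \<Sum>q\<leftarrow>L n. \<integral>\<omega>. W \<omega> * step_integral q \<omega> \<partial>M)"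
      unfolding elementary_integral_eq
      by (rule integral_sum_list_mult) (auto intro: W step_integral_square_integrable[OF L(1)])
    also have "\<dots> = (\<Sum>x\<leftarrow>[()]. \<Sum>q\<leftarrow>L n. 0)"
      using L(1)[of n]
      by (intro arg_cong[where f=sum_list] map_cong refl)
        (auto simp: elementary_integrand_def step_integral_def intro!: zero)
    finally show ?thesis by simp
  qed
  moreover have "(\<lambda>n. expectation (\<lambda>\<omega>. W \<omega> * elementary_integral B (L n) \<omega>)) \<longlonglongrightarrow> expectation (\<lambda>\<omega>. W \<omega> * Z \<omega>)"
    using W Z by (intro tendsto_integral_mult_mean_square elementary_square_integrable L)
      (auto simp: has_ito_integral_def)
  ultimately show ?thesis by (simp add: LIMSEQ_const_iff)
qed

lemma expectation_ito_integral:
  assumes Z: "has_ito_integral M F \<rho> B H Z"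
  shows "expectation Z = 0"
proof -
  have "expectation (\<lambda>\<omega>. 1 * Z \<omega>) = 0"
  proof (rule expectation_mult_ito_integral[OF square_integrable_const Z])
    fix \<xi> :: "'a \<Rightarrow> real" and A :: "real set" and a b :: real
    assume \<xi>: "\<xi> \<in> borel_measurable (F a)" "bounded (\<xi> ` space M)" and A: "A \<in> sets borel"
    have "integrable M \<xi>"
      using square_integrable_bounded_mult[OF square_integrable_const[of 1] measurable_F_M[OF \<xi>(1)] \<xi>(2)]
      by (intro square_integrable_integrable) simp
    from expectation_past_mult_noise[OF \<xi>(1) this A]
    show "expectation (\<lambda>\<omega>. 1 * (\<xi> \<omega> * B (strip A a b) \<omega>)) = 0" by simp
  qed
  then show ?thesis by simp
qed

text \<open>The jumps are split at the time \<open>a\<close> at which the increment starts.  Those up to \<open>a\<close> join \<open>\<xi>\<close> in the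
  past of \<open>a\<close>.  For those after \<open>a\<close>, first \<open>\<xi>\<close> separates from the joint future of both noises, then the
  noise separates from the jumps.\<close>

lemma expectation_poisson_integral_mult_noise:
  assumes G: "G \<in> borel_measurable jump_intensity" "(\<integral>\<^sup>+x. G x \<partial>jump_intensity) < \<infinity>"
      "(\<integral>\<^sup>+x. G x * G x \<partial>jump_intensity) < \<infinity>"
    and \<xi>: "\<xi> \<in> borel_measurable (F a)" "bounded (\<xi> ` space M)" and A: "A \<in> sets borel"
  shows "expectation (\<lambda>\<omega>. jumps.poisson_integral G \<omega> * (\<xi> \<omega> * B (strip A a b) \<omega>)) = 0"
proof -
  let ?T = "\<lambda>T. T \<times> (UNIV :: (real \<times> real) set)"
  let ?G = "\<lambda>T x. G x * indicator (?T T) x"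
  let ?I = "jumps.poisson_integral" and ?b = "B (strip A a b)"
  have T[measurable]: "?T {..a} \<in> sets jump_intensity" "?T {a<..} \<in> sets jump_intensity"
    unfolding sets_jump_intensity
    by (intro borel_closed borel_open closed_Times open_Times closed_UNIV open_UNIV closed_atMost open_greaterThan)+
  have G'[measurable]: "?G T \<in> borel_measurable jump_intensity" if "?T T \<in> sets jump_intensity" for T
    using G(1) that by measurable
  have fin: "(\<integral>\<^sup>+x. ?G T x \<partial>jump_intensity) < \<infinity>" "(\<integral>\<^sup>+x. ?G T x * ?G T x \<partial>jump_intensity) < \<infinity>" for T
    by (rule le_less_trans[OF nn_integral_mono G(2)] le_less_trans[OF nn_integral_mono G(3)],
        simp split: split_indicator)+
  note sq = jumps.square_integrable_poisson_integral[OF G' fin(1) fin(2)]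
  note b = white_noise_square_integrable[OF strip_finite[OF A, of a b]]
  have past: "?I (?G {..a}) \<in> borel_measurable (F a)"
    unfolding jumps.poisson_integral_def[abs_def]
    by (intro borel_measurable_enn2real jumps.measurable_nn_integral_N_subalgebra[OF space_F T(1) _ G(1)]
        jumps_measurable[OF _ _ space_F adapted(2)]) (simp_all only: sets_jump_intensity)
  have future: "?I (?G {a<..}) \<in> borel_measurable (future a)"
    unfolding jumps.poisson_integral_def[abs_def]
    by (intro borel_measurable_enn2real jumps.measurable_nn_integral_N_subalgebra[OF space_future T(2) _ G(1)]
        jumps_measurable[OF _ _ space_future in_future(2)]) (simp_all only: sets_jump_intensity)
  have b_future: "?b \<in> borel_measurable (future a)"
    by (intro white_noise_measurable[OF strip_finite[OF A] _ space_future in_future(1)]) auto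
  have \<xi>int: "integrable M \<xi>"
    using square_integrable_bounded_mult[OF square_integrable_const[of 1] measurable_F_M[OF \<xi>(1)] \<xi>(2)]
    by (intro square_integrable_integrable) simp
  have \<xi>b: "square_integrable M (\<lambda>\<omega>. \<xi> \<omega> * ?b \<omega>)"
    by (intro strip_increment_square_integrable measurable_F_M[OF \<xi>(1)] \<xi>(2) A)
  have "expectation (\<lambda>\<omega>. ?I (?G {..a}) \<omega> * \<xi> \<omega> * ?b \<omega>) = 0"
  proof (rule expectation_past_mult_noise[OF _ _ A])
    show "(\<lambda>\<omega>. ?I (?G {..a}) \<omega> * \<xi> \<omega>) \<in> borel_measurable (F a)"
      using past \<xi>(1) by simp
    have "square_integrable M (\<lambda>\<omega>. \<xi> \<omega> * ?I (?G {..a}) \<omega>)"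
      by (intro square_integrable_bounded_mult sq T measurable_F_M[OF \<xi>(1)] \<xi>(2))
    then show "integrable M (\<lambda>\<omega>. ?I (?G {..a}) \<omega> * \<xi> \<omega>)"
      by (intro square_integrable_integrable) (simp add: mult.commute)
  qed
  then have 1: "expectation (\<lambda>\<omega>. ?I (?G {..a}) \<omega> * (\<xi> \<omega> * ?b \<omega>)) = 0"
    by (simp add: mult.assoc)
  have noise: "expectation (\<lambda>\<omega>. ?b \<omega> * ?I (?G {a<..}) \<omega>) = expectation ?b * expectation (?I (?G {a<..}))"
  proof (rule indep_set_integral_mult(2))
    let ?W = "sigma (space M) (white_noise_sets M \<rho> B UNIV)" and ?P = "sigma (space M) (poisson_sets M N UNIV)"
    have sW: "sets ?W = white_noise_sets M \<rho> B UNIV" and sP: "sets ?P = poisson_sets M N UNIV"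
      unfolding white_noise_sets_def poisson_sets_def by (rule sets_sigma_generated_sets)+
    show "indep_set (sets ?W) (sets ?P)"
      unfolding sW sP by (rule noises_indep)
    have spW: "space ?W = space M" and spP: "space ?P = space M"
      unfolding white_noise_sets_def poisson_sets_def
      by (intro space_measure_of generated_sets_subset_Pow)+
    show "space ?W = space M" "space ?P = space M" by (fact spW spP)+
    show "?b \<in> borel_measurable ?W"
      by (intro white_noise_measurable[OF strip_finite[OF A] _ spW, where T=UNIV]) (auto simp: sW)
    show "?I (?G {a<..}) \<in> borel_measurable ?P"
      unfolding jumps.poisson_integral_def[abs_def]
      by (intro borel_measurable_enn2real jumps.measurable_nn_integral_N_subalgebra[OF spP T(2) _ G(1)]
          jumps_measurable[OF _ _ spP, where T=UNIV]) (simp_all only: sets_jump_intensity sP, auto)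
  qed (intro square_integrable_integrable b sq T)+
  have "expectation (\<lambda>\<omega>. \<xi> \<omega> * (?b \<omega> * ?I (?G {a<..}) \<omega>))
      = expectation \<xi> * expectation (\<lambda>\<omega>. ?b \<omega> * ?I (?G {a<..}) \<omega>)"
    by (intro indep_set_integral_mult(2)[OF indep_future[of a]] space_F space_future \<xi>(1) \<xi>int
        borel_measurable_times b_future future square_integrable_mult b sq T)
  then have 2: "expectation (\<lambda>\<omega>. ?I (?G {a<..}) \<omega> * (\<xi> \<omega> * ?b \<omega>)) = 0"
    using noise white_noise_mean[OF strip_finite[OF A]] by (simp add: mult_ac)
  have "AE \<omega> in M. (\<integral>\<^sup>+x. G x \<partial>N \<omega>) < \<infinity>"
    by (rule jumps.AE_nn_integral_N_finite[OF G(1,2)])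
  then have split: "AE \<omega> in M. ?I G \<omega> = ?I (?G {..a}) \<omega> + ?I (?G {a<..}) \<omega>"
    using AE_space
  proof eventually_elim
    case (elim \<omega>)
    have "(\<integral>\<^sup>+x. G x \<partial>N \<omega>) = (\<integral>\<^sup>+x. ?G {..a} x + ?G {a<..} x \<partial>N \<omega>)"
      by (intro nn_integral_cong) (auto split: split_indicator)
    also have "\<dots> = (\<integral>\<^sup>+x. ?G {..a} x \<partial>N \<omega>) + (\<integral>\<^sup>+x. ?G {a<..} x \<partial>N \<omega>)"
      using elim(2) T by (intro nn_integral_add) (auto simp: jumps.measurable_N intro!: G')
    finally have eq: "(\<integral>\<^sup>+x. G x \<partial>N \<omega>) = (\<integral>\<^sup>+x. ?G {..a} x \<partial>N \<omega>) + (\<integral>\<^sup>+x. ?G {a<..} x \<partial>N \<omega>)" .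
    with elim(1) show ?case
      unfolding jumps.poisson_integral_def eq by (intro enn2real_plus) (auto simp: less_top)
  qed
  have "expectation (\<lambda>\<omega>. ?I G \<omega> * (\<xi> \<omega> * ?b \<omega>))
      = expectation (\<lambda>\<omega>. ?I (?G {..a}) \<omega> * (\<xi> \<omega> * ?b \<omega>) + ?I (?G {a<..}) \<omega> * (\<xi> \<omega> * ?b \<omega>))"
  proof (rule integral_cong_AE)
    show "AE \<omega> in M. ?I G \<omega> * (\<xi> \<omega> * ?b \<omega>)
        = ?I (?G {..a}) \<omega> * (\<xi> \<omega> * ?b \<omega>) + ?I (?G {a<..}) \<omega> * (\<xi> \<omega> * ?b \<omega>)"
      using split by eventually_elim (simp add: distrib_right)
    show "(\<lambda>\<omega>. ?I G \<omega> * (\<xi> \<omega> * ?b \<omega>)) \<in> borel_measurable M"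
      by (intro borel_measurable_times jumps.measurable_poisson_integral G square_integrable_measurable[OF \<xi>b]
          measurable_F_M[OF \<xi>(1)] square_integrable_measurable[OF b])
    show "(\<lambda>\<omega>. ?I (?G {..a}) \<omega> * (\<xi> \<omega> * ?b \<omega>) + ?I (?G {a<..}) \<omega> * (\<xi> \<omega> * ?b \<omega>)) \<in> borel_measurable M"
      by (intro borel_measurable_add borel_measurable_times square_integrable_measurable[OF sq] T
          measurable_F_M[OF \<xi>(1)] square_integrable_measurable[OF b])
  qed
  also have "\<dots> = 0"
    using 1 2 square_integrable_mult[OF sq[OF T(1)] \<xi>b] square_integrable_mult[OF sq[OF T(2)] \<xi>b]
    by simp
  finally show ?thesis .
qed

theorem expectation_poisson_integral_mult_ito:
  assumes G: "G \<in> borel_measurable jump_intensity" "(\<integral>\<^sup>+x. G x \<partial>jump_intensity) < \<infinity>"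
      "(\<integral>\<^sup>+x. G x * G x \<partial>jump_intensity) < \<infinity>"
    and Z: "has_ito_integral M F \<rho> B H Z"
  shows "expectation (\<lambda>\<omega>. jumps.poisson_integral G \<omega> * Z \<omega>) = 0"
  by (rule expectation_mult_ito_integral[OF jumps.square_integrable_poisson_integral[OF G] Z])
    (rule expectation_poisson_integral_mult_noise[OF G])

end

section \<open>Kernels, their moments and the averaging law\<close>

lemma nn_integral_gamma:
  fixes a c :: real
  assumes a: "a > 0" and c: "c > 0"
  shows "(\<integral>\<^sup>+x. ennreal (indicator {0<..} x * (x powr (a - 1) * exp (- (c * x)))) \<partial>lborel) = ennreal (Gamma a / c powr a)"
proof -
  let ?f = "\<lambda>t. ennreal (indicator {0..} t * t powr (a - 1) / exp t)"
  have "ennreal (Gamma a) = (\<integral>\<^sup>+t. ?f t \<partial>lborel)"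
    by (rule Gamma_conv_nn_integral_real[OF a])
  also have "\<dots> = ennreal \<bar>c\<bar> * (\<integral>\<^sup>+x. ?f (0 + c * x) \<partial>lborel)"
    using c by (intro nn_integral_real_affine) auto
  also have "(\<integral>\<^sup>+x. ?f (0 + c * x) \<partial>lborel)
      = (\<integral>\<^sup>+x. ennreal (c powr (a - 1)) * ennreal (indicator {0<..} x * (x powr (a - 1) * exp (- (c * x)))) \<partial>lborel)"
    using c by (intro nn_integral_cong)
      (auto simp: ennreal_mult'[symmetric] powr_mult exp_minus field_simps indicator_def zero_le_mult_iff)
  also have "\<dots> = ennreal (c powr (a - 1)) * (\<integral>\<^sup>+x. ennreal (indicator {0<..} x * (x powr (a - 1) * exp (- (c * x)))) \<partial>lborel)"
    by (rule nn_integral_cmult) measurable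
  finally have eq: "ennreal (Gamma a) = ennreal (c powr a) *
      (\<integral>\<^sup>+x. ennreal (indicator {0<..} x * (x powr (a - 1) * exp (- (c * x)))) \<partial>lborel)"
    using c by (simp add: mult.assoc[symmetric] ennreal_mult'[symmetric] powr_mult_base)
  have "ennreal (1 / c powr a) * ennreal (Gamma a) = ennreal (1 / c powr a * c powr a) *
      (\<integral>\<^sup>+x. ennreal (indicator {0<..} x * (x powr (a - 1) * exp (- (c * x)))) \<partial>lborel)"
    unfolding eq by (simp add: mult.assoc[symmetric] ennreal_mult'[symmetric])
  then show ?thesis
    using c Gamma_real_pos[OF a] by (simp add: ennreal_mult'[symmetric] ennreal_mult''[symmetric] mult.commute)
qed

lemma nn_integral_exp_past:
  fixes c t :: real
  assumes "c > 0"
  shows "(\<integral>\<^sup>+s. ennreal (indicator {..t} s * exp (- c * (t - s))) \<partial>lborel) = ennreal (1 / c)"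
proof -
  have "(\<integral>\<^sup>+s. ennreal (indicator {..t} s * exp (- c * (t - s))) \<partial>lborel)
      = ennreal \<bar>-1\<bar> * (\<integral>\<^sup>+x. ennreal (indicator {..t} (t + -1 * x) * exp (- c * (t - (t + -1 * x)))) \<partial>lborel)"
    by (rule nn_integral_real_affine) auto
  also have "\<dots> = (\<integral>\<^sup>+x. ennreal (indicator {..t} (t - x) * exp (- (c * x))) \<partial>lborel)"
    by simp
  also have "\<dots> = (\<integral>\<^sup>+x. ennreal (indicator {0<..} x * (x powr (1 - 1) * exp (- (c * x)))) \<partial>lborel)"
    using AE_lborel_singleton[of "0::real"]
    by (intro nn_integral_cong_AE) (auto simp: indicator_def elim!: eventually_mono)
  also have "\<dots> = ennreal (1 / c)"
    using assms nn_integral_gamma[of 1 c] by simp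
  finally show ?thesis .
qed

text \<open>All integrals over \<open>(R, s)\<close> in the model have this shape: \<open>q = 1\<close> for the drift kernel and \<open>q = 2\<close> for
  the squared diffusion kernel, with the dependence on the lag absorbed in \<open>w\<close>.\<close>

lemma nn_integral_exp_past_pair:
  fixes K :: "real measure" and q t :: real and w :: "real \<Rightarrow> real"
  assumes K: "sigma_finite_measure K" "sets K = sets borel"
    and w: "w \<in> borel_measurable borel" "\<And>R. R > 0 \<Longrightarrow> 0 \<le> w R" and q: "q > 0"
  shows "(\<integral>\<^sup>+(R, s). ennreal (indicator ({0<..} \<times> {..t}) (R, s) * (w R * exp (- (q * R) * (t - s)))) \<partial>(K \<Otimes>\<^sub>M lborel))
    = (\<integral>\<^sup>+R. ennreal (indicator {0<..} R * (w R / (q * R))) \<partial>K)"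
proof -
  interpret K: sigma_finite_measure K by fact
  interpret pair_sigma_finite K lborel ..
  note [measurable_cong] = K(2)
  note [measurable] = w(1)
  have "(\<integral>\<^sup>+(R, s). ennreal (indicator ({0<..} \<times> {..t}) (R, s) * (w R * exp (- (q * R) * (t - s)))) \<partial>(K \<Otimes>\<^sub>M lborel))
    = (\<integral>\<^sup>+R. \<integral>\<^sup>+s. ennreal (indicator ({0<..} \<times> {..t}) (R, s) * (w R * exp (- (q * R) * (t - s)))) \<partial>lborel \<partial>K)"
    by (subst lborel.nn_integral_fst[symmetric]) (auto simp: indicator_times)
  also have "\<dots> = (\<integral>\<^sup>+R. ennreal (indicator {0<..} R * (w R / (q * R))) \<partial>K)"
  proof (intro nn_integral_cong)
    fix R :: real
    show "(\<integral>\<^sup>+s. ennreal (indicator ({0<..} \<times> {..t}) (R, s) * (w R * exp (- (q * R) * (t - s)))) \<partial>lborel)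
        = ennreal (indicator {0<..} R * (w R / (q * R)))"
    proof (cases "R > 0")
      case True
      have "(\<integral>\<^sup>+s. ennreal (indicator ({0<..} \<times> {..t}) (R, s) * (w R * exp (- (q * R) * (t - s)))) \<partial>lborel)
          = (\<integral>\<^sup>+s. ennreal (w R) * ennreal (indicator {..t} s * exp (- (q * R) * (t - s))) \<partial>lborel)"
        using True w(2) by (intro nn_integral_cong) (auto simp: indicator_def ennreal_mult'[symmetric])
      also have "\<dots> = ennreal (w R) * ennreal (1 / (q * R))"
        using nn_integral_exp_past[of "q * R" t] True q by (subst nn_integral_cmult) (simp_all only: mult_pos_pos, measurable)
      finally show ?thesis using True w(2) q by (simp add: ennreal_mult'[symmetric])
    qed simp
  qed
  finally show ?thesis .
qed

context supOUSV_parameters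
begin

text \<open>The contribution to the supOU process at time \<open>t\<close> of a jump at the point \<open>(s, z, r)\<close>.\<close>

definition supOU_kernel :: "real \<Rightarrow> real \<times> real \<times> real \<Rightarrow> real" where
  "supOU_kernel t = (\<lambda>(s, z, r). indicator ({..t} \<times> {0<..} \<times> {0<..}) (s, z, r) * (z * exp (- r * (t - s))))"

lemma supOU_kernel_nonneg: "0 \<le> supOU_kernel t x"
  by (auto simp: supOU_kernel_def indicator_def split: prod.splits)

lemma measurable_supOU_kernel_pair [measurable]:
  "(\<lambda>p. supOU_kernel (fst p) (snd p)) \<in> borel_measurable (borel \<Otimes>\<^sub>M jump_intensity)"
proof -
  have "(\<lambda>p. supOU_kernel (fst p) (snd p)) = (\<lambda>p. of_bool (fst (snd p) \<le> fst p \<and> 0 < fst (snd (snd p)) \<and> 0 < snd (snd (snd p)))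
      * (fst (snd (snd p)) * exp (- snd (snd (snd p)) * (fst p - fst (snd p)))))"
    by (auto simp: supOU_kernel_def fun_eq_iff indicator_def split: prod.splits)
  then show ?thesis by (simp add: case_prod_beta)
qed

lemma measurable_supOU_kernel [measurable]: "supOU_kernel t \<in> borel_measurable jump_intensity"
  using measurable_compose[OF measurable_Pair1' measurable_supOU_kernel_pair, of t] by simp

definition jump_moment :: "nat \<Rightarrow> ennreal" where
  "jump_moment k = (\<integral>\<^sup>+z. ennreal (indicator {0<..} z * z ^ k) \<partial>\<nu>)"

definition rate_integral :: "real \<Rightarrow> ennreal" where
  "rate_integral h = (\<integral>\<^sup>+r. ennreal (indicator {0<..} r * (exp (- r * h) / r)) \<partial>\<pi>)"

lemma jump_moment_finite: "k \<ge> 1 \<Longrightarrow> jump_moment k < \<infinity>"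
proof -
  assume "k \<ge> 1"
  then have "integrable \<nu> (\<lambda>z. z ^ k)" by (rule \<nu>_moments)
  then have "(\<integral>\<^sup>+z. ennreal (norm (z ^ k)) \<partial>\<nu>) < \<infinity>" unfolding integrable_iff_bounded by (elim conjE)
  then show ?thesis
    unfolding jump_moment_def
    by (rule le_less_trans[rotated]) (auto intro!: nn_integral_mono ennreal_leI simp: indicator_def)
qed

lemma rate_integral_antimono: "h \<le> h' \<Longrightarrow> rate_integral h' \<le> rate_integral h"
  unfolding rate_integral_def
  by (intro nn_integral_mono ennreal_leI) (auto simp: indicator_def divide_right_mono)

lemma rate_integral_0_finite: "rate_integral 0 < \<infinity>"
proof -
  have "(\<integral>\<^sup>+r. ennreal (norm (1 / r)) \<partial>\<pi>) < \<infinity>" using \<pi>_inverse unfolding integrable_iff_bounded by (elim conjE)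
  then show ?thesis
    unfolding rate_integral_def
    by (rule le_less_trans[rotated]) (auto intro!: nn_integral_mono ennreal_leI simp: indicator_def)
qed

lemma rate_integral_finite: "h \<ge> 0 \<Longrightarrow> rate_integral h < \<infinity>"
  using rate_integral_antimono[of 0 h] rate_integral_0_finite by (auto intro: le_less_trans)

lemma stationary_mean_positive: "jump_moment 1 * rate_integral 0 > 0"
proof -
  have "emeasure \<pi> UNIV \<noteq> 0" using pi.emeasure_space_1 by simp
  then show ?thesis
    unfolding jump_moment_def rate_integral_def ennreal_zero_less_mult_iff
    using nn_integral_positive_half_line[OF sets_\<nu> \<nu>_pos \<nu>_nonzero, of "\<lambda>z. z ^ 1"]
      nn_integral_positive_half_line[OF sets_\<pi> \<pi>_pos, of "\<lambda>r. exp (- r * 0) / r"] by simp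
qed

text \<open>Covers the mean (\<open>k = q = 1\<close>) and the covariance (\<open>k = q = 2\<close>) of the supOU process, where the lag
  enters through \<open>w\<close>.\<close>

lemma nn_integral_jump_response:
  assumes w: "w \<in> borel_measurable borel" "\<And>r. r > 0 \<Longrightarrow> 0 \<le> w r" and q: "q > 0"
  shows "(\<integral>\<^sup>+(s, z, r). ennreal (indicator ({..t} \<times> {0<..} \<times> {0<..}) (s, z, r) *
      (z ^ k * (w r * exp (- (q * r) * (t - s))))) \<partial>jump_intensity)
    = jump_moment k * (\<integral>\<^sup>+r. ennreal (indicator {0<..} r * (w r / (q * r))) \<partial>\<pi>)"
proof -
  note [measurable] = w(1)
  let ?f = "\<lambda>s z r. ennreal (indicator ({..t} \<times> {0<..} \<times> {0<..}) (s, z, r) *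
      (z ^ k * (w r * exp (- (q * r) * (t - s)))))"
  have "(\<integral>\<^sup>+(s, z, r). ?f s z r \<partial>jump_intensity) = (\<integral>\<^sup>+y. \<integral>\<^sup>+s. ?f s (fst y) (snd y) \<partial>lborel \<partial>(\<nu> \<Otimes>\<^sub>M \<pi>))"
    using jump.nn_integral_snd[of "\<lambda>(s, y). ?f s (fst y) (snd y)"]
    by (simp add: case_prod_unfold indicator_times)
  also have "\<dots> = (\<integral>\<^sup>+y. ennreal (indicator {0<..} (fst y) * fst y ^ k) *
      ennreal (indicator {0<..} (snd y) * (w (snd y) / (q * snd y))) \<partial>(\<nu> \<Otimes>\<^sub>M \<pi>))"
  proof (intro nn_integral_cong)
    fix y :: "real \<times> real"
    obtain z r where y: "y = (z, r)" by (cases y)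
    show "(\<integral>\<^sup>+s. ?f s (fst y) (snd y) \<partial>lborel) = ennreal (indicator {0<..} (fst y) * fst y ^ k) *
      ennreal (indicator {0<..} (snd y) * (w (snd y) / (q * snd y)))"
    proof (cases "0 < z \<and> 0 < r")
      case True
      have "(\<integral>\<^sup>+s. ?f s z r \<partial>lborel)
          = (\<integral>\<^sup>+s. ennreal (z ^ k * w r) * ennreal (indicator {..t} s * exp (- (q * r) * (t - s))) \<partial>lborel)"
        using True w(2)
        by (intro nn_integral_cong) (auto simp: indicator_def ennreal_mult'[symmetric] mult_ac)
      also have "\<dots> = ennreal (z ^ k * w r) * ennreal (1 / (q * r))"
        by (subst nn_integral_cmult) (measurable, simp only: nn_integral_exp_past[OF mult_pos_pos[OF q conjunct2[OF True]]])
      finally show ?thesis using True w(2) q by (simp add: y ennreal_mult'[symmetric])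
    qed (auto simp: y indicator_def)
  qed
  also have "\<dots> = (\<integral>\<^sup>+z. \<integral>\<^sup>+r. ennreal (indicator {0<..} z * z ^ k) *
      ennreal (indicator {0<..} r * (w r / (q * r))) \<partial>\<pi> \<partial>\<nu>)"
    by (subst pi.nn_integral_fst[symmetric]) auto
  also have "\<dots> = jump_moment k * (\<integral>\<^sup>+r. ennreal (indicator {0<..} r * (w r / (q * r))) \<partial>\<pi>)"
    by (simp add: nn_integral_cmult nn_integral_multc jump_moment_def)
  finally show ?thesis .
qed

lemma nn_integral_supOU_kernel: "(\<integral>\<^sup>+x. supOU_kernel t x \<partial>jump_intensity) = jump_moment 1 * rate_integral 0"
  using nn_integral_jump_response[of "\<lambda>_. 1" 1 t 1]
  by (simp add: supOU_kernel_def rate_integral_def case_prod_beta')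

text \<open>The covariance of the supOU process: for \<open>s' \<le> s \<le> u\<close> the two exponentials combine to
  \<open>e\<^sup>-\<^sup>r\<^sup>(\<^sup>u\<^sup>-\<^sup>s\<^sup>) e\<^sup>-\<^sup>2\<^sup>r\<^sup>(\<^sup>s\<^sup>-\<^sup>s\<^sup>'\<^sup>)\<close>, and the integral over \<open>s'\<close> produces the factor \<open>1 / (2 r)\<close>.\<close>

lemma nn_integral_supOU_kernel_mult:
  assumes "s \<le> u"
  shows "(\<integral>\<^sup>+x. ennreal (supOU_kernel s x) * ennreal (supOU_kernel u x) \<partial>jump_intensity)
    = jump_moment 2 * (rate_integral (u - s) / 2)"
proof -
  have "(\<integral>\<^sup>+x. ennreal (supOU_kernel s x) * ennreal (supOU_kernel u x) \<partial>jump_intensity)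
    = (\<integral>\<^sup>+(s', z, r). ennreal (indicator ({..s} \<times> {0<..} \<times> {0<..}) (s', z, r) *
      (z ^ 2 * (exp (- r * (u - s)) * exp (- (2 * r) * (s - s'))))) \<partial>jump_intensity)"
    using assms
    by (intro nn_integral_cong)
      (auto simp: supOU_kernel_def indicator_def ennreal_mult'[symmetric] power2_eq_square mult_exp_exp algebra_simps)
  also have "\<dots> = jump_moment 2 * (\<integral>\<^sup>+r. ennreal (indicator {0<..} r * (exp (- r * (u - s)) / (2 * r))) \<partial>\<pi>)"
    by (rule nn_integral_jump_response) auto
  also have "(\<integral>\<^sup>+r. ennreal (indicator {0<..} r * (exp (- r * (u - s)) / (2 * r))) \<partial>\<pi>)
      = (\<integral>\<^sup>+r. ennreal (indicator {0<..} r * (exp (- r * (u - s)) / r)) / 2 \<partial>\<pi>)"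
    by (intro nn_integral_cong) (auto simp: indicator_def divide_ennreal[symmetric] divide_ennreal_def[symmetric]
      ennreal_divide_numeral)
  also have "\<dots> = rate_integral (u - s) / 2"
    unfolding rate_integral_def by (intro nn_integral_divide) measurable
  finally show ?thesis .
qed

definition drift_kernel :: "real \<Rightarrow> real \<times> real \<Rightarrow> real" where
  "drift_kernel t = (\<lambda>(R, s). indicator ({0<..} \<times> {..t}) (R, s) * (R * exp (- R * (t - s))))"

lemma drift_kernel_nonneg: "0 \<le> drift_kernel t p"
  by (auto simp: drift_kernel_def indicator_def split: prod.splits)

lemma measurable_drift_kernel [measurable]: "drift_kernel t \<in> borel_measurable noise_control"
  unfolding drift_kernel_def by (simp add: indicator_times)

text \<open>Up to the factor \<open>\<mu>\<close> the drift of the model at time \<open>t\<close> averages the centred supOU process over a random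
  past time with this law.\<close>

definition averaging_law :: "real \<Rightarrow> real measure" where
  "averaging_law t = distr (density noise_control (\<lambda>p. ennreal (drift_kernel t p))) borel snd"

lemma sets_averaging_law [simp, measurable_cong]: "sets (averaging_law t) = sets borel"
  by (simp add: averaging_law_def)

lemma space_averaging_law [simp]: "space (averaging_law t) = UNIV"
  by (simp add: averaging_law_def)

definition laplace_\<rho> :: "real \<Rightarrow> real" where
  "laplace_\<rho> h = (\<integral>R. exp (- R * h) \<partial>\<rho>)"

lemma nn_integral_laplace_\<rho>:
  assumes "h \<ge> 0"
  shows "(\<integral>\<^sup>+R. ennreal (indicator {0<..} R * exp (- R * h)) \<partial>\<rho>) = ennreal (laplace_\<rho> h)"
proof -
  have pos: "AE R in \<rho>. R > 0"
    using AE_not_in[of "{..0}" \<rho>] \<rho>_pos by (auto simp: null_sets_def sets_\<rho> elim!: eventually_mono)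
  have "integrable \<rho> (\<lambda>R. exp (- R * h))"
    using pos assms by (intro rho.integrable_const_bound[of _ 1]) (auto elim!: eventually_mono)
  then have "(\<integral>\<^sup>+R. ennreal (exp (- R * h)) \<partial>\<rho>) = ennreal (laplace_\<rho> h)"
    unfolding laplace_\<rho>_def by (rule nn_integral_eq_integral) simp
  moreover have "(\<integral>\<^sup>+R. ennreal (indicator {0<..} R * exp (- R * h)) \<partial>\<rho>) = (\<integral>\<^sup>+R. ennreal (exp (- R * h)) \<partial>\<rho>)"
    using pos by (intro nn_integral_cong_AE) (auto elim!: eventually_mono)
  ultimately show ?thesis by simp
qed

lemma laplace_\<rho>_nonneg: "0 \<le> laplace_\<rho> h"
  by (simp add: laplace_\<rho>_def)

lemma laplace_\<rho>_0: "laplace_\<rho> 0 = 1"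
  using rho.prob_space by (simp add: laplace_\<rho>_def)

lemma nn_integral_noise_control_exp:
  assumes "w \<in> borel_measurable borel" "\<And>R. R > 0 \<Longrightarrow> 0 \<le> w R" "q > 0"
  shows "(\<integral>\<^sup>+(R, s). ennreal (indicator ({0<..} \<times> {..t}) (R, s) * (w R * exp (- (q * R) * (t - s)))) \<partial>noise_control)
    = (\<integral>\<^sup>+R. ennreal (indicator {0<..} R * (w R / (q * R))) \<partial>\<rho>)"
  by (rule nn_integral_exp_past_pair[OF rho.sigma_finite_measure_axioms sets_\<rho> assms])

lemma nn_integral_averaging_law:
  assumes [measurable]: "f \<in> borel_measurable borel"
  shows "(\<integral>\<^sup>+s. f s \<partial>averaging_law t) = (\<integral>\<^sup>+p. ennreal (drift_kernel t p) * f (snd p) \<partial>noise_control)"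
  unfolding averaging_law_def by (simp add: nn_integral_distr nn_integral_density)

text \<open>Given \<open>R\<close>, the delay is exponential with rate \<open>R\<close>, so it exceeds \<open>h\<close> with probability \<open>e\<^sup>-\<^sup>R\<^sup>h\<close>.\<close>

lemma emeasure_averaging_law_atMost:
  assumes "h \<ge> 0"
  shows "emeasure (averaging_law t) {..t - h} = ennreal (laplace_\<rho> h)"
proof -
  have "emeasure (averaging_law t) {..t - h} = (\<integral>\<^sup>+s. indicator {..t - h} s \<partial>averaging_law t)" by simp
  also have "\<dots> = (\<integral>\<^sup>+p. ennreal (drift_kernel t p) * indicator {..t - h} (snd p) \<partial>noise_control)"
    by (rule nn_integral_averaging_law) simp
  also have "\<dots> = (\<integral>\<^sup>+(R, s). ennreal (indicator ({0<..} \<times> {..t - h}) (R, s) *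
      (R * exp (- R * h) * exp (- (1 * R) * ((t - h) - s)))) \<partial>noise_control)"
    using assms by (intro nn_integral_cong)
      (auto simp: drift_kernel_def indicator_def mult_exp_exp mult.assoc algebra_simps)
  also have "\<dots> = (\<integral>\<^sup>+R. ennreal (indicator {0<..} R * (R * exp (- R * h) / (1 * R))) \<partial>\<rho>)"
    by (rule nn_integral_noise_control_exp) auto
  also have "\<dots> = (\<integral>\<^sup>+R. ennreal (indicator {0<..} R * exp (- R * h)) \<partial>\<rho>)"
    by (intro nn_integral_cong) (auto simp: indicator_def)
  finally show ?thesis using nn_integral_laplace_\<rho>[OF assms] by simp
qed

lemma emeasure_averaging_law_future: "emeasure (averaging_law t) {t<..} = 0"
proof -
  have "emeasure (averaging_law t) {t<..} = (\<integral>\<^sup>+s. indicator {t<..} s \<partial>averaging_law t)" by simp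
  also have "\<dots> = (\<integral>\<^sup>+p. ennreal (drift_kernel t p) * indicator {t<..} (snd p) \<partial>noise_control)"
    by (rule nn_integral_averaging_law) simp
  also have "\<dots> = (\<integral>\<^sup>+p. 0 \<partial>noise_control)"
    by (intro nn_integral_cong) (auto simp: drift_kernel_def indicator_def)
  finally show ?thesis by simp
qed

lemma AE_averaging_law: "AE s in averaging_law t. s \<le> t"
  using AE_not_in[of "{t<..}" "averaging_law t"] emeasure_averaging_law_future[of t]
  by (auto simp: null_sets_def not_less elim!: eventually_mono)

lemma prob_space_averaging_law: "prob_space (averaging_law t)"
proof
  have "emeasure (averaging_law t) UNIV = emeasure (averaging_law t) ({..t - 0} \<union> {t<..})"
    by (intro arg_cong[where f="emeasure (averaging_law t)"]) auto
  also have "\<dots> = emeasure (averaging_law t) {..t - 0} + emeasure (averaging_law t) {t<..}"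
    by (intro plus_emeasure[symmetric]) auto
  finally show "emeasure (averaging_law t) (space (averaging_law t)) = 1"
    using emeasure_averaging_law_atMost[of 0 t] by (simp add: emeasure_averaging_law_future laplace_\<rho>_0)
qed

lemma measurable_supOU_kernel_averaging:
  assumes "sets K = sets jump_intensity"
  shows "(\<lambda>(s, x). ennreal (supOU_kernel s x)) \<in> borel_measurable (averaging_law t \<Otimes>\<^sub>M K)"
proof -
  have "(\<lambda>p. ennreal (supOU_kernel (fst p) (snd p))) \<in> borel_measurable (borel \<Otimes>\<^sub>M jump_intensity)"
    by measurable
  then show ?thesis
    unfolding measurable_cong_sets[OF sets_pair_measure_cong[OF sets_averaging_law assms] refl]
    by (simp only: case_prod_unfold)
qed

text \<open>The supOU kernel averaged over \<open>s\<close>, that is, the contribution of a jump at \<open>x\<close> to the drift at time \<open>t\<close>.\<close>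

definition drift_response :: "real \<Rightarrow> real \<times> real \<times> real \<Rightarrow> ennreal" where
  "drift_response t x = (\<integral>\<^sup>+s. ennreal (supOU_kernel s x) \<partial>averaging_law t)"

lemma measurable_drift_response [measurable]: "drift_response t \<in> borel_measurable jump_intensity"
proof -
  interpret Q: prob_space "averaging_law t" by (rule prob_space_averaging_law)
  have "(\<lambda>(x, s). ennreal (supOU_kernel s x)) \<in> borel_measurable (jump_intensity \<Otimes>\<^sub>M averaging_law t)"
    using measurable_supOU_kernel_averaging[OF refl, of t]
    by (subst (asm) measurable_pair_swap_iff) (simp only: case_prod_unfold fst_conv snd_conv)
  from Q.borel_measurable_nn_integral[OF this] show ?thesis
    by (simp only: drift_response_def[abs_def])
qed

text \<open>Stated for a general \<open>\<sigma>\<close>-finite measure because it serves twice: with the intensity, to compute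
  moments, and with the Poisson measure of a single outcome, to rewrite the drift.\<close>

lemma nn_integral_mult_drift_response:
  assumes K: "sigma_finite_measure K" "sets K = sets jump_intensity" and H: "H \<in> borel_measurable K"
  shows "(\<integral>\<^sup>+x. H x * drift_response t x \<partial>K) = (\<integral>\<^sup>+s. (\<integral>\<^sup>+x. H x * ennreal (supOU_kernel s x) \<partial>K) \<partial>averaging_law t)"
proof -
  interpret K: sigma_finite_measure K by fact
  interpret Q: prob_space "averaging_law t" by (rule prob_space_averaging_law)
  interpret P: pair_sigma_finite "averaging_law t" K ..
  have k: "(\<lambda>p. ennreal (supOU_kernel (fst p) (snd p))) \<in> borel_measurable (averaging_law t \<Otimes>\<^sub>M K)"
    using measurable_supOU_kernel_averaging[OF K(2)] by (simp only: case_prod_unfold)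
  have "(\<lambda>s. ennreal (supOU_kernel s x)) \<in> borel_measurable (averaging_law t)" if "x \<in> space K" for x
    using measurable_compose[OF measurable_Pair2'[OF that] k] by simp
  then have "(\<integral>\<^sup>+x. H x * drift_response t x \<partial>K) = (\<integral>\<^sup>+x. (\<integral>\<^sup>+s. H x * ennreal (supOU_kernel s x) \<partial>averaging_law t) \<partial>K)"
    by (intro nn_integral_cong) (simp add: drift_response_def nn_integral_cmult)
  also have "\<dots> = (\<integral>\<^sup>+s. (\<integral>\<^sup>+x. H x * ennreal (supOU_kernel s x) \<partial>K) \<partial>averaging_law t)"
  proof -
    have "(\<lambda>p. H (snd p) * ennreal (supOU_kernel (fst p) (snd p))) \<in> borel_measurable (averaging_law t \<Otimes>\<^sub>M K)"
      using k measurable_compose[OF measurable_snd H] by (intro borel_measurable_times_ennreal) auto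
    from P.Fubini[OF this] show ?thesis by simp
  qed
  finally show ?thesis .
qed

lemma nn_integral_drift_response:
  "(\<integral>\<^sup>+x. drift_response t x \<partial>jump_intensity) = jump_moment 1 * rate_integral 0"
proof -
  interpret Q: prob_space "averaging_law t" by (rule prob_space_averaging_law)
  show ?thesis
    using nn_integral_mult_drift_response[OF jump.sigma_finite_measure_axioms refl, of "\<lambda>_. 1" t]
    by (simp add: nn_integral_supOU_kernel Q.emeasure_space_1[simplified])
qed

lemma nn_integral_supOU_kernel_mult_le:
  "(\<integral>\<^sup>+x. ennreal (supOU_kernel s x) * ennreal (supOU_kernel u x) \<partial>jump_intensity)
    \<le> jump_moment 2 * (rate_integral 0 / 2)"
proof (cases "s \<le> u")
  case True
  then show ?thesis
    unfolding nn_integral_supOU_kernel_mult[OF True]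
    by (intro mult_left_mono divide_right_mono_ennreal rate_integral_antimono) auto
next
  case False
  then have ge: "u \<le> s" by simp
  have "(\<integral>\<^sup>+x. ennreal (supOU_kernel s x) * ennreal (supOU_kernel u x) \<partial>jump_intensity) = jump_moment 2 * (rate_integral (s - u) / 2)"
    using nn_integral_supOU_kernel_mult[OF ge] by (simp add: mult.commute)
  then show ?thesis
    using ge by (auto intro!: mult_left_mono divide_right_mono_ennreal rate_integral_antimono)
qed

text \<open>The dichotomy behind the decay of the drift covariance.  Either the time \<open>v\<close> drawn for \<open>t + h\<close> falls
  back by at least \<open>h / 2\<close>, which has small probability, or it is at distance at least \<open>h / 2\<close> from every
  time \<open>s \<le> t\<close>, where the supOU covariance is small.\<close>

lemma nn_integral_drift_response_mult_le:
  assumes h: "h \<ge> 0"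
  shows "(\<integral>\<^sup>+x. drift_response t x * drift_response (t + h) x \<partial>jump_intensity)
    \<le> jump_moment 2 * (rate_integral 0 / 2) * ennreal (laplace_\<rho> (h / 2)) + jump_moment 2 * (rate_integral (h / 2) / 2)"
proof -
  let ?K = "jump_moment 2 * (rate_integral 0 / 2)" and ?c = "jump_moment 2 * (rate_integral (h / 2) / 2)"
  interpret Q: prob_space "averaging_law t" by (rule prob_space_averaging_law)
  interpret Q': prob_space "averaging_law (t + h)" by (rule prob_space_averaging_law)
  \<comment> \<open>the threshold \<open>t + h / 2\<close> is written as a delay of \<open>h / 2\<close> from \<open>t + h\<close>\<close>
  have cov: "(\<integral>\<^sup>+x. ennreal (supOU_kernel s x) * ennreal (supOU_kernel v x) \<partial>jump_intensity)
      \<le> ?K * indicator {..(t + h) - h / 2} v + ?c" if "s \<le> t" for s v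
  proof (cases "v \<le> (t + h) - h / 2")
    case True
    have "?K \<le> ?K + ?c" by simp
    with True show ?thesis
      using nn_integral_supOU_kernel_mult_le[of s v] by (auto intro: order_trans)
  next
    case False
    then have "s \<le> v" "h / 2 \<le> v - s" using that h by auto
    then have "(\<integral>\<^sup>+x. ennreal (supOU_kernel s x) * ennreal (supOU_kernel v x) \<partial>jump_intensity) \<le> ?c"
      by (auto simp: nn_integral_supOU_kernel_mult intro!: mult_left_mono divide_right_mono_ennreal rate_integral_antimono)
    then show ?thesis by (rule order_trans) simp
  qed
  have "(\<integral>\<^sup>+x. drift_response t x * drift_response (t + h) x \<partial>jump_intensity)
      = (\<integral>\<^sup>+s. (\<integral>\<^sup>+x. drift_response (t + h) x * ennreal (supOU_kernel s x) \<partial>jump_intensity) \<partial>averaging_law t)"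
    using nn_integral_mult_drift_response[OF jump.sigma_finite_measure_axioms refl measurable_drift_response, of "t + h" t]
    by (simp add: mult.commute)
  also have "\<dots> = (\<integral>\<^sup>+s. (\<integral>\<^sup>+x. ennreal (supOU_kernel s x) * drift_response (t + h) x \<partial>jump_intensity) \<partial>averaging_law t)"
    by (simp add: mult.commute)
  also have "\<dots> = (\<integral>\<^sup>+s. (\<integral>\<^sup>+v. (\<integral>\<^sup>+x. ennreal (supOU_kernel s x) * ennreal (supOU_kernel v x) \<partial>jump_intensity)
      \<partial>averaging_law (t + h)) \<partial>averaging_law t)"
    by (subst nn_integral_mult_drift_response[OF jump.sigma_finite_measure_axioms refl]) simp_all
  also have "\<dots> \<le> (\<integral>\<^sup>+s. (\<integral>\<^sup>+v. ?K * indicator {..(t + h) - h / 2} v + ?c \<partial>averaging_law (t + h)) \<partial>averaging_law t)"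
    by (rule nn_integral_mono_AE) (use AE_averaging_law[of t] in eventually_elim, intro nn_integral_mono cov)
  also have "\<dots> = ?K * emeasure (averaging_law (t + h)) {..(t + h) - h / 2} + ?c"
    using Q.emeasure_space_1 Q'.emeasure_space_1 by (simp add: nn_integral_add nn_integral_cmult)
  also have "\<dots> = ?K * ennreal (laplace_\<rho> (h / 2)) + ?c"
    using h by (subst emeasure_averaging_law_atMost) auto
  finally show ?thesis .
qed

definition stationary_mean :: real where
  "stationary_mean = enn2real (jump_moment 1 * rate_integral 0)"

lemma stationary_mean: "jump_moment 1 * rate_integral 0 = ennreal stationary_mean" "stationary_mean > 0"
proof -
  have "jump_moment 1 * rate_integral 0 < \<infinity>"
    using jump_moment_finite[of 1] rate_integral_0_finite by (simp add: ennreal_mult_less_top)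
  then show "jump_moment 1 * rate_integral 0 = ennreal stationary_mean"
    by (simp add: stationary_mean_def less_top)
  then show "stationary_mean > 0"
    using stationary_mean_positive by simp
qed

definition drift_covariance :: "real \<Rightarrow> real \<Rightarrow> real" where
  "drift_covariance t u = enn2real (\<integral>\<^sup>+x. drift_response t x * drift_response u x \<partial>jump_intensity)"

definition drift_covariance_bound :: "real \<Rightarrow> real" where
  "drift_covariance_bound h = enn2real (jump_moment 2) / 2 *
     (enn2real (rate_integral 0) * laplace_\<rho> (h / 2) + enn2real (rate_integral (h / 2)))"

lemma drift_covariance_nonneg: "0 \<le> drift_covariance t u"
  by (simp add: drift_covariance_def)

lemma drift_covariance_bound_eq:
  assumes "h \<ge> 0"
  shows "jump_moment 2 * (rate_integral 0 / 2) * ennreal (laplace_\<rho> (h / 2)) + jump_moment 2 * (rate_integral (h / 2) / 2)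
    = ennreal (drift_covariance_bound h)"
proof -
  obtain m where m: "jump_moment 2 = ennreal m" "m \<ge> 0"
    using jump_moment_finite[of 2] by (cases "jump_moment 2") auto
  obtain a where a: "rate_integral 0 = ennreal a" "a \<ge> 0"
    using rate_integral_0_finite by (cases "rate_integral 0") auto
  obtain b where b: "rate_integral (h / 2) = ennreal b" "b \<ge> 0"
    using rate_integral_finite[of "h / 2"] assms by (cases "rate_integral (h / 2)") auto
  have "ennreal x / 2 = ennreal (x / 2)" if "x \<ge> 0" for x
    using divide_ennreal[OF that, of 2] by simp
  then show ?thesis
    using m a b laplace_\<rho>_nonneg[of "h / 2"]
    by (simp add: drift_covariance_bound_def ennreal_mult[symmetric] ennreal_plus[symmetric] algebra_simps
        del: ennreal_plus)
qed

lemma drift_covariance_le: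
  assumes "h \<ge> 0"
  shows "drift_covariance t (t + h) \<le> drift_covariance_bound h"
proof -
  have "0 \<le> drift_covariance_bound h"
    using laplace_\<rho>_nonneg[of "h / 2"] by (simp add: drift_covariance_bound_def)
  then show ?thesis
    unfolding drift_covariance_def
    using nn_integral_drift_response_mult_le[OF assms, of t] drift_covariance_bound_eq[OF assms]
    by (intro enn2real_leI) auto
qed

lemma drift_response_square_finite:
  "(\<integral>\<^sup>+x. drift_response t x * drift_response t x \<partial>jump_intensity) < \<infinity>"
  using nn_integral_drift_response_mult_le[of 0 t] drift_covariance_bound_eq[of 0]
  by (auto intro: le_less_trans)

end

section \<open>The autocovariance of the model\<close>

context supOUSV
begin

lemma supOU_eq_poisson_integral:
  assumes "\<omega> \<in> space M"
  shows "supOU N t \<omega> = jumps.poisson_integral (\<lambda>x. ennreal (supOU_kernel t x)) \<omega>"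
proof -
  have "supOU N t \<omega> = (\<integral>x. supOU_kernel t x \<partial>N \<omega>)"
    unfolding supOU_def set_lebesgue_integral_def
    by (intro Bochner_Integration.integral_cong) (auto simp: supOU_kernel_def)
  also have "\<dots> = enn2real (\<integral>\<^sup>+x. ennreal (supOU_kernel t x) \<partial>N \<omega>)"
    by (rule integral_eq_nn_integral) (use assms in \<open>auto simp: jumps.measurable_N supOU_kernel_nonneg\<close>)
  finally show ?thesis by (simp add: jumps.poisson_integral_def)
qed

lemma measurable_supOU [measurable]: "supOU N t \<in> borel_measurable M"
proof -
  have "jumps.poisson_integral (\<lambda>x. ennreal (supOU_kernel t x)) \<in> borel_measurable M" by measurable
  then show ?thesis by (simp add: supOU_eq_poisson_integral cong: measurable_cong)
qed

lemma supOU_nonneg: "\<omega> \<in> space M \<Longrightarrow> 0 \<le> supOU N t \<omega>"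
  by (simp add: supOU_eq_poisson_integral jumps.poisson_integral_def)

lemma expectation_supOU: "expectation (supOU N t) = stationary_mean"
proof -
  have "expectation (supOU N t) = expectation (jumps.poisson_integral (\<lambda>x. ennreal (supOU_kernel t x)))"
    by (intro Bochner_Integration.integral_cong) (auto simp: supOU_eq_poisson_integral)
  also have "\<dots> = stationary_mean"
    using stationary_mean(2)
    by (subst jumps.expectation_poisson_integral) (simp_all add: nn_integral_supOU_kernel stationary_mean(1)[simplified])
  finally show ?thesis .
qed

lemma expectation_drift_poisson_integral:
  "expectation (jumps.poisson_integral (drift_response t)) = stationary_mean"
  using stationary_mean(2)
  by (subst jumps.expectation_poisson_integral) (simp_all add: nn_integral_drift_response stationary_mean(1)[simplified])

text \<open>Fubini's theorem is applied to the Poisson measure of a fixed outcome and the averaging law.  Only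
  measurability in time, for that outcome, enters.\<close>

lemma drift_eq_poisson_integral:
  "AE \<omega> in M. supOUSV_drift M \<rho> \<mu> N t \<omega> =
     \<mu> * (jumps.poisson_integral (drift_response t) \<omega> - stationary_mean)"
proof -
  have "(\<integral>\<^sup>+x. drift_response t x \<partial>jump_intensity) < \<infinity>"
    by (simp add: nn_integral_drift_response stationary_mean(1)[simplified])
  from jumps.AE_sigma_finite_N jumps.AE_nn_integral_N_finite[OF measurable_drift_response this] AE_space
  show ?thesis
  proof eventually_elim
    case (elim \<omega>)
    interpret K: sigma_finite_measure "N \<omega>" by fact
    interpret Q: prob_space "averaging_law t" by (rule prob_space_averaging_law)
    note sN = jumps.sets_N[OF elim(3)]
    \<comment> \<open>the value of the supOU process as an extended real, before infinite values are set to \<open>0\<close>\<close>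
    define y where "y s = (\<integral>\<^sup>+x. ennreal (supOU_kernel s x) \<partial>N \<omega>)" for s
    have "(\<lambda>(s, x). ennreal (supOU_kernel s x)) \<in> borel_measurable (averaging_law t \<Otimes>\<^sub>M N \<omega>)"
      by (rule measurable_supOU_kernel_averaging[OF sN])
    from K.borel_measurable_nn_integral[OF this] have y[measurable]: "y \<in> borel_measurable borel"
      unfolding y_def[abs_def] by (simp cong: measurable_cong_sets)
    have Y: "supOU N s \<omega> = enn2real (y s)" for s
      using elim(3) by (simp add: supOU_eq_poisson_integral jumps.poisson_integral_def y_def)
    have int: "(\<integral>\<^sup>+s. y s \<partial>averaging_law t) = (\<integral>\<^sup>+x. drift_response t x \<partial>N \<omega>)"
      using nn_integral_mult_drift_response[OF K.sigma_finite_measure_axioms sN, of "\<lambda>_. 1" t]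
      by (simp add: y_def)
    have "AE s in averaging_law t. y s \<noteq> \<infinity>"
      using elim(2) by (intro nn_integral_PInf_AE) (auto simp: int)
    then have ey: "(\<integral>\<^sup>+s. ennreal (enn2real (y s)) \<partial>averaging_law t) = (\<integral>\<^sup>+x. drift_response t x \<partial>N \<omega>)"
      unfolding int[symmetric] by (intro nn_integral_cong_AE) (auto elim!: eventually_mono simp: less_top)
    have Yint: "integrable (averaging_law t) (\<lambda>s. enn2real (y s))"
      using elim(2) by (intro integrableI_nonneg) (auto simp: ey)
    have Yval: "(\<integral>s. enn2real (y s) \<partial>averaging_law t) = jumps.poisson_integral (drift_response t) \<omega>"
      by (subst integral_eq_nn_integral) (auto simp: ey jumps.poisson_integral_def)
    have "supOUSV_drift M \<rho> \<mu> N t \<omega>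
        = (\<integral>p. drift_kernel t p * (\<mu> * (enn2real (y (snd p)) - stationary_mean)) \<partial>noise_control)"
      unfolding supOUSV_drift_def set_lebesgue_integral_def expectation_supOU
      by (intro Bochner_Integration.integral_cong) (auto simp: drift_kernel_def Y)
    also have "\<dots> = (\<integral>p. \<mu> * (enn2real (y (snd p)) - stationary_mean) \<partial>density noise_control (\<lambda>p. ennreal (drift_kernel t p)))"
      by (subst integral_density) (auto simp: drift_kernel_nonneg)
    also have "\<dots> = (\<integral>s. \<mu> * (enn2real (y s) - stationary_mean) \<partial>averaging_law t)"
      unfolding averaging_law_def by (subst integral_distr) auto
    also have "\<dots> = \<mu> * (jumps.poisson_integral (drift_response t) \<omega> - stationary_mean)"
      using Yint Yval Q.prob_space by simp
    finally show ?case .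
  qed
qed

lemma expectation_diffusion_mult:
  "expectation (\<lambda>\<omega>. supOUSV_diffusion \<sigma> N t R s \<omega> * supOUSV_diffusion \<sigma> N (t + h) R s \<omega>)
    = indicator ({0<..} \<times> ({..t} \<inter> {..t + h})) (R, s) *
      (\<sigma>\<^sup>2 * stationary_mean * R * exp (- R * h) * exp (- (2 * R) * (t - s)))"
proof (cases "R > 0 \<and> s \<le> t \<and> s \<le> t + h")
  case True
  have "expectation (\<lambda>\<omega>. supOUSV_diffusion \<sigma> N t R s \<omega> * supOUSV_diffusion \<sigma> N (t + h) R s \<omega>)
      = expectation (\<lambda>\<omega>. (exp (- R * (t - s)) * exp (- R * (t + h - s)) * \<sigma>\<^sup>2 * R) * supOU N s \<omega>)"
  proof (intro Bochner_Integration.integral_cong refl)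
    fix \<omega> assume "\<omega> \<in> space M"
    then have "sqrt (R * supOU N s \<omega>) * sqrt (R * supOU N s \<omega>) = R * supOU N s \<omega>"
      using True supOU_nonneg by simp
    then show "supOUSV_diffusion \<sigma> N t R s \<omega> * supOUSV_diffusion \<sigma> N (t + h) R s \<omega>
        = (exp (- R * (t - s)) * exp (- R * (t + h - s)) * \<sigma>\<^sup>2 * R) * supOU N s \<omega>"
      using True by (simp add: supOUSV_diffusion_def power2_eq_square mult_ac)
  qed
  also have "\<dots> = (exp (- R * (t - s)) * exp (- R * (t + h - s)) * \<sigma>\<^sup>2 * R) * stationary_mean"
    by (simp add: expectation_supOU)
  also have "exp (- R * (t - s)) * exp (- R * (t + h - s)) = exp (- R * h) * exp (- (2 * R) * (t - s))"
    by (simp add: mult_exp_exp algebra_simps)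
  finally show ?thesis using True by simp
qed (auto simp: supOUSV_diffusion_def indicator_def)

lemma diffusion_covariance:
  assumes h: "h \<ge> 0" and Z: "has_ito_integral M F \<rho> B (supOUSV_diffusion \<sigma> N t) Z"
    and Z': "has_ito_integral M F \<rho> B (supOUSV_diffusion \<sigma> N (t + h)) Z'"
  shows "expectation (\<lambda>\<omega>. Z \<omega> * Z' \<omega>) = \<sigma>\<^sup>2 * stationary_mean / 2 * laplace_\<rho> h"
proof -
  let ?c = "\<lambda>(R, s). indicator ({0<..} \<times> {..t}) (R, s) *
      (\<sigma>\<^sup>2 * stationary_mean * R * exp (- R * h) * exp (- (2 * R) * (t - s)))"
  have meas: "supOUSV_diffusion \<sigma> N u R s \<in> borel_measurable M" for u R s
    unfolding supOUSV_diffusion_def[abs_def] by measurable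
  have tt: "{..t} \<inter> {..t + h} = {..t}" using h by auto
  have cm: "?c \<in> borel_measurable noise_control"
    by (simp add: indicator_times)
  have "expectation (\<lambda>\<omega>. Z \<omega> * Z' \<omega>) = (\<integral>y. ?c y \<partial>noise_control)"
    by (rule ito_isometry[OF Z Z' meas meas _ cm])
      (simp only: expectation_diffusion_mult tt prod.case)
  also have "\<dots> = enn2real (\<integral>\<^sup>+(R, s). ennreal (indicator ({0<..} \<times> {..t}) (R, s) *
      ((\<sigma>\<^sup>2 * stationary_mean * R * exp (- R * h)) * exp (- (2 * R) * (t - s)))) \<partial>noise_control)"
  proof -
    have "0 \<le> ?c y" for y
      using stationary_mean(2) by (auto simp: indicator_def split: prod.splits)
    then show ?thesis
      using cm by (subst integral_eq_nn_integral) (auto simp: case_prod_unfold)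
  qed
  also have "(\<integral>\<^sup>+(R, s). ennreal (indicator ({0<..} \<times> {..t}) (R, s) *
      ((\<sigma>\<^sup>2 * stationary_mean * R * exp (- R * h)) * exp (- (2 * R) * (t - s)))) \<partial>noise_control)
      = (\<integral>\<^sup>+R. ennreal (indicator {0<..} R * ((\<sigma>\<^sup>2 * stationary_mean * R * exp (- R * h)) / (2 * R))) \<partial>\<rho>)"
    using stationary_mean(2) by (intro nn_integral_noise_control_exp) auto
  also have "\<dots> = (\<integral>\<^sup>+R. ennreal (\<sigma>\<^sup>2 * stationary_mean / 2) * ennreal (indicator {0<..} R * exp (- R * h)) \<partial>\<rho>)"
    using stationary_mean(2)
    by (intro nn_integral_cong) (auto simp: indicator_def ennreal_mult'[symmetric])
  also have "\<dots> = ennreal (\<sigma>\<^sup>2 * stationary_mean / 2) * ennreal (laplace_\<rho> h)"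
    unfolding nn_integral_laplace_\<rho>[OF h, symmetric] by (intro nn_integral_cmult) measurable
  finally show ?thesis
    using stationary_mean(2) laplace_\<rho>_nonneg[of h] by (simp add: enn2real_mult)
qed

lemma X_decomposition:
  obtains Z where "has_ito_integral M F \<rho> B (supOUSV_diffusion \<sigma> N t) Z"
    "AE \<omega> in M. X t \<omega> = \<mu> * (jumps.poisson_integral (drift_response t) \<omega> - stationary_mean) + Z \<omega>"
proof -
  obtain Z where Z: "has_ito_integral M F \<rho> B (supOUSV_diffusion \<sigma> N t) Z"
      "AE \<omega> in M. X t \<omega> = supOUSV_drift M \<rho> \<mu> N t \<omega> + Z \<omega>"
    using X_eq by blast
  show ?thesis
    by (rule that[OF Z(1)]) (use Z(2) drift_eq_poisson_integral[of t] in eventually_elim, simp)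
qed

lemma drift_response_integrability:
  "drift_response t \<in> borel_measurable jump_intensity"
  "(\<integral>\<^sup>+x. drift_response t x \<partial>jump_intensity) < \<infinity>"
  "(\<integral>\<^sup>+x. drift_response t x * drift_response t x \<partial>jump_intensity) < \<infinity>"
  using drift_response_square_finite[of t]
  by (auto simp: nn_integral_drift_response stationary_mean(1)[simplified])

theorem expectation_X: "expectation (X t) = 0"
proof -
  obtain Z where Z: "has_ito_integral M F \<rho> B (supOUSV_diffusion \<sigma> N t) Z"
    and eq: "AE \<omega> in M. X t \<omega> = \<mu> * (jumps.poisson_integral (drift_response t) \<omega> - stationary_mean) + Z \<omega>"
    by (rule X_decomposition)
  note D = square_integrable_integrable[OF jumps.square_integrable_poisson_integral[OF drift_response_integrability[of t]]]
  note Zi = square_integrable_integrable[OF ito_integral_square_integrable[OF Z]]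
  have "expectation (X t) = expectation (\<lambda>\<omega>. \<mu> * (jumps.poisson_integral (drift_response t) \<omega> - stationary_mean) + Z \<omega>)"
    using D Zi by (intro integral_cong_AE X_rv eq) auto
  also have "\<dots> = 0"
    using D Zi by (simp add: prob_space expectation_drift_poisson_integral expectation_ito_integral[OF Z])
  finally show ?thesis .
qed

text \<open>Drift and diffusion are uncorrelated, so the autocovariance is the sum of the two contributions.\<close>

theorem covariance_X:
  assumes h: "h \<ge> 0"
  shows "expectation (\<lambda>\<omega>. X t \<omega> * X (t + h) \<omega>)
    = \<sigma>\<^sup>2 * stationary_mean / 2 * laplace_\<rho> h + \<mu>\<^sup>2 * drift_covariance t (t + h)"
proof -
  let ?D = "\<lambda>t \<omega>. jumps.poisson_integral (drift_response t) \<omega> - stationary_mean"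
  obtain Z where Z: "has_ito_integral M F \<rho> B (supOUSV_diffusion \<sigma> N t) Z"
    and eq: "AE \<omega> in M. X t \<omega> = \<mu> * ?D t \<omega> + Z \<omega>"
    by (rule X_decomposition)
  obtain Z' where Z': "has_ito_integral M F \<rho> B (supOUSV_diffusion \<sigma> N (t + h)) Z'"
    and eq': "AE \<omega> in M. X (t + h) \<omega> = \<mu> * ?D (t + h) \<omega> + Z' \<omega>"
    by (rule X_decomposition)
  have D: "square_integrable M (?D u)" for u
    by (intro square_integrable_diff square_integrable_const
        jumps.square_integrable_poisson_integral[OF drift_response_integrability])
  note Zs = ito_integral_square_integrable[OF Z] ito_integral_square_integrable[OF Z']
  have zero: "expectation (\<lambda>\<omega>. ?D u \<omega> * V \<omega>) = 0"
    if V: "has_ito_integral M F \<rho> B H V" for u H V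
  proof -
    note Vs = ito_integral_square_integrable[OF V]
    have "expectation (\<lambda>\<omega>. ?D u \<omega> * V \<omega>)
        = expectation (\<lambda>\<omega>. jumps.poisson_integral (drift_response u) \<omega> * V \<omega> - stationary_mean * V \<omega>)"
      by (simp add: algebra_simps)
    also have "\<dots> = 0"
      using square_integrable_mult[OF jumps.square_integrable_poisson_integral[OF drift_response_integrability[of u]] Vs]
        square_integrable_integrable[OF Vs]
      by (simp add: expectation_poisson_integral_mult_ito[OF drift_response_integrability V] expectation_ito_integral[OF V])
    finally show ?thesis .
  qed
  have "expectation (\<lambda>\<omega>. X t \<omega> * X (t + h) \<omega>)
      = expectation (\<lambda>\<omega>. (\<mu> * ?D t \<omega> + Z \<omega>) * (\<mu> * ?D (t + h) \<omega> + Z' \<omega>))"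
  proof (rule integral_cong_AE)
    show "AE \<omega> in M. X t \<omega> * X (t + h) \<omega> = (\<mu> * ?D t \<omega> + Z \<omega>) * (\<mu> * ?D (t + h) \<omega> + Z' \<omega>)"
      using eq eq' by eventually_elim simp
    show "(\<lambda>\<omega>. X t \<omega> * X (t + h) \<omega>) \<in> borel_measurable M"
      by (intro borel_measurable_times X_rv)
    show "(\<lambda>\<omega>. (\<mu> * ?D t \<omega> + Z \<omega>) * (\<mu> * ?D (t + h) \<omega> + Z' \<omega>)) \<in> borel_measurable M"
      by (intro borel_measurable_times borel_measurable_add borel_measurable_const
          square_integrable_measurable[OF D] square_integrable_measurable[OF Zs(1)] square_integrable_measurable[OF Zs(2)])
  qed
  also have "\<dots> = expectation (\<lambda>\<omega>. \<mu>\<^sup>2 * (?D t \<omega> * ?D (t + h) \<omega>) + \<mu> * (?D t \<omega> * Z' \<omega>)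
      + \<mu> * (?D (t + h) \<omega> * Z \<omega>) + Z \<omega> * Z' \<omega>)"
    by (intro Bochner_Integration.integral_cong) (auto simp: algebra_simps power2_eq_square)
  also have "\<dots> = \<mu>\<^sup>2 * expectation (\<lambda>\<omega>. ?D t \<omega> * ?D (t + h) \<omega>) + expectation (\<lambda>\<omega>. Z \<omega> * Z' \<omega>)"
    using square_integrable_mult[OF D D, of t "t + h"] square_integrable_mult[OF D Zs(2), of t]
      square_integrable_mult[OF D Zs(1), of "t + h"] square_integrable_mult[OF Zs]
    by (simp add: zero[OF Z] zero[OF Z'])
  also have "expectation (\<lambda>\<omega>. ?D t \<omega> * ?D (t + h) \<omega>) = drift_covariance t (t + h)"
    using jumps.covariance_poisson_integral[OF drift_response_integrability[of t] drift_response_integrability[of "t + h"]]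
    by (simp add: expectation_drift_poisson_integral drift_covariance_def)
  finally show ?thesis
    by (simp add: diffusion_covariance[OF h Z Z'])
qed

text \<open>The drift part of the variance is nonnegative, so the diffusion part bounds the denominator from
  below.\<close>

theorem autocorrelation_bounds:
  assumes h: "h \<ge> 0"
  shows "0 \<le> autocorrelation X t h"
    and "autocorrelation X t h \<le> laplace_\<rho> h + \<mu>\<^sup>2 * (2 / (\<sigma>\<^sup>2 * stationary_mean) * drift_covariance_bound h)"
proof -
  let ?a = "\<sigma>\<^sup>2 * stationary_mean / 2"
  let ?num = "?a * laplace_\<rho> h + \<mu>\<^sup>2 * drift_covariance t (t + h)"
  let ?den = "?a + \<mu>\<^sup>2 * drift_covariance t t"
  have AC: "autocorrelation X t h = ?num / ?den"
    using covariance_X[OF h, of t] covariance_X[of 0 t]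
    by (simp add: autocorrelation_def expectation_X power2_eq_square laplace_\<rho>_0)
  have a: "?a > 0" using \<sigma>_pos stationary_mean(2) by simp
  have den: "?a \<le> ?den" using drift_covariance_nonneg[of t t] by simp
  have num: "0 \<le> ?num"
    using a laplace_\<rho>_nonneg[of h] drift_covariance_nonneg[of t "t + h"] by simp
  show "0 \<le> autocorrelation X t h"
    unfolding AC using a den num by simp
  have "?num / ?den \<le> ?num / ?a"
    using a den num by (intro divide_left_mono) auto
  also have "\<dots> = laplace_\<rho> h + \<mu>\<^sup>2 * (drift_covariance t (t + h) / ?a)"
  proof -
    have "(c * x + y * d) / c = x + y * (d / c)" if "c > 0" for c x y d :: real
      using that by (simp add: add_divide_distrib)
    from this[OF a] show ?thesis .
  qed
  also have "\<dots> \<le> laplace_\<rho> h + \<mu>\<^sup>2 * (drift_covariance_bound h / ?a)"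
    using a drift_covariance_le[OF h, of t] by (intro add_left_mono mult_left_mono divide_right_mono) auto
  finally show "autocorrelation X t h \<le> laplace_\<rho> h + \<mu>\<^sup>2 * (2 / (\<sigma>\<^sup>2 * stationary_mean) * drift_covariance_bound h)"
    unfolding AC by (simp add: mult.commute)
qed

end

section \<open>Decay rates for gamma densities\<close>

text \<open>Tilting by \<open>e\<^sup>-\<^sup>h\<^sup>r\<close> and dividing by a power of \<open>r\<close> keep the density a multiple of a gamma density: the
  inverse scale \<open>1 / \<beta>\<close> becomes \<open>h + 1 / \<beta>\<close> and the shape \<open>\<alpha>\<close> becomes \<open>\<alpha> - p\<close>.\<close>

lemma nn_integral_gamma_measure:
  assumes pos: "0 < \<beta>" "0 < \<alpha>" "p < \<alpha>" "0 \<le> h"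
  shows "(\<integral>\<^sup>+r. ennreal (indicator {0<..} r * (exp (- r * h) * r powr (- p))) \<partial>gamma_measure \<alpha> \<beta>)
    = ennreal (Gamma (\<alpha> - p) / (Gamma \<alpha> * \<beta> powr \<alpha>) / (h + 1 / \<beta>) powr (\<alpha> - p))"
proof -
  let ?C = "Gamma \<alpha> * \<beta> powr \<alpha>"
  have C: "?C > 0" using pos Gamma_real_pos[of \<alpha>] by simp
  have [measurable]: "gamma_density \<alpha> \<beta> \<in> borel_measurable borel"
    unfolding gamma_density_def[abs_def] by measurable
  have "(\<integral>\<^sup>+r. ennreal (indicator {0<..} r * (exp (- r * h) * r powr (- p))) \<partial>gamma_measure \<alpha> \<beta>)
      = (\<integral>\<^sup>+r. ennreal (gamma_density \<alpha> \<beta> r) * ennreal (indicator {0<..} r * (exp (- r * h) * r powr (- p))) \<partial>lborel)"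
    unfolding gamma_measure_def by (intro nn_integral_density) auto
  also have "\<dots> = (\<integral>\<^sup>+r. ennreal (1 / ?C) *
      ennreal (indicator {0<..} r * (r powr ((\<alpha> - p) - 1) * exp (- ((h + 1 / \<beta>) * r)))) \<partial>lborel)"
  proof (intro nn_integral_cong)
    fix r :: real
    show "ennreal (gamma_density \<alpha> \<beta> r) * ennreal (indicator {0<..} r * (exp (- r * h) * r powr (- p)))
      = ennreal (1 / ?C) * ennreal (indicator {0<..} r * (r powr ((\<alpha> - p) - 1) * exp (- ((h + 1 / \<beta>) * r))))"
    proof (cases "r > 0")
      case True
      have e: "exp (- ((h + 1 / \<beta>) * r)) = exp (- r / \<beta>) * exp (- r * h)"
        by (simp add: mult_exp_exp algebra_simps)
      have "r powr ((\<alpha> - p) - 1) = r powr ((\<alpha> - 1) + - p)" by (simp add: algebra_simps)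
      then have q: "r powr ((\<alpha> - p) - 1) = r powr (\<alpha> - 1) * r powr (- p)" by (simp only: powr_add)
      show ?thesis
        unfolding e q using True C
        by (simp add: gamma_density_def ennreal_mult'[symmetric] ennreal_mult''[symmetric])
    qed simp
  qed
  also have "\<dots> = ennreal (1 / ?C) * ennreal (Gamma (\<alpha> - p) / (h + 1 / \<beta>) powr (\<alpha> - p))"
    using pos by (subst nn_integral_cmult) (measurable, subst nn_integral_gamma, auto intro!: add_nonneg_pos)
  also have "\<dots> = ennreal (Gamma (\<alpha> - p) / ?C / (h + 1 / \<beta>) powr (\<alpha> - p))"
    using C by (subst ennreal_mult'[symmetric]) (auto simp: less_imp_le)
  finally show ?thesis .
qed

text \<open>Used with \<open>p = 0\<close> for the Laplace transform of \<open>\<rho>\<close> and with \<open>p = 1\<close> for the covariance of the supOU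
  process; the factor \<open>c\<close> is there for the half lag \<open>h / 2\<close>.\<close>

lemma gamma_transform_bigo:
  fixes F :: "real \<Rightarrow> real"
  assumes pos: "0 < \<beta>" "0 < \<alpha>" "p < \<alpha>"
    and F: "\<And>h. 0 \<le> h \<Longrightarrow> ennreal (F h) =
      (\<integral>\<^sup>+r. ennreal (indicator {0<..} r * (exp (- r * h) * r powr (- p))) \<partial>gamma_measure \<alpha> \<beta>)"
    and F0: "\<And>h. 0 \<le> F h" and c: "0 < c"
  shows "(\<lambda>h. F (h * c)) \<in> O(\<lambda>h. h powr (- (\<alpha> - p)))"
proof (rule bigoI)
  let ?C = "Gamma (\<alpha> - p) / (Gamma \<alpha> * \<beta> powr \<alpha>)"
  have C: "0 \<le> ?C" using pos Gamma_real_pos[of \<alpha>] Gamma_real_pos[of "\<alpha> - p"] by simp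
  show "\<forall>\<^sub>F h in at_top. norm (F (h * c)) \<le> (?C * c powr (- (\<alpha> - p))) * norm (h powr (- (\<alpha> - p)))"
    using eventually_gt_at_top[of 0]
  proof eventually_elim
    case (elim h)
    then have hc: "0 < h * c" using c by simp
    have "ennreal (F (h * c)) = ennreal (?C / (h * c + 1 / \<beta>) powr (\<alpha> - p))"
      using F[of "h * c"] nn_integral_gamma_measure[OF pos, of "h * c"] hc by simp
    then have "F (h * c) = ?C / (h * c + 1 / \<beta>) powr (\<alpha> - p)"
      using ennreal_inj[OF F0 divide_nonneg_nonneg[OF C powr_ge_zero]] by simp
    also have "\<dots> \<le> ?C / (h * c) powr (\<alpha> - p)"
    proof -
      have "0 < h * c + 1 / \<beta>" using hc pos by (intro add_pos_pos) auto
      then show ?thesis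
        using C hc pos by (intro divide_left_mono powr_mono2 mult_pos_pos) auto
    qed
    also have "\<dots> = ?C * c powr (- (\<alpha> - p)) * h powr (- (\<alpha> - p))"
      using elim c by (simp only: powr_minus powr_mult divide_inverse) (simp add: powr_mult)
    finally show ?case using F0 by simp
  qed
qed

lemma powr_bigo_mono:
  fixes a b :: real
  assumes "a \<le> b" shows "(\<lambda>h. h powr (- b)) \<in> O(\<lambda>h::real. h powr (- a))"
proof (rule bigoI)
  show "\<forall>\<^sub>F h::real in at_top. norm (h powr (- b)) \<le> 1 * norm (h powr (- a))"
    using eventually_ge_at_top[of 1] by eventually_elim (use assms in \<open>simp add: powr_mono\<close>)
qed

lemma tendsto_0_of_bigo_powr:
  fixes F :: "real \<Rightarrow> real"
  assumes "F \<in> O(\<lambda>h. h powr (- a))" "a > 0"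
  shows "(F \<longlongrightarrow> 0) at_top"
proof -
  have "((\<lambda>h::real. h powr (- a)) \<longlongrightarrow> 0) at_top"
    using assms(2) by (intro tendsto_neg_powr filterlim_ident) auto
  then have "(\<lambda>h::real. h powr (- a)) \<in> o(\<lambda>_. 1)" by (intro smalloI_tendsto) auto
  with assms(1) have "F \<in> o(\<lambda>_. 1)" by (rule landau_o.big_small_trans)
  from smalloD_tendsto[OF this] show ?thesis by simp
qed

theorem proposition3:
  fixes \<nu> \<pi> \<rho> :: "real measure"
    and \<mu> \<sigma> \<alpha>\<^sub>r \<beta>\<^sub>r \<alpha>\<^sub>R \<beta>\<^sub>R \<eta> :: real
    and AC :: "'a measure \<Rightarrow> (real \<Rightarrow> 'a \<Rightarrow> real) \<Rightarrow> real \<Rightarrow> real \<Rightarrow> real"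
  defines "\<eta> \<equiv> ((\<alpha>\<^sub>r - 1) * (\<alpha>\<^sub>R + 2) - 1) / (\<alpha>\<^sub>R + 2)"
    and "AC \<equiv> prob_space.autocorrelation"
  assumes "supOUSV_parameters \<nu> \<pi> \<rho> \<sigma>"
    and "\<pi> = gamma_measure \<alpha>\<^sub>r \<beta>\<^sub>r" and "\<rho> = gamma_measure \<alpha>\<^sub>R \<beta>\<^sub>R"
    and "\<alpha>\<^sub>r - 1 > 0" and "\<alpha>\<^sub>R > 0" and "\<beta>\<^sub>r > 0" and "\<beta>\<^sub>R > 0"
    and "\<alpha>\<^sub>r \<in> {1<..2} \<longrightarrow> (\<alpha>\<^sub>r - 1) * (\<alpha>\<^sub>R + 2) > 1"
  shows "(\<forall>M F N B X t. supOUSV \<nu> \<pi> \<rho> \<mu> \<sigma> M F N B X \<longrightarrow> (AC M X t \<longlongrightarrow> 0) at_top) \<and>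
    (\<alpha>\<^sub>r > 2 \<longrightarrow>
      (\<exists>f g k. f \<in> O(\<lambda>h. h powr (- \<alpha>\<^sub>R)) \<and> g \<in> O(\<lambda>h. h powr (- \<alpha>\<^sub>R)) \<and>
        k \<in> O(\<lambda>h. h powr (- (\<alpha>\<^sub>r - 2))) \<and>
        (\<forall>M F N B X t. supOUSV \<nu> \<pi> \<rho> \<mu> \<sigma> M F N B X \<longrightarrow>
          (\<forall>h\<ge>0. AC M X t h \<le> \<sigma>\<^sup>2 * f h + \<mu>\<^sup>2 * (g h + k h))))) \<and>
    (\<alpha>\<^sub>r \<in> {1<..2} \<longrightarrow> \<eta> > 0 \<and>
      (\<exists>f g k. f \<in> O(\<lambda>h. h powr (- \<alpha>\<^sub>R)) \<and> g \<in> O(\<lambda>h. h powr (- \<alpha>\<^sub>R)) \<and>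
        k \<in> O(\<lambda>h. h powr (- \<eta>)) \<and>
        (\<forall>M F N B X t. supOUSV \<nu> \<pi> \<rho> \<mu> \<sigma> M F N B X \<longrightarrow>
          (\<forall>h\<ge>0. AC M X t h \<le> \<sigma>\<^sup>2 * f h + \<mu>\<^sup>2 * (g h + k h)))))"
proof -
  interpret P: supOUSV_parameters \<nu> \<pi> \<rho> \<sigma> by fact
  define L where "L = P.laplace_\<rho>"
  define J where "J h = enn2real (P.rate_integral h)" for h
  define K where "K = enn2real (P.jump_moment 2) / (\<sigma>\<^sup>2 * P.stationary_mean)"
  define f where "f h = L h / \<sigma>\<^sup>2" for h
  define g where "g h = K * J 0 * L (h / 2)" for h
  define k where "k h = K * J (h / 2)" for h
  have L: "(\<lambda>h. L (h * c)) \<in> O(\<lambda>h. h powr (- \<alpha>\<^sub>R))" if "c > 0" for c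
  proof -
    have "ennreal (L h) = (\<integral>\<^sup>+r. ennreal (indicator {0<..} r * (exp (- r * h) * r powr (- 0))) \<partial>gamma_measure \<alpha>\<^sub>R \<beta>\<^sub>R)"
      if "0 \<le> h" for h
      unfolding L_def assms(5)[symmetric] P.nn_integral_laplace_\<rho>[OF that, symmetric]
      by (intro nn_integral_cong) (auto simp: indicator_def)
    from gamma_transform_bigo[OF assms(9,7,7) this _ that] show ?thesis
      by (simp add: L_def P.laplace_\<rho>_nonneg)
  qed
  have J: "(\<lambda>h. J (h * c)) \<in> O(\<lambda>h. h powr (- (\<alpha>\<^sub>r - 1)))" if "c > 0" for c
  proof -
    have "ennreal (J h) = (\<integral>\<^sup>+r. ennreal (indicator {0<..} r * (exp (- r * h) * r powr (- 1))) \<partial>gamma_measure \<alpha>\<^sub>r \<beta>\<^sub>r)"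
      if "0 \<le> h" for h
    proof -
      have "ennreal (J h) = P.rate_integral h"
        using P.rate_integral_finite[OF that] by (simp add: J_def less_top)
      also have "\<dots> = (\<integral>\<^sup>+r. ennreal (indicator {0<..} r * (exp (- r * h) * r powr (- 1))) \<partial>gamma_measure \<alpha>\<^sub>r \<beta>\<^sub>r)"
        unfolding P.rate_integral_def assms(4)[symmetric]
        by (intro nn_integral_cong) (auto simp: indicator_def powr_minus divide_inverse)
      finally show ?thesis .
    qed
    from gamma_transform_bigo[OF assms(8) _ _ this _ that] assms(6) show ?thesis
      by (simp add: J_def)
  qed
  have f: "f \<in> O(\<lambda>h. h powr (- \<alpha>\<^sub>R))"
    unfolding f_def[abs_def] divide_inverse using L[of 1] P.\<sigma>_pos by simp
  have g: "g \<in> O(\<lambda>h. h powr (- \<alpha>\<^sub>R))"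
    unfolding g_def[abs_def] using L[of "1/2"] by simp
  have k: "k \<in> O(\<lambda>h. h powr (- (\<alpha>\<^sub>r - 1)))"
    unfolding k_def[abs_def] using J[of "1/2"] by simp
  have k': "k \<in> O(\<lambda>h. h powr (- a))" if "a \<le> \<alpha>\<^sub>r - 1" for a
    by (rule landau_o.big_trans[OF k powr_bigo_mono[OF that]])
  have AC: "0 \<le> AC M X t h \<and> AC M X t h \<le> \<sigma>\<^sup>2 * f h + \<mu>\<^sup>2 * (g h + k h)"
    if S: "supOUSV \<nu> \<pi> \<rho> \<mu> \<sigma> M F N B X" and h: "0 \<le> h" for M F N B X t h
  proof -
    have "L h + \<mu>\<^sup>2 * (2 / (\<sigma>\<^sup>2 * P.stationary_mean) * P.drift_covariance_bound h) = \<sigma>\<^sup>2 * f h + \<mu>\<^sup>2 * (g h + k h)"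
      using P.\<sigma>_pos by (simp add: f_def g_def k_def K_def J_def L_def P.drift_covariance_bound_def algebra_simps)
    then show ?thesis
      using supOUSV.autocorrelation_bounds[OF S h, of t] by (simp add: AC_def L_def)
  qed
  have lim: "(AC M X t \<longlongrightarrow> 0) at_top" if S: "supOUSV \<nu> \<pi> \<rho> \<mu> \<sigma> M F N B X" for M F N B X t
  proof (rule tendsto_sandwich)
    show "\<forall>\<^sub>F h in at_top. 0 \<le> AC M X t h"
      using eventually_ge_at_top[of 0] by eventually_elim (use AC[OF S] in blast)
    show "\<forall>\<^sub>F h in at_top. AC M X t h \<le> \<sigma>\<^sup>2 * f h + \<mu>\<^sup>2 * (g h + k h)"
      using eventually_ge_at_top[of 0] by eventually_elim (use AC[OF S] in blast)
    have "((\<lambda>h. \<sigma>\<^sup>2 * f h + \<mu>\<^sup>2 * (g h + k h)) \<longlongrightarrow> \<sigma>\<^sup>2 * 0 + \<mu>\<^sup>2 * (0 + 0)) at_top"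
      using assms(6,7) by (intro tendsto_intros tendsto_0_of_bigo_powr[OF f] tendsto_0_of_bigo_powr[OF g]
          tendsto_0_of_bigo_powr[OF k])
    then show "((\<lambda>h. \<sigma>\<^sup>2 * f h + \<mu>\<^sup>2 * (g h + k h)) \<longlongrightarrow> 0) at_top" by simp
  qed simp
  have eta: "\<eta> \<le> \<alpha>\<^sub>r - 1"
    using assms(7) by (simp add: \<eta>_def divide_le_eq)
  have eta_pos: "\<eta> > 0" if "\<alpha>\<^sub>r \<in> {1<..2}"
    using assms(7,10) that by (simp add: \<eta>_def)
  have bound: "\<exists>f g k. f \<in> O(\<lambda>h. h powr (- \<alpha>\<^sub>R)) \<and> g \<in> O(\<lambda>h. h powr (- \<alpha>\<^sub>R)) \<and>
        k \<in> O(\<lambda>h. h powr (- a)) \<and>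
        (\<forall>M F N B X t. supOUSV \<nu> \<pi> \<rho> \<mu> \<sigma> M F N B X \<longrightarrow>
          (\<forall>h\<ge>0. AC M X t h \<le> \<sigma>\<^sup>2 * f h + \<mu>\<^sup>2 * (g h + k h)))" if "a \<le> \<alpha>\<^sub>r - 1" for a
    using AC by (intro exI[of _ f] exI[of _ g] exI[of _ k] conjI f g k'[OF that]) blast
  show ?thesis
    by (intro conjI impI allI lim bound eta eta_pos) simp_all
qed

end
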